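(* Let $R$ be a non-discrete irreducible, continuous ring. Every continuous homomorphism from $\mathrm{GL}(R)$ (with the rank topology) to a Hausdorff topological group with the escape property is trivial.
   Context: All rings are unital. A ring $R$ is regular if for every $a \in R$ there is $b \in R$ with $aba=a$. For a regular ring $R$, the set $L(R)=\{aR : a\in R\}$, ordered by inclusion, is a complemented modular lattice. A continuous ring is a regular ring $R$ such that the lattice $L(R)$ is complete and satisfies $I\wedge\bigvee C=\bigvee\{I\wedge J : J\in C\}$ and $I\vee\bigwedge C=\bigwedge\{I\vee J : J\in C\}$ for every chain $C\subseteq L(R)$ and every $I\in L(R)$. A ring is irreducible if it is non-zero and not isomorphic to a direct product of two non-zero rings. A rank function on a regular ring $R$ is a map $\rho\colon R\to[0,1]$ with $\rho(1)=1$, $\rho(ab)\le\min\{\rho(a),\rho(b)\}$ for all $a,b \in R$, $\rho(e+f)=\rho(e)+\rho(f)$ for any idempotents $e,f$ with $ef=fe=0$, and $\rho(a)=0$ only if $a=0$. Every irreducible, continuous ring $R$ has a unique rank function, denoted $\mathrm{rk}_R$; the rank metric is $d_R(a,b)=\mathrm{rk}_R(a-b)$, and the topology it generates is the rank topology. $R$ is non-discrete if its rank topology is not discrete. $\mathrm{GL}(R)$ denotes the group of units of $R$, a topological group with the rank topology. A length function on a group $G$ is a map $f\colon G\to\mathbb{R}$ with $f(e)=0$, $f(x^{-1})=f(x)\ge0$ and $f(xy)\le f(x)+f(y)$ for all $x,y\in G$. For a topological group $G$, a neighborhood $U$ of the neutral element is an escape neighborhood for a length function $f$ on $G$ if for every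 $\varepsilon>0$ there is $n\in\mathbb{N}$ such that $\{x\in G : x^1,\ldots,x^n\in U\}\subseteq f^{-1}([0,\varepsilon))$. An escape function on $G$ is a length function on $G$ possessing an escape neighborhood. $G$ has the escape property if for every neighborhood $U$ of the neutral element there is an escape function $f$ on $G$ with $f^{-1}([0,1))\subseteq U$. *)

theory Defs
  imports
    "HOL-Algebra.QuotRing"
    "HOL-Algebra.Chinese_Remainder"
    "HOL-Algebra.Complete_Lattice"
    "HOL-Analysis.Abstract_Metric_Spaces"
begin

section \<open>Irreducible continuous rings\<close>

text \<open>The library locale \<^locale>\<open>ring\<close> is unital, associative, and not assumed commutative.\<close>

definition regular_ring :: "('a, 'm) ring_scheme \<Rightarrow> bool" where
  "regular_ring R \<longleftrightarrow>
     ring R \<and> (\<forall>a\<in>carrier R. \<exists>b\<in>carrier R. a \<otimes>\<^bsub>R\<^esub> b \<otimes>\<^bsub>R\<^esub> a = a)"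

text \<open>The ordered set of principal right ideals \<open>aR\<close>, as a record for the order theory of
  HOL-Algebra; its meets, joins, infima and suprema are taken inside this carrier.\<close>

definition principal_right_ideals :: "('a, 'm) ring_scheme \<Rightarrow> 'a set gorder" where
  "principal_right_ideals R =
     \<lparr>carrier = {a <#\<^bsub>R\<^esub> carrier R | a. a \<in> carrier R}, eq = (=), le = (\<subseteq>)\<rparr>"

definition continuous_ring :: "('a, 'm) ring_scheme \<Rightarrow> bool" where
  "continuous_ring R \<longleftrightarrow>
     regular_ring R \<and>
     (let L = principal_right_ideals R in
        complete_lattice L \<and>
        (\<forall>C I. subset.chain (carrier L) C \<and> I \<in> carrier L \<longrightarrow>
           I \<sqinter>\<^bsub>L\<^esub> (\<Squnion>\<^bsub>L\<^esub> C) = \<Squnion>\<^bsub>L\<^esub> {I \<sqinter>\<^bsub>L\<^esub> J | J. J \<in> C} \<and>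
           I \<squnion>\<^bsub>L\<^esub> (\<Sqinter>\<^bsub>L\<^esub> C) = \<Sqinter>\<^bsub>L\<^esub> {I \<squnion>\<^bsub>L\<^esub> J | J. J \<in> C}))"

text \<open>The factors \<open>S\<close> and \<open>T\<close> may be taken over the element type of \<open>R\<close> without loss of
  generality: if \<open>R\<close> is isomorphic to a product of rings over any types, then each factor
  embeds (additively and multiplicatively) into \<open>R\<close>, so it has an isomorphic copy whose
  carrier is a subset of \<open>carrier R\<close>.\<close>

definition irreducible_ring :: "('a, 'm) ring_scheme \<Rightarrow> bool" where
  "irreducible_ring R \<longleftrightarrow>
     carrier R \<noteq> {\<zero>\<^bsub>R\<^esub>} \<and>
     \<not> (\<exists>(S :: 'a ring) (T :: 'a ring).
          ring S \<and> ring T \<and> carrier S \<noteq> {\<zero>\<^bsub>S\<^esub>} \<and> carrier T \<noteq> {\<zero>\<^bsub>T\<^esub>} \<and>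
          R \<simeq> RDirProd S T)"


section \<open>The rank function and the rank topology\<close>

text \<open>Rank functions are extensional functions on the carrier, so that uniqueness of the rank
  function can hold as an equality of functions and the description operator in \<open>rk\<close> is
  meaningful.\<close>

definition rank_function :: "('a, 'm) ring_scheme \<Rightarrow> ('a \<Rightarrow> real) \<Rightarrow> bool" where
  "rank_function R \<rho> \<longleftrightarrow>
     \<rho> \<in> carrier R \<rightarrow>\<^sub>E {0..1} \<and>
     \<rho> \<one>\<^bsub>R\<^esub> = 1 \<and>
     (\<forall>a\<in>carrier R. \<forall>b\<in>carrier R. \<rho> (a \<otimes>\<^bsub>R\<^esub> b) \<le> min (\<rho> a) (\<rho> b)) \<and>
     (\<forall>e\<in>carrier R. \<forall>f\<in>carrier R.
        e \<otimes>\<^bsub>R\<^esub> e = e \<and> f \<otimes>\<^bsub>R\<^esub> f = f \<and> e \<otimes>\<^bsub>R\<^esub> f = \<zero>\<^bsub>R\<^esub> \<and> f \<otimes>\<^bsub>R\<^esub> e = \<zero>\<^bsub>R\<^esub> \<longrightarrow>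
        \<rho> (e \<oplus>\<^bsub>R\<^esub> f) = \<rho> e + \<rho> f) \<and>
     (\<forall>a\<in>carrier R. \<rho> a = 0 \<longrightarrow> a = \<zero>\<^bsub>R\<^esub>)"

definition rk :: "('a, 'm) ring_scheme \<Rightarrow> 'a \<Rightarrow> real" where
  "rk R = (THE \<rho>. rank_function R \<rho>)"

text \<open>The value \<open>0\<close> off the carrier is irrelevant to the topology; it is there because
  \<^locale>\<open>Metric_space\<close> demands nonnegativity and symmetry on the whole type.\<close>

definition rank_dist :: "('a, 'm) ring_scheme \<Rightarrow> 'a \<Rightarrow> 'a \<Rightarrow> real" where
  "rank_dist R a b =
     (if a \<in> carrier R \<and> b \<in> carrier R then rk R (a \<ominus>\<^bsub>R\<^esub> b) else 0)"

definition rank_topology :: "('a, 'm) ring_scheme \<Rightarrow> 'a topology" where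
  "rank_topology R = Metric_space.mtopology (carrier R) (rank_dist R)"

definition nondiscrete_ring :: "('a, 'm) ring_scheme \<Rightarrow> bool" where
  "nondiscrete_ring R \<longleftrightarrow> rank_topology R \<noteq> discrete_topology (carrier R)"

text \<open>The group of units is \<^term>\<open>units_of R\<close>.\<close>

definition GL_topology :: "('a, 'm) ring_scheme \<Rightarrow> 'a topology" where
  "GL_topology R = subtopology (rank_topology R) (Units R)"


section \<open>Topological groups with the escape property\<close>

definition topological_group :: "('g, 'm) monoid_scheme \<Rightarrow> 'g topology \<Rightarrow> bool" where
  "topological_group G T \<longleftrightarrow>
     group G \<and> topspace T = carrier G \<and>
     continuous_map (prod_topology T T) T (\<lambda>(x, y). x \<otimes>\<^bsub>G\<^esub> y) \<and>
     continuous_map T T (\<lambda>x. inv\<^bsub>G\<^esub> x)"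

definition identity_neighborhood :: "('g, 'm) monoid_scheme \<Rightarrow> 'g topology \<Rightarrow> 'g set \<Rightarrow> bool" where
  "identity_neighborhood G T U \<longleftrightarrow>
     U \<subseteq> carrier G \<and> (\<exists>V. openin T V \<and> \<one>\<^bsub>G\<^esub> \<in> V \<and> V \<subseteq> U)"

text \<open>Length functions are not required to be continuous.\<close>

definition length_function :: "('g, 'm) monoid_scheme \<Rightarrow> ('g \<Rightarrow> real) \<Rightarrow> bool" where
  "length_function G f \<longleftrightarrow>
     f \<one>\<^bsub>G\<^esub> = 0 \<and>
     (\<forall>x\<in>carrier G. f (inv\<^bsub>G\<^esub> x) = f x \<and> 0 \<le> f x) \<and>
     (\<forall>x\<in>carrier G. \<forall>y\<in>carrier G. f (x \<otimes>\<^bsub>G\<^esub> y) \<le> f x + f y)"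

definition escape_neighborhood ::
  "('g, 'm) monoid_scheme \<Rightarrow> 'g topology \<Rightarrow> ('g \<Rightarrow> real) \<Rightarrow> 'g set \<Rightarrow> bool" where
  "escape_neighborhood G T f U \<longleftrightarrow>
     identity_neighborhood G T U \<and>
     (\<forall>\<epsilon>>0. \<exists>n::nat.
        {x \<in> carrier G. \<forall>k\<in>{1..n}. x [^]\<^bsub>G\<^esub> k \<in> U} \<subseteq> {x \<in> carrier G. f x \<in> {0..<\<epsilon>}})"

definition escape_function ::
  "('g, 'm) monoid_scheme \<Rightarrow> 'g topology \<Rightarrow> ('g \<Rightarrow> real) \<Rightarrow> bool" where
  "escape_function G T f \<longleftrightarrow> length_function G f \<and> (\<exists>U. escape_neighborhood G T f U)"

definition escape_property :: "('g, 'm) monoid_scheme \<Rightarrow> 'g topology \<Rightarrow> bool" where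
  "escape_property G T \<longleftrightarrow>
     (\<forall>U. identity_neighborhood G T U \<longrightarrow>
        (\<exists>f. escape_function G T f \<and> {x \<in> carrier G. f x \<in> {0..<1}} \<subseteq> U))"

end

theory Submission
  imports Defs "HOL-Analysis.Function_Topology"
begin

text \<open>A continuous homomorphism \<open>\<phi>\<close> followed by an escape function \<open>f\<close> vanishes on a
  neighbourhood \<open>{u. rk (u - 1) < d}\<close> of the identity, because \<open>rk (u\<^sup>k - 1) \<le> rk (u - 1)\<close>, so that all
  powers of such a \<open>u\<close> stay in the escape neighbourhood.  In the non-discrete case these \<open>u\<close>
  generate the group of units: given a unit \<open>u\<close> fixing an ideal \<open>P\<close> pointwise and a small ideal \<open>A\<close>
  independent of \<open>P\<close>, there is a unit \<open>h\<close> close to \<open>1\<close> agreeing with \<open>u\<close> on \<open>P + A\<close>, and \<open>h\<^sup>-\<^sup>1 u\<close> fixes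
  more than \<open>u\<close> does.  Hence \<open>f \<circ> \<phi> = 0\<close> for all escape functions, and \<open>\<phi>\<close> is trivial.

  As \<open>rk\<close> is a definite description, existence and uniqueness of the rank function are needed.
  They follow from von Neumann's theory: principal right ideals are comparable up to isomorphism,
  isomorphic ideals \<open>X \<supseteq> Y\<close> are equal, and the dimension of \<open>B\<close> is the limit of the numbers of
  independent copies of a small \<open>A\<close> in \<open>B\<close>, relative to the number in the whole ring.\<close>

section \<open>Principal right ideals\<close>

text \<open>Module maps never appear: a principal right ideal of a regular ring is a direct summand,
  so every map between two of them is left multiplication by a ring element, and maps given on
  independent ideals combine to one such multiplication. The obstacle in the generation argument is
  invertibility. The obvious choice, \<open>u\<close> on \<open>A\<close> and the identity on a
  complement of \<open>A\<close> containing \<open>P\<close>, is close to \<open>1\<close> but may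
  have a kernel. It is repaired by sending this kernel isomorphically onto a complement of the
  image; this requires that the two have equal dimension and that equal dimension implies
  isomorphism, so comparability and direct finiteness serve here again. The repair moves a second
  ideal no larger than \<open>A\<close>, so \<open>h\<close> is within \<open>2 * D A\<close> of
  \<open>1\<close>, and non-discreteness supplies a non-zero \<open>A\<close> with
  \<open>2 * D A < d\<close>. The process ends because finitely many multiples of \<open>D A\<close>
  exceed 1. Irreducibility acts through primeness, which gives non-zero maps between any two
  non-zero ideals and hence comparability.\<close>

no_notation Sum_Type.Plus (infixr "<+>" 65)

context ring
begin

text \<open>The carrier of \<open>principal_right_ideals R\<close> as a bare family of sets, so that
  ideals can be handled by inclusion, intersection and elementwise sum.\<close>

definition PR :: "'a set set" where
  "PR = {a <# carrier R | a. a \<in> carrier R}"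

lemma mem_lcos: "x \<in> s <# A \<longleftrightarrow> (\<exists>a\<in>A. x = s \<otimes> a)"
  by (auto simp: l_coset_def)

lemma mem_set_add: "x \<in> A <+> B \<longleftrightarrow> (\<exists>a\<in>A. \<exists>b\<in>B. x = a \<oplus> b)"
  by (auto simp: set_add_def')

lemma PR_subset: "A \<in> PR \<Longrightarrow> A \<subseteq> carrier R"
  by (auto simp: PR_def mem_lcos)

lemma PR_closed: "A \<in> PR \<Longrightarrow> x \<in> A \<Longrightarrow> x \<in> carrier R"
  using PR_subset by blast

lemma PR_zero: "A \<in> PR \<Longrightarrow> \<zero> \<in> A"
  by (auto simp: PR_def mem_lcos intro!: bexI[of _ \<zero>])

lemma PR_add: "A \<in> PR \<Longrightarrow> x \<in> A \<Longrightarrow> y \<in> A \<Longrightarrow> x \<oplus> y \<in> A"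
  by (auto simp: PR_def mem_lcos) (metis add.m_closed r_distr)

lemma PR_mult: "A \<in> PR \<Longrightarrow> x \<in> A \<Longrightarrow> r \<in> carrier R \<Longrightarrow> x \<otimes> r \<in> A"
  by (auto simp: PR_def mem_lcos) (metis m_assoc m_closed)

lemma PR_neg: "A \<in> PR \<Longrightarrow> x \<in> A \<Longrightarrow> \<ominus> x \<in> A"
  by (auto simp: PR_def mem_lcos) (metis a_inv_closed r_minus)

lemma PR_minus: "A \<in> PR \<Longrightarrow> x \<in> A \<Longrightarrow> y \<in> A \<Longrightarrow> x \<ominus> y \<in> A"
  by (simp add: a_minus_def PR_add PR_neg)

lemma PR_principal: "a \<in> carrier R \<Longrightarrow> a <# carrier R \<in> PR"
  by (auto simp: PR_def)

lemma lcos_lcos: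
  "s \<in> carrier R \<Longrightarrow> t \<in> carrier R \<Longrightarrow> A \<subseteq> carrier R \<Longrightarrow> s <# (t <# A) = (s \<otimes> t) <# A"
  by (auto simp: l_coset_def m_assoc subset_iff)

lemma lcos_mono: "A \<subseteq> B \<Longrightarrow> s <# A \<subseteq> s <# B"
  by (auto simp: l_coset_def)

lemma lcos_PR: "s \<in> carrier R \<Longrightarrow> A \<in> PR \<Longrightarrow> s <# A \<in> PR"
  by (auto simp: PR_def lcos_lcos)

lemma carrier_PR: "carrier R \<in> PR"
  by (auto simp: PR_def mem_lcos l_coset_def intro!: exI[of _ \<one>])

lemma zero_PR: "{\<zero>} \<in> PR"
  by (auto simp: PR_def l_coset_def intro!: exI[of _ \<zero>])

lemma lcos_one: "A \<subseteq> carrier R \<Longrightarrow> \<one> <# A = A"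
  by (force simp: l_coset_def subset_iff)

lemma set_add_subset: "A \<in> PR \<Longrightarrow> B \<in> PR \<Longrightarrow> A <+> B \<subseteq> carrier R"
  by (auto simp: mem_set_add PR_closed)

lemma set_add_comm: "A \<in> PR \<Longrightarrow> B \<in> PR \<Longrightarrow> A <+> B = B <+> A"
  by (auto simp: mem_set_add) (metis PR_closed a_comm)+

lemma set_add_assoc:
  assumes "A \<in> PR" "B \<in> PR" "C \<in> PR" shows "(A <+> B) <+> C = A <+> (B <+> C)"
proof -
  have *: "a \<oplus> b \<oplus> c = a \<oplus> (b \<oplus> c)" if "a \<in> A" "b \<in> B" "c \<in> C" for a b c
    using that assms by (simp add: PR_closed a_assoc)
  have "x \<in> (A <+> B) <+> C \<longleftrightarrow> (\<exists>a\<in>A. \<exists>b\<in>B. \<exists>c\<in>C. x = a \<oplus> b \<oplus> c)" for x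
    unfolding Bex_def mem_set_add by blast
  moreover have "x \<in> A <+> (B <+> C) \<longleftrightarrow> (\<exists>a\<in>A. \<exists>b\<in>B. \<exists>c\<in>C. x = a \<oplus> (b \<oplus> c))" for x
    unfolding Bex_def mem_set_add by blast
  ultimately show ?thesis using * by (simp add: set_eq_iff)
qed

lemma set_add_mono: "A \<subseteq> A' \<Longrightarrow> B \<subseteq> B' \<Longrightarrow> A <+> B \<subseteq> A' <+> B'"
  by (auto simp: mem_set_add subset_iff)

lemma subset_set_add1: "A \<in> PR \<Longrightarrow> B \<in> PR \<Longrightarrow> A \<subseteq> A <+> B"
  by (auto simp: mem_set_add) (metis PR_closed PR_zero r_zero)

lemma subset_set_add2: "A \<in> PR \<Longrightarrow> B \<in> PR \<Longrightarrow> B \<subseteq> A <+> B"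
  by (auto simp: mem_set_add) (metis PR_closed PR_zero l_zero)

lemma set_add_least: "A \<subseteq> C \<Longrightarrow> B \<subseteq> C \<Longrightarrow> C \<in> PR \<Longrightarrow> A <+> B \<subseteq> C"
  by (auto simp: mem_set_add subset_iff PR_add)

lemma set_add_zero: "A \<in> PR \<Longrightarrow> A <+> {\<zero>} = A" "A \<in> PR \<Longrightarrow> {\<zero>} <+> A = A"
  using PR_closed by (auto simp: set_eq_iff mem_set_add)

lemma minus_zero_iff:
  assumes "a \<in> carrier R" "b \<in> carrier R" shows "a \<ominus> b = \<zero> \<longleftrightarrow> a = b"
proof
  assume "a \<ominus> b = \<zero>"
  moreover have "a = (a \<ominus> b) \<oplus> b" using assms by algebra
  ultimately show "a = b" using assms by simp
qed (use assms in \<open>simp add: a_minus_def r_neg\<close>)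

lemma indepD:
  assumes "A \<in> PR" "B \<in> PR" "A \<inter> B = {\<zero>}" "a \<in> A" "b \<in> B" "a \<oplus> b = \<zero>"
  shows "a = \<zero>" "b = \<zero>"
proof -
  have c: "a \<in> carrier R" "b \<in> carrier R" using assms PR_closed by auto
  then have "a = \<ominus> b" using assms(6) minus_equality by auto
  then have "a \<in> A \<inter> B" using assms PR_neg by auto
  then show "a = \<zero>" using assms by auto
  then show "b = \<zero>" using assms(6) c by auto
qed

lemma indepI:
  assumes "A \<in> PR" "B \<in> PR" "\<And>x. x \<in> A \<Longrightarrow> x \<in> B \<Longrightarrow> x = \<zero>"
  shows "A \<inter> B = {\<zero>}"
  using assms PR_zero by blast

lemma indep_mono:
  assumes "A \<inter> B = {\<zero>}" "A' \<subseteq> A" "B' \<subseteq> B" "A' \<in> PR" "B' \<in> PR"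
  shows "A' \<inter> B' = {\<zero>}"
  by (rule indepI) (use assms in auto)

lemma indep_unique:
  assumes "A \<in> PR" "B \<in> PR" "A \<inter> B = {\<zero>}" "a \<in> A" "b \<in> B" "a' \<in> A" "b' \<in> B" "a \<oplus> b = a' \<oplus> b'"
  shows "a = a'" "b = b'"
proof -
  have c: "a \<in> carrier R" "b \<in> carrier R" "a' \<in> carrier R" "b' \<in> carrier R" using assms PR_closed by auto
  have "(a \<ominus> a') \<oplus> (b \<ominus> b') = (a \<oplus> b) \<ominus> (a' \<oplus> b')" using c by algebra
  also have "\<dots> = \<zero>" using assms(8) c by (simp add: a_minus_def r_neg)
  finally have "a \<ominus> a' = \<zero>" "b \<ominus> b' = \<zero>"
    using indepD[OF assms(1-3), of "a \<ominus> a'" "b \<ominus> b'"] assms PR_minus by auto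
  then show "a = a'" "b = b'" using c by (auto simp: minus_zero_iff)
qed

text \<open>If \<open>x = b + c\<close> lies in \<open>A\<close>, then \<open>c = x - b\<close> lies
  in \<open>A <+> B\<close>, hence is zero. The sums are assumed principal because closure of
  \<open>PR\<close> under sums rests on regularity, which this context does not have.\<close>

lemma indep_assoc:
  assumes "A \<in> PR" "B \<in> PR" "C \<in> PR" "A <+> B \<in> PR" "B <+> C \<in> PR"
    and "A \<inter> B = {\<zero>}" "(A <+> B) \<inter> C = {\<zero>}"
  shows "A \<inter> (B <+> C) = {\<zero>}" "B \<inter> C = {\<zero>}"
proof -
  show "B \<inter> C = {\<zero>}"
    by (rule indep_mono[OF assms(7)]) (use assms subset_set_add2 in auto)
  show "A \<inter> (B <+> C) = {\<zero>}"
  proof (rule indepI[OF assms(1,5)])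
    fix x assume x: "x \<in> A" "x \<in> B <+> C"
    then obtain b c where bc: "b \<in> B" "c \<in> C" "x = b \<oplus> c" by (auto simp: mem_set_add)
    have cl: "x \<in> carrier R" "b \<in> carrier R" "c \<in> carrier R" using x bc assms PR_closed by auto
    have "c = x \<oplus> (\<ominus> b)" unfolding bc(3) using cl by algebra
    then have "c \<in> A <+> B" using x(1) PR_neg[OF assms(2) bc(1)] unfolding mem_set_add by blast
    then have "c = \<zero>" using assms(7) bc by blast
    then have "x \<in> A \<inter> B" using bc cl x by auto
    then show "x = \<zero>" using assms(6) by auto
  qed
qed

end

text \<open>Completeness takes the form of closure under intersections: an infimum of principal
  right ideals must contain \<open>x R\<close> for every common element \<open>x\<close>, so it is
  the intersection.\<close>

locale complete_regular_ring = ring +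
  assumes regular: "a \<in> carrier R \<Longrightarrow> \<exists>b\<in>carrier R. a \<otimes> b \<otimes> a = a"
    and Inter_PR: "\<A> \<subseteq> PR \<Longrightarrow> \<A> \<noteq> {} \<Longrightarrow> \<Inter>\<A> \<in> PR"
begin

section \<open>Idempotents, complements, kernels and gluing\<close>

lemma inter_PR: "A \<in> PR \<Longrightarrow> B \<in> PR \<Longrightarrow> A \<inter> B \<in> PR"
  using Inter_PR[of "{A, B}"] by auto

text \<open>If \<open>a b a = a\<close>, then \<open>a b\<close> is an idempotent generating
  \<open>a R\<close>. Its value is the left identity it provides on \<open>A\<close>, which makes
  \<open>A\<close> a direct summand.\<close>

lemma PR_idem:
  assumes "A \<in> PR"
  obtains e where "e \<in> carrier R" "e \<otimes> e = e" "e \<in> A" "\<And>x. x \<in> A \<Longrightarrow> e \<otimes> x = x" "A = e <# carrier R"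
proof -
  obtain a where a: "a \<in> carrier R" "A = a <# carrier R" using assms by (auto simp: PR_def)
  obtain b where b: "b \<in> carrier R" "a \<otimes> b \<otimes> a = a" using regular a by blast
  let ?e = "a \<otimes> b"
  have e: "?e \<in> A" using a b by (auto simp: mem_lcos)
  have fx: "?e \<otimes> x = x" if x: "x \<in> A" for x
  proof -
    obtain r where r: "r \<in> carrier R" "x = a \<otimes> r" using x a by (auto simp: mem_lcos)
    have "?e \<otimes> x = (a \<otimes> b \<otimes> a) \<otimes> r" unfolding r(2) using r(1) a(1) b(1) by algebra
    then show ?thesis using b r by simp
  qed
  have "A = ?e <# carrier R"
    using fx e PR_closed[OF assms] PR_mult[OF assms] by (force simp: mem_lcos)
  then show thesis using that[of ?e] e fx a b by auto
qed

text \<open>Peirce decomposition \<open>b = e b + (1 - e) b\<close> for an idempotent generator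
  \<open>e\<close> of \<open>A\<close>; the second summand stays in \<open>B\<close> because
  \<open>e b\<close> lies in \<open>A\<close> and \<open>A\<close> is contained in
  \<open>B\<close>.\<close>

lemma complement:
  assumes "A \<in> PR" "B \<in> PR" "A \<subseteq> B"
  obtains C where "C \<in> PR" "C \<subseteq> B" "A \<inter> C = {\<zero>}" "A <+> C = B"
proof -
  obtain e where e: "e \<in> carrier R" "e \<otimes> e = e" "e \<in> A" "\<And>x. x \<in> A \<Longrightarrow> e \<otimes> x = x"
    using PR_idem[OF assms(1)] by metis
  let ?C = "(\<one> \<ominus> e) <# B"
  have C: "?C \<in> PR" using e assms by (intro lcos_PR) auto
  have form: "(\<one> \<ominus> e) \<otimes> b = b \<ominus> e \<otimes> b" if "b \<in> carrier R" for b
    using e that by algebra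
  have ez: "e \<otimes> ((\<one> \<ominus> e) \<otimes> b) = \<zero>" if b: "b \<in> carrier R" for b
  proof -
    have "e \<otimes> ((\<one> \<ominus> e) \<otimes> b) = e \<otimes> b \<ominus> (e \<otimes> e) \<otimes> b" using e(1) b by algebra
    then show ?thesis using e b by (simp add: minus_zero_iff)
  qed
  have eB: "e \<otimes> b \<in> A" if "b \<in> carrier R" for b using PR_mult[OF assms(1) e(3)] that by auto
  have sub: "?C \<subseteq> B"
    using form eB PR_closed[OF assms(2)] PR_minus[OF assms(2)] subsetD[OF assms(3)] by (auto simp: mem_lcos)
  have ind: "A \<inter> ?C = {\<zero>}"
    using e(4) ez PR_closed[OF assms(2)] by (intro indepI[OF assms(1) C]) (auto simp: mem_lcos, metis)
  have "B \<subseteq> A <+> ?C"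
  proof
    fix b assume b: "b \<in> B"
    have bc: "b \<in> carrier R" using b PR_closed assms by auto
    have "b = e \<otimes> b \<oplus> ((\<one> \<ominus> e) \<otimes> b)" using bc e(1) by algebra
    moreover have "(\<one> \<ominus> e) \<otimes> b \<in> ?C" using b unfolding mem_lcos by blast
    ultimately show "b \<in> A <+> ?C" using eB[OF bc] unfolding mem_set_add by blast
  qed
  then have "A <+> ?C = B" using set_add_least[OF assms(3) sub assms(2)] by auto
  then show thesis using that C sub ind by auto
qed

text \<open>Modulo \<open>A = e R\<close> the ideal \<open>B\<close> may be replaced by
  \<open>(1 - e) B = g R\<close>, for which \<open>e g = 0\<close>. A single generator is then built
  from the two idempotents.\<close>

lemma set_add_PR:
  assumes "A \<in> PR" "B \<in> PR" shows "A <+> B \<in> PR"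
proof -
  obtain e where e: "e \<in> carrier R" "e \<otimes> e = e" "e \<in> A" "\<And>x. x \<in> A \<Longrightarrow> e \<otimes> x = x" "A = e <# carrier R"
    using PR_idem[OF assms(1)] by metis
  let ?B = "(\<one> \<ominus> e) <# B"
  have "?B \<in> PR" using e assms lcos_PR by auto
  then obtain g where g: "g \<in> carrier R" "g \<otimes> g = g" "g \<in> ?B" "\<And>x. x \<in> ?B \<Longrightarrow> g \<otimes> x = x"
    "?B = g <# carrier R"
    using PR_idem by metis
  obtain b where b: "b \<in> B" "g = (\<one> \<ominus> e) \<otimes> b" using g(3) unfolding mem_lcos by blast
  have bc: "b \<in> carrier R" using b assms PR_closed by auto
  have "e \<otimes> g = e \<otimes> b \<ominus> e \<otimes> e \<otimes> b" unfolding b(2) using e(1) bc by algebra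
  then have eg: "e \<otimes> g = \<zero>" using e bc by (simp add: minus_zero_iff)
  \<comment> \<open>Only \<open>e g = 0\<close> is known, not \<open>g e = 0\<close>; subtracting
    \<open>g e\<close> gives \<open>h e = e\<close> and \<open>h g = g\<close>, so \<open>h\<close>
    is a left identity on both summands.\<close>
  define h where "h = e \<oplus> g \<ominus> g \<otimes> e"
  have h: "h \<in> carrier R" using e g by (auto simp: h_def)
  have "h \<otimes> e = e \<otimes> e \<oplus> g \<otimes> e \<ominus> g \<otimes> (e \<otimes> e)" unfolding h_def using e(1) g(1) by algebra
  then have he: "h \<otimes> e = e" unfolding e(2) using e(1) g(1) by algebra
  have "h \<otimes> g = e \<otimes> g \<oplus> g \<otimes> g \<ominus> g \<otimes> (e \<otimes> g)" unfolding h_def using e(1) g(1) by algebra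
  then have hg: "h \<otimes> g = g" unfolding eg g(2) using e(1) g(1) by algebra
  have "A <+> B = h <# carrier R"
  proof (rule Set.set_eqI, rule iffI)
    fix x assume "x \<in> A <+> B"
    then obtain a y where x: "a \<in> A" "y \<in> B" "x = a \<oplus> y" by (auto simp: mem_set_add)
    have c: "a \<in> carrier R" "y \<in> carrier R" using x assms PR_closed by auto
    obtain r where r: "r \<in> carrier R" "(\<one> \<ominus> e) \<otimes> y = g \<otimes> r"
      using g(5) x(2) by (auto simp: mem_lcos set_eq_iff)
    have y: "y = e \<otimes> y \<oplus> g \<otimes> r" unfolding r(2)[symmetric] using c e(1) by algebra
    have a: "a = e \<otimes> a" using e(4) x by simp
    have xx: "x = e \<otimes> a \<oplus> (e \<otimes> y \<oplus> g \<otimes> r)" unfolding x(3) using a y by simp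
    have "h \<otimes> x = (h \<otimes> e) \<otimes> a \<oplus> ((h \<otimes> e) \<otimes> y \<oplus> (h \<otimes> g) \<otimes> r)"
      unfolding xx using h c e(1) g(1) r(1) by algebra
    then have "h \<otimes> x = x" unfolding he hg using xx by simp
    then show "x \<in> h <# carrier R" using x c by (auto simp: mem_lcos intro!: bexI[of _ x])
  next
    fix x assume "x \<in> h <# carrier R"
    then obtain r where r: "r \<in> carrier R" "x = h \<otimes> r" by (auto simp: mem_lcos)
    \<comment> \<open>Here \<open>h r = e r + g (r - e r)\<close>; inserting
      \<open>g = (1 - e) b\<close> and collecting the terms that begin with \<open>e\<close> gives a
      member of \<open>A\<close> plus a member of \<open>B\<close>.\<close>
    have "x = e \<otimes> (r \<ominus> b \<otimes> r \<oplus> b \<otimes> (e \<otimes> r)) \<oplus> b \<otimes> (r \<ominus> e \<otimes> r)"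
      unfolding r(2) h_def b(2) using e(1) bc r(1) by algebra
    moreover have "e \<otimes> (r \<ominus> b \<otimes> r \<oplus> b \<otimes> (e \<otimes> r)) \<in> A" using PR_mult[OF assms(1) e(3)] e bc r by auto
    moreover have "b \<otimes> (r \<ominus> e \<otimes> r) \<in> B" using PR_mult[OF assms(2) b(1)] e bc r by auto
    ultimately show "x \<in> A <+> B" by (auto simp: mem_set_add)
  qed
  then show ?thesis using h PR_principal by simp
qed

text \<open>If \<open>s q s = s\<close>, then \<open>q s\<close> is idempotent with the same right
  annihilator as \<open>s\<close>, and that annihilator is generated by
  \<open>1 - q s\<close>.\<close>

lemma kernel_PR:
  assumes "s \<in> carrier R" shows "{x \<in> carrier R. s \<otimes> x = \<zero>} \<in> PR"
proof -
  obtain q where q: "q \<in> carrier R" "s \<otimes> q \<otimes> s = s" using regular assms by blast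
  have "{x \<in> carrier R. s \<otimes> x = \<zero>} = (\<one> \<ominus> q \<otimes> s) <# carrier R"
  proof (rule Set.set_eqI, rule iffI)
    fix x assume "x \<in> {x \<in> carrier R. s \<otimes> x = \<zero>}"
    then have x: "x \<in> carrier R" "s \<otimes> x = \<zero>" by auto
    have "(\<one> \<ominus> q \<otimes> s) \<otimes> x = x \<ominus> q \<otimes> (s \<otimes> x)" using x(1) q(1) assms by algebra
    then have "(\<one> \<ominus> q \<otimes> s) \<otimes> x = x" unfolding x(2) using x(1) q(1) by algebra
    then show "x \<in> (\<one> \<ominus> q \<otimes> s) <# carrier R" using x by (auto simp: mem_lcos intro!: bexI[of _ x])
  next
    fix x assume "x \<in> (\<one> \<ominus> q \<otimes> s) <# carrier R"
    then obtain r where r: "r \<in> carrier R" "x = (\<one> \<ominus> q \<otimes> s) \<otimes> r" by (auto simp: mem_lcos)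
    have "s \<otimes> x = s \<otimes> r \<ominus> (s \<otimes> q \<otimes> s) \<otimes> r" unfolding r(2) using r(1) q(1) assms by algebra
    then have "s \<otimes> x = \<zero>" unfolding q(2) using r(1) assms by (simp add: minus_zero_iff)
    then show "x \<in> {x \<in> carrier R. s \<otimes> x = \<zero>}" using r q assms by auto
  qed
  then show ?thesis using PR_principal q assms by auto
qed

text \<open>The component \<open>p\<close> of \<open>1\<close> in \<open>A\<close> works:
  \<open>x = p x + (1 - p) x\<close> is the decomposition of \<open>x\<close>, and decompositions
  are unique.\<close>

lemma projection:
  assumes "A \<in> PR" "B \<in> PR" "A \<inter> B = {\<zero>}" "A <+> B = carrier R"
  obtains p where "p \<in> carrier R" "p \<in> A" "\<one> \<ominus> p \<in> B"
    "\<And>x. x \<in> A \<Longrightarrow> p \<otimes> x = x" "\<And>x. x \<in> B \<Longrightarrow> p \<otimes> x = \<zero>"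
proof -
  have "\<one> \<in> A <+> B" using assms by auto
  then obtain p q where pq: "p \<in> A" "q \<in> B" "\<one> = p \<oplus> q" by (auto simp: mem_set_add)
  have c: "p \<in> carrier R" "q \<in> carrier R" using pq assms PR_closed by auto
  have q: "\<one> \<ominus> p = q" unfolding pq(3) using c by algebra
  have split: "p \<otimes> x \<oplus> q \<otimes> x = x" if "x \<in> carrier R" for x
    using l_distr[OF c that] pq(3)[symmetric] that by simp
  have A: "p \<otimes> x = x" if x: "x \<in> A" for x
  proof -
    have xc: "x \<in> carrier R" using x assms PR_closed by auto
    have "p \<otimes> x \<oplus> q \<otimes> x = x \<oplus> \<zero>" using split xc by simp
    then show ?thesis
      using indep_unique(1)[OF assms(1-3), of "p \<otimes> x" "q \<otimes> x" x \<zero>] x xc pq PR_mult PR_zero assms by auto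
  qed
  have B: "p \<otimes> x = \<zero>" if x: "x \<in> B" for x
  proof -
    have xc: "x \<in> carrier R" using x assms PR_closed by auto
    have "p \<otimes> x \<oplus> q \<otimes> x = \<zero> \<oplus> x" using split xc by simp
    then show ?thesis
      using indep_unique(1)[OF assms(1-3), of "p \<otimes> x" "q \<otimes> x" \<zero> x] x xc pq PR_mult PR_zero assms by auto
  qed
  show thesis using that[of p] c pq q A B by auto
qed

text \<open>The complement of \<open>A\<close> is chosen to contain \<open>B\<close>, so that the
  projection onto \<open>A\<close> along it kills \<open>B\<close>.\<close>

lemma complement_carrier:
  assumes "A \<in> PR" "B \<in> PR" "A \<inter> B = {\<zero>}"
  obtains C where "C \<in> PR" "B \<subseteq> C" "A \<inter> C = {\<zero>}" "A <+> C = carrier R"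
proof -
  have AB: "A <+> B \<in> PR" using set_add_PR assms by auto
  obtain D where D: "D \<in> PR" "(A <+> B) \<inter> D = {\<zero>}" "(A <+> B) <+> D = carrier R"
    using complement[OF AB carrier_PR set_add_subset] assms by metis
  have BD: "B <+> D \<in> PR" using set_add_PR assms D by auto
  show thesis
    using that[OF BD subset_set_add1[OF assms(2) D(1)] indep_assoc(1)[OF assms(1,2) D(1) AB BD assms(3) D(2)]]
      D(3) set_add_assoc assms D(1) by auto
qed

text \<open>The element \<open>s p + t (1 - p)\<close>, with \<open>p\<close> the projection onto
  \<open>A\<close> along a complement containing \<open>B\<close>. This is the source of all maps
  that are prescribed piecewise.\<close>

lemma glue:
  assumes "A \<in> PR" "B \<in> PR" "A \<inter> B = {\<zero>}" "s \<in> carrier R" "t \<in> carrier R"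
  obtains u where "u \<in> carrier R" "\<And>x. x \<in> A \<Longrightarrow> u \<otimes> x = s \<otimes> x" "\<And>x. x \<in> B \<Longrightarrow> u \<otimes> x = t \<otimes> x"
proof -
  obtain C where C: "C \<in> PR" "B \<subseteq> C" "A \<inter> C = {\<zero>}" "A <+> C = carrier R"
    using complement_carrier[OF assms(1-3)] by metis
  obtain p where p: "p \<in> carrier R" "\<And>x. x \<in> A \<Longrightarrow> p \<otimes> x = x" "\<And>x. x \<in> C \<Longrightarrow> p \<otimes> x = \<zero>"
    using projection[OF assms(1) C(1,3,4)] by metis
  let ?u = "s \<otimes> p \<oplus> t \<otimes> (\<one> \<ominus> p)"
  have f: "?u \<otimes> x = s \<otimes> (p \<otimes> x) \<oplus> t \<otimes> (x \<ominus> p \<otimes> x)" if "x \<in> carrier R" for x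
    using that p(1) assms(4,5) by algebra
  have "?u \<otimes> x = s \<otimes> x" if x: "x \<in> A" for x
  proof -
    have "x \<in> carrier R" using x assms PR_closed by auto
    then show ?thesis using f p(2)[OF x] assms by (simp add: a_minus_def r_neg)
  qed
  moreover have "?u \<otimes> x = t \<otimes> x" if x: "x \<in> B" for x
  proof -
    have "x \<in> carrier R" using x assms PR_closed by auto
    then show ?thesis using f p(3) C(2) x assms by (auto simp: a_minus_def)
  qed
  ultimately show thesis using that[of ?u] p assms by auto
qed

end

context ring
begin

lemma lcosI: "a \<in> A \<Longrightarrow> s \<otimes> a \<in> s <# A"
  by (auto simp: mem_lcos)

lemma set_addI: "a \<in> A \<Longrightarrow> b \<in> B \<Longrightarrow> a \<oplus> b \<in> A <+> B"
  by (auto simp: mem_set_add)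

section \<open>Isomorphism and comparability\<close>

text \<open>Isomorphism of right modules: a linear map on \<open>e R\<close> is left multiplication
  by the image of \<open>e\<close>, so requiring a multiplier from the ring loses no
  isomorphism.\<close>

definition piso :: "'a set \<Rightarrow> 'a set \<Rightarrow> bool" where
  "piso A B \<longleftrightarrow> A \<in> PR \<and> B \<in> PR \<and>
     (\<exists>s\<in>carrier R. s <# A = B \<and> (\<forall>x\<in>A. s \<otimes> x = \<zero> \<longrightarrow> x = \<zero>))"

definition emb :: "'a set \<Rightarrow> 'a set \<Rightarrow> bool" where
  "emb A B \<longleftrightarrow> (\<exists>B'\<subseteq>B. piso A B')"

lemma piso_PR: "piso A B \<Longrightarrow> A \<in> PR" "piso A B \<Longrightarrow> B \<in> PR"
  by (auto simp: piso_def)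

lemma emb_PR: "emb A B \<Longrightarrow> A \<in> PR"
  by (auto simp: emb_def piso_def)

lemma pisoI:
  "s \<in> carrier R \<Longrightarrow> A \<in> PR \<Longrightarrow> (\<And>x. x \<in> A \<Longrightarrow> s \<otimes> x = \<zero> \<Longrightarrow> x = \<zero>) \<Longrightarrow> piso A (s <# A)"
  by (auto simp: piso_def lcos_PR)

lemma piso_refl: "A \<in> PR \<Longrightarrow> piso A A"
  using pisoI[of \<one> A] lcos_one[OF PR_subset] PR_closed by force

lemma piso_trans:
  assumes "piso A B" "piso B C" shows "piso A C"
proof -
  obtain s where s: "s \<in> carrier R" "s <# A = B" "\<And>x. x \<in> A \<Longrightarrow> s \<otimes> x = \<zero> \<Longrightarrow> x = \<zero>"
    using assms(1) unfolding piso_def by blast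
  obtain t where t: "t \<in> carrier R" "t <# B = C" "\<And>x. x \<in> B \<Longrightarrow> t \<otimes> x = \<zero> \<Longrightarrow> x = \<zero>"
    using assms(2) unfolding piso_def by blast
  have A: "A \<in> PR" using assms(1) piso_PR by auto
  have "piso A ((t \<otimes> s) <# A)"
  proof (rule pisoI)
    fix x assume x: "x \<in> A" "t \<otimes> s \<otimes> x = \<zero>"
    have "t \<otimes> (s \<otimes> x) = \<zero>" using x s(1) t(1) PR_closed[OF A] by (simp add: m_assoc)
    moreover have "s \<otimes> x \<in> B" using s(2) x(1) by (auto simp: mem_lcos)
    ultimately show "x = \<zero>" using s(3) t(3) x(1) by blast
  qed (use s t A in auto)
  moreover have "(t \<otimes> s) <# A = C" using lcos_lcos[OF t(1) s(1) PR_subset[OF A]] s(2) t(2) by simp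
  ultimately show ?thesis by simp
qed

lemma lcos_inj:
  assumes "A \<in> PR" "s \<in> carrier R" "\<And>x. x \<in> A \<Longrightarrow> s \<otimes> x = \<zero> \<Longrightarrow> x = \<zero>"
    and "x \<in> A" "y \<in> A" "s \<otimes> x = s \<otimes> y"
  shows "x = y"
proof -
  have c: "x \<in> carrier R" "y \<in> carrier R" using assms PR_closed by auto
  have "s \<otimes> (x \<ominus> y) = s \<otimes> x \<ominus> s \<otimes> y" using c assms(2) by algebra
  then have "s \<otimes> (x \<ominus> y) = \<zero>" using assms(6) c assms(2) by (simp add: a_minus_def r_neg)
  then have "x \<ominus> y = \<zero>" using assms PR_minus by blast
  then show ?thesis using minus_zero_iff c by simp
qed

lemma lcos_set_add:
  assumes "A \<in> PR" "B \<in> PR" "s \<in> carrier R" shows "s <# (A <+> B) = (s <# A) <+> (s <# B)"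
proof -
  have *: "s \<otimes> (a \<oplus> b) = s \<otimes> a \<oplus> s \<otimes> b" if "a \<in> A" "b \<in> B" for a b
    using that assms by (simp add: PR_closed r_distr)
  have "x \<in> s <# (A <+> B) \<longleftrightarrow> (\<exists>a\<in>A. \<exists>b\<in>B. x = s \<otimes> (a \<oplus> b))" for x
    unfolding Bex_def mem_set_add mem_lcos by blast
  moreover have "x \<in> (s <# A) <+> (s <# B) \<longleftrightarrow> (\<exists>a\<in>A. \<exists>b\<in>B. x = s \<otimes> a \<oplus> s \<otimes> b)" for x
    unfolding Bex_def mem_set_add mem_lcos by blast
  ultimately show ?thesis using * by (simp add: set_eq_iff)
qed

lemma lcos_indep:
  assumes "A \<in> PR" "B \<in> PR" "C \<in> PR" "A \<subseteq> C" "B \<subseteq> C" "A \<inter> B = {\<zero>}"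
    and "s \<in> carrier R" "\<And>x. x \<in> C \<Longrightarrow> s \<otimes> x = \<zero> \<Longrightarrow> x = \<zero>"
  shows "(s <# A) \<inter> (s <# B) = {\<zero>}"
proof (rule indepI)
  fix x assume "x \<in> s <# A" "x \<in> s <# B"
  then obtain a b where x: "a \<in> A" "b \<in> B" "x = s \<otimes> a" "x = s \<otimes> b" by (auto simp: mem_lcos)
  then have "a = b" using lcos_inj[OF assms(3,7,8), of a b] assms(4,5) by auto
  then have "a = \<zero>" using x assms(6) by auto
  then show "x = \<zero>" using x assms(7) by simp
qed (use assms lcos_PR in auto)

lemma piso_restrict:
  assumes "piso A B" "A' \<in> PR" "A' \<subseteq> A" obtains B' where "piso A' B'" "B' \<subseteq> B"
proof -
  obtain s where s: "s \<in> carrier R" "s <# A = B" "\<And>x. x \<in> A \<Longrightarrow> s \<otimes> x = \<zero> \<Longrightarrow> x = \<zero>"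
    using assms(1) unfolding piso_def by blast
  show thesis
    by (rule that[OF pisoI[OF s(1) assms(2)]]) (use s assms(3) in \<open>auto dest: lcos_mono\<close>)
qed

lemma emb_refl: "A \<in> PR \<Longrightarrow> emb A A"
  unfolding emb_def using piso_refl by blast

lemma emb_mono: "emb A B \<Longrightarrow> B \<subseteq> C \<Longrightarrow> emb A C"
  unfolding emb_def by blast

lemma piso_emb: "piso A B \<Longrightarrow> emb A B"
  unfolding emb_def by blast

lemma subset_emb: "A \<in> PR \<Longrightarrow> A \<subseteq> B \<Longrightarrow> emb A B"
  using emb_mono emb_refl by blast

lemma emb_trans:
  assumes "emb A B" "emb B C" shows "emb A C"
proof -
  obtain B' where B': "B' \<subseteq> B" "piso A B'" using assms emb_def by auto
  obtain C' where C': "C' \<subseteq> C" "piso B C'" using assms emb_def by auto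
  obtain D where D: "piso B' D" "D \<subseteq> C'" using piso_restrict[OF C'(2) piso_PR(2)[OF B'(2)] B'(1)] .
  then show ?thesis using piso_trans[OF B'(2) D(1)] C'(1) unfolding emb_def by auto
qed

lemma piso_zero: assumes "piso A B" shows "A = {\<zero>} \<longleftrightarrow> B = {\<zero>}"
proof -
  obtain s where s: "s \<in> carrier R" "s <# A = B" "\<And>x. x \<in> A \<Longrightarrow> s \<otimes> x = \<zero> \<Longrightarrow> x = \<zero>"
    using assms unfolding piso_def by blast
  have "s \<otimes> x \<in> B" if "x \<in> A" for x using that s(2) by (auto simp: mem_lcos)
  then have "A = {\<zero>}" if "B = {\<zero>}"
    using that s(3) PR_zero[OF piso_PR(1)[OF assms]] by blast
  moreover have "B = {\<zero>}" if "A = {\<zero>}"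
    unfolding s(2)[symmetric] that using s(1) by (simp add: l_coset_def)
  ultimately show ?thesis by blast
qed

end

context complete_regular_ring
begin

text \<open>Write \<open>A = a R\<close> and let \<open>c\<close> be a quasi-inverse of
  \<open>s a\<close>. Then \<open>s (a c s x) = s x\<close> on \<open>A\<close>, and injectivity
  cancels the outer \<open>s\<close>, so \<open>a c\<close> inverts \<open>s\<close>.\<close>

lemma piso_sym:
  assumes "piso A B" shows "piso B A"
proof -
  obtain s where s: "s \<in> carrier R" "s <# A = B" "\<And>x. x \<in> A \<Longrightarrow> s \<otimes> x = \<zero> \<Longrightarrow> x = \<zero>"
    using assms(1) unfolding piso_def by blast
  have AB: "A \<in> PR" "B \<in> PR" using assms piso_PR by auto
  obtain a where a: "a \<in> carrier R" "a \<in> A" "A = a <# carrier R"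
    using PR_idem[OF AB(1)] by metis
  obtain c where c: "c \<in> carrier R" "s \<otimes> a \<otimes> c \<otimes> (s \<otimes> a) = s \<otimes> a"
    using regular[of "s \<otimes> a"] s(1) a(1) by auto
  have inv: "a \<otimes> c \<otimes> (s \<otimes> x) = x" if x: "x \<in> A" for x
  proof -
    obtain r where r: "r \<in> carrier R" "x = a \<otimes> r" using x a(3) by (auto simp: mem_lcos)
    have "s \<otimes> (a \<otimes> c \<otimes> (s \<otimes> x)) = s \<otimes> a \<otimes> c \<otimes> (s \<otimes> a) \<otimes> r"
      unfolding r(2) using s(1) a(1) c(1) r(1) by algebra
    also have "\<dots> = s \<otimes> x" unfolding c(2) r(2) using s(1) a(1) c(1) r(1) by algebra
    finally have "s \<otimes> (a \<otimes> c \<otimes> (s \<otimes> x)) = s \<otimes> x" .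
    moreover have "a \<otimes> c \<otimes> (s \<otimes> x) \<in> A"
      using PR_mult[OF AB(1) PR_mult[OF AB(1) a(2) c(1)]] s(1) PR_closed[OF AB(1) x] by auto
    ultimately show ?thesis using lcos_inj[OF AB(1) s(1,3) _ x] by blast
  qed
  have "piso B ((a \<otimes> c) <# B)"
  proof (rule pisoI)
    fix y assume y: "y \<in> B" "a \<otimes> c \<otimes> y = \<zero>"
    then obtain x where x: "x \<in> A" "y = s \<otimes> x" using s(2) by (auto simp: mem_lcos)
    then have "x = \<zero>" using inv y by auto
    then show "y = \<zero>" using x s by simp
  qed (use a c AB in auto)
  moreover have "(a \<otimes> c) <# B = A"
  proof (rule Set.set_eqI)
    fix x
    have "x \<in> (a \<otimes> c) <# B \<longleftrightarrow> (\<exists>y\<in>A. x = a \<otimes> c \<otimes> (s \<otimes> y))"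
      unfolding s(2)[symmetric] Bex_def mem_lcos by blast
    then show "x \<in> (a \<otimes> c) <# B \<longleftrightarrow> x \<in> A" using inv by auto
  qed
  ultimately show ?thesis by simp
qed

lemma piso_set_add:
  assumes "piso A A'" "piso B B'" "A \<inter> B = {\<zero>}" "A' \<inter> B' = {\<zero>}"
  shows "piso (A <+> B) (A' <+> B')"
proof -
  obtain s where s: "s \<in> carrier R" "s <# A = A'" "\<And>x. x \<in> A \<Longrightarrow> s \<otimes> x = \<zero> \<Longrightarrow> x = \<zero>"
    using assms(1) unfolding piso_def by blast
  obtain t where t: "t \<in> carrier R" "t <# B = B'" "\<And>x. x \<in> B \<Longrightarrow> t \<otimes> x = \<zero> \<Longrightarrow> x = \<zero>"
    using assms(2) unfolding piso_def by blast
  have P: "A \<in> PR" "B \<in> PR" "A' \<in> PR" "B' \<in> PR" using assms piso_PR by auto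
  obtain u where u: "u \<in> carrier R" "\<And>x. x \<in> A \<Longrightarrow> u \<otimes> x = s \<otimes> x" "\<And>x. x \<in> B \<Longrightarrow> u \<otimes> x = t \<otimes> x"
    using glue[OF P(1,2) assms(3) s(1) t(1)] by metis
  have uA: "u <# A = A'" using u(2) s(2) by (auto simp: l_coset_def)
  have uB: "u <# B = B'" using u(3) t(2) by (auto simp: l_coset_def)
  have "piso (A <+> B) (u <# (A <+> B))"
  proof (rule pisoI[OF u(1) set_add_PR[OF P(1,2)]])
    fix x assume x: "x \<in> A <+> B" "u \<otimes> x = \<zero>"
    then obtain a b where ab: "a \<in> A" "b \<in> B" "x = a \<oplus> b" by (auto simp: mem_set_add)
    have c: "a \<in> carrier R" "b \<in> carrier R" using ab P PR_closed by auto
    have "s \<otimes> a \<oplus> t \<otimes> b = \<zero>" using x(2) ab u c by (simp add: r_distr)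
    moreover have "s \<otimes> a \<in> A'" "t \<otimes> b \<in> B'" using ab s(2) t(2) by (auto simp: mem_lcos)
    ultimately have "s \<otimes> a = \<zero>" "t \<otimes> b = \<zero>" using indepD[OF P(3,4) assms(4)] by auto
    then have "a = \<zero>" "b = \<zero>" using s(3) t(3) ab by auto
    then show "x = \<zero>" using ab by simp
  qed
  then show ?thesis using lcos_set_add[OF P(1,2) u(1)] uA uB by simp
qed

lemma emb_set_add:
  assumes "emb A A'" "emb B B'" "A \<inter> B = {\<zero>}" "A' \<inter> B' = {\<zero>}"
  shows "emb (A <+> B) (A' <+> B')"
proof -
  obtain A1 B1 where *: "A1 \<subseteq> A'" "piso A A1" "B1 \<subseteq> B'" "piso B B1" using assms emb_def by auto
  have "A1 \<inter> B1 = {\<zero>}"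
    by (rule indep_mono[OF assms(4) *(1,3)]) (use * piso_PR in auto)
  then show ?thesis using piso_set_add[OF *(2,4) assms(3)] set_add_mono[OF *(1,3)] emb_def by blast
qed

text \<open>On families of ideals, \<open>cl\<close> of the union is the supremum in the lattice of
  principal right ideals.\<close>

definition cl :: "'a set \<Rightarrow> 'a set" where
  "cl S = \<Inter>{J \<in> PR. S \<subseteq> J}"

lemma cl_PR: "S \<subseteq> carrier R \<Longrightarrow> cl S \<in> PR"
  unfolding cl_def by (rule Inter_PR) (use carrier_PR in auto)

lemma cl_upper: "S \<subseteq> cl S"
  unfolding cl_def by blast

lemma cl_least: "J \<in> PR \<Longrightarrow> S \<subseteq> J \<Longrightarrow> cl S \<subseteq> J"
  unfolding cl_def by blast

end

text \<open>These are the forms of irreducibility and continuity on which the dimension theory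
  rests: upper continuity preserves independence from \<open>I\<close> along increasing chains, and
  lower continuity preserves covering by \<open>I <+> J\<close> along decreasing ones.\<close>

locale prime_continuous_ring = complete_regular_ring +
  assumes prime: "\<lbrakk>a \<in> carrier R; b \<in> carrier R; a \<noteq> \<zero>; b \<noteq> \<zero>\<rbrakk> \<Longrightarrow> \<exists>r\<in>carrier R. b \<otimes> r \<otimes> a \<noteq> \<zero>"
    and upper_continuous:
      "\<lbrakk>subset.chain PR \<C>; \<C> \<noteq> {}; I \<in> PR; \<And>J. J \<in> \<C> \<Longrightarrow> I \<inter> J = {\<zero>}\<rbrakk> \<Longrightarrow> I \<inter> cl (\<Union>\<C>) = {\<zero>}"
    and lower_continuous:
      "\<lbrakk>subset.chain PR \<C>; \<C> \<noteq> {}; I \<in> PR; X \<in> PR; \<And>J. J \<in> \<C> \<Longrightarrow> X \<subseteq> I <+> J\<rbrakk> \<Longrightarrow> X \<subseteq> I <+> \<Inter>\<C>"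
begin

text \<open>By primeness some \<open>b r a\<close> is non-zero, so multiplication by
  \<open>b r\<close> is a non-zero map from \<open>a R\<close> into \<open>B\<close>; it is
  injective on a complement of its kernel.\<close>

lemma common_part:
  assumes "A \<in> PR" "B \<in> PR" "A \<noteq> {\<zero>}" "B \<noteq> {\<zero>}"
  obtains A' B' where "piso A' B'" "A' \<subseteq> A" "B' \<subseteq> B" "A' \<noteq> {\<zero>}"
proof -
  obtain a b where ab: "a \<in> A" "b \<in> B" "a \<noteq> \<zero>" "b \<noteq> \<zero>" using assms PR_zero by blast
  have c: "a \<in> carrier R" "b \<in> carrier R" using ab assms PR_closed by auto
  obtain r where r: "r \<in> carrier R" "b \<otimes> r \<otimes> a \<noteq> \<zero>" using prime[OF c ab(3,4)] by auto
  let ?s = "b \<otimes> r" and ?aR = "a <# carrier R"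
  have s: "?s \<in> carrier R" using c r by auto
  have aR: "?aR \<in> PR" using PR_principal c by auto
  let ?K = "?aR \<inter> {x \<in> carrier R. ?s \<otimes> x = \<zero>}"
  have K: "?K \<in> PR" using inter_PR[OF aR kernel_PR[OF s]] .
  obtain A' where A': "A' \<in> PR" "A' \<subseteq> ?aR" "?K \<inter> A' = {\<zero>}" "?K <+> A' = ?aR"
    using complement[OF K aR] by auto
  have "piso A' (?s <# A')"
  proof (rule pisoI[OF s A'(1)])
    fix x assume "x \<in> A'" "?s \<otimes> x = \<zero>"
    then have "x \<in> ?K \<inter> A'" using A'(2) PR_closed[OF A'(1)] by blast
    then show "x = \<zero>" using A'(3) by blast
  qed
  moreover have "?s <# A' \<subseteq> B"
  proof
    fix x assume "x \<in> ?s <# A'"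
    then obtain y where y: "y \<in> A'" "x = b \<otimes> r \<otimes> y" by (auto simp: mem_lcos)
    then show "x \<in> B"
      using PR_mult[OF assms(2) PR_mult[OF assms(2) ab(2) r(1)]] PR_closed[OF A'(1)] by auto
  qed
  moreover have "?aR \<subseteq> A" using PR_mult[OF assms(1) ab(1)] by (auto simp: mem_lcos)
  then have "A' \<subseteq> A" using A'(2) by simp
  moreover have "A' \<noteq> {\<zero>}"
  proof
    assume "A' = {\<zero>}"
    then have "?K = ?aR" using A'(4) set_add_zero K by auto
    moreover have "a \<in> ?aR" using c by (auto simp: mem_lcos intro!: bexI[of _ \<one>])
    ultimately show False using r by auto
  qed
  ultimately show thesis using that by blast
qed

text \<open>A partial isomorphism between independent \<open>A\<close> and \<open>B\<close> is encoded by its graph, an ideal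
  \<open>G \<subseteq> A + B\<close> meeting both trivially; such graphs are closed under suprema of chains by
  upper continuity.\<close>

lemma comparable_indep:
  assumes A: "A \<in> PR" and B: "B \<in> PR" and AB: "A \<inter> B = {\<zero>}"
  shows "emb A B \<or> emb B A"
proof -
  let ?S = "A <+> B"
  have S: "?S \<in> PR" using set_add_PR A B by auto
  define \<G> where "\<G> = {G \<in> PR. G \<subseteq> ?S \<and> A \<inter> G = {\<zero>} \<and> B \<inter> G = {\<zero>}}"
  have zero: "{\<zero>} \<in> \<G>" using zero_PR PR_zero[OF S] PR_zero[OF A] PR_zero[OF B] by (auto simp: \<G>_def)
  have "\<exists>M\<in>\<G>. \<forall>X\<in>\<G>. M \<subseteq> X \<longrightarrow> X = M"
  proof (rule subset_Zorn)
    fix \<C> assume ch: "subset.chain \<G> \<C>"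
    show "\<exists>U\<in>\<G>. \<forall>X\<in>\<C>. X \<subseteq> U"
    proof (cases "\<C> = {}")
      case True
      then show ?thesis using zero by auto
    next
      case False
      have sub: "\<C> \<subseteq> \<G>" using ch by (simp add: subset_chain_def)
      have ch': "subset.chain PR \<C>" using ch sub unfolding subset_chain_def \<G>_def by blast
      have U: "\<Union>\<C> \<subseteq> ?S" using sub unfolding \<G>_def by blast
      have "A \<inter> J = {\<zero>}" "B \<inter> J = {\<zero>}" if "J \<in> \<C>" for J
        using subsetD[OF sub that] by (auto simp: \<G>_def)
      then have "A \<inter> cl (\<Union>\<C>) = {\<zero>}" "B \<inter> cl (\<Union>\<C>) = {\<zero>}"
        using upper_continuous[OF ch' False A] upper_continuous[OF ch' False B] by simp_all
      moreover have "cl (\<Union>\<C>) \<in> PR" using cl_PR[OF subset_trans[OF U PR_subset[OF S]]] .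
      ultimately have "cl (\<Union>\<C>) \<in> \<G>" using cl_least[OF S U] by (simp add: \<G>_def)
      moreover have "X \<subseteq> cl (\<Union>\<C>)" if "X \<in> \<C>" for X
        using Union_upper[OF that] cl_upper by (rule subset_trans)
      ultimately show ?thesis by blast
    qed
  qed
  then obtain G where G: "G \<in> \<G>" "\<And>X. X \<in> \<G> \<Longrightarrow> G \<subseteq> X \<Longrightarrow> X = G" by blast
  have GP: "G \<in> PR" "G \<subseteq> ?S" "A \<inter> G = {\<zero>}" "B \<inter> G = {\<zero>}" using G(1) by (auto simp: \<G>_def)
  \<comment> \<open>On \<open>A <+> B\<close> the elements \<open>u\<close> and \<open>v\<close> act
    as the two coordinate projections; restricted to a graph both are injective.\<close>
  obtain u where u: "u \<in> carrier R" "\<And>x. x \<in> A \<Longrightarrow> u \<otimes> x = \<one> \<otimes> x" "\<And>x. x \<in> B \<Longrightarrow> u \<otimes> x = \<zero> \<otimes> x"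
    using glue[OF A B AB one_closed zero_closed] by metis
  obtain v where v: "v \<in> carrier R" "\<And>x. x \<in> A \<Longrightarrow> v \<otimes> x = \<zero> \<otimes> x" "\<And>x. x \<in> B \<Longrightarrow> v \<otimes> x = \<one> \<otimes> x"
    using glue[OF A B AB zero_closed one_closed] by metis
  have uv: "u \<otimes> (a \<oplus> b) = a" "v \<otimes> (a \<oplus> b) = b" if "a \<in> A" "b \<in> B" for a b
    using that u v PR_closed[OF A] PR_closed[OF B] by (auto simp: r_distr)
  have inj: "g = \<zero>" if g: "g \<in> G" "u \<otimes> g = \<zero> \<or> v \<otimes> g = \<zero>" for g
  proof -
    obtain a b where ab: "a \<in> A" "b \<in> B" "g = a \<oplus> b" 
      using subsetD[OF GP(2) g(1)] unfolding mem_set_add by blast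
    have "a \<in> carrier R" "b \<in> carrier R" using ab A B PR_closed by auto
    then have "g \<in> A \<or> g \<in> B" using g(2) uv[OF ab(1,2)] ab by auto
    then show ?thesis using g(1) GP by blast
  qed
  have memS: "u \<otimes> x \<in> A" "v \<otimes> x \<in> B" if "x \<in> ?S" for x
    using that uv by (auto simp: mem_set_add)
  have isoA: "piso G (u <# G)" and isoB: "piso G (v <# G)" using inj u v GP by (auto intro!: pisoI)
  have subA: "u <# G \<subseteq> A" and subB: "v <# G \<subseteq> B" 
    using memS subsetD[OF GP(2)] by (auto simp: mem_lcos)
  obtain A2 where A2: "A2 \<in> PR" "A2 \<subseteq> A" "(u <# G) \<inter> A2 = {\<zero>}" "(u <# G) <+> A2 = A"
    using complement[OF piso_PR(2)[OF isoA] A subA] .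
  obtain B2 where B2: "B2 \<in> PR" "B2 \<subseteq> B" "(v <# G) \<inter> B2 = {\<zero>}" "(v <# G) <+> B2 = B"
    using complement[OF piso_PR(2)[OF isoB] B subB] .
  \<comment> \<open>Maximality of \<open>G\<close>: an isomorphism \<open>s\<close> between non-zero
    parts of the two leftovers has graph \<open>(1 + s) A1\<close>, and adding this to
    \<open>G\<close> still gives an ideal meeting \<open>A\<close> and \<open>B\<close>
    trivially.\<close>
  have "A2 = {\<zero>} \<or> B2 = {\<zero>}"
  proof (rule ccontr)
    assume "\<not> ?thesis"
    then obtain A1 B1 where 1: "piso A1 B1" "A1 \<subseteq> A2" "B1 \<subseteq> B2" "A1 \<noteq> {\<zero>}"
      using common_part[OF A2(1) B2(1)] by blast
    obtain s where s: "s \<in> carrier R" "s <# A1 = B1" "\<And>x. x \<in> A1 \<Longrightarrow> s \<otimes> x = \<zero> \<Longrightarrow> x = \<zero>"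
      using 1(1) unfolding piso_def by blast
    have A1: "A1 \<in> PR" using 1(1) piso_PR by auto
    let ?G1 = "(\<one> \<oplus> s) <# A1"
    have G1: "?G1 \<in> PR" using lcos_PR s A1 by auto
    have G2: "G <+> ?G1 \<in> PR" using set_add_PR GP G1 by auto
    have form: "a \<in> A" "s \<otimes> a \<in> B" "s \<otimes> a \<in> B2" "(\<one> \<oplus> s) \<otimes> a = a \<oplus> s \<otimes> a" if a: "a \<in> A1" for a
    proof -
      show "a \<in> A" using a 1 A2 by auto
      show "s \<otimes> a \<in> B2" using lcosI[OF a, of s] s(2) 1(3) by blast
      then show "s \<otimes> a \<in> B" using B2 by auto
      show "(\<one> \<oplus> s) \<otimes> a = a \<oplus> s \<otimes> a" using s a PR_closed[OF A1] by (simp add: l_distr)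
    qed
    have pieces: "u \<otimes> g \<in> u <# G" "v \<otimes> g \<in> v <# G" if "g \<in> G" for g
      using that by (auto simp: mem_lcos)
    have dis: "g = \<zero> \<and> a = \<zero>"
      if *: "g \<in> G" "a \<in> A1" "g \<oplus> (a \<oplus> s \<otimes> a) \<in> A \<or> g \<oplus> (a \<oplus> s \<otimes> a) \<in> B" for g a
    proof -
      have c: "g \<in> carrier R" "a \<in> carrier R" "s \<otimes> a \<in> carrier R" using * GP A1 s PR_closed by auto
      have U: "u \<otimes> (g \<oplus> (a \<oplus> s \<otimes> a)) = u \<otimes> g \<oplus> a" "v \<otimes> (g \<oplus> (a \<oplus> s \<otimes> a)) = v \<otimes> g \<oplus> s \<otimes> a"
        using uv[OF form(1,2)[OF *(2)]] u(1) v(1) c by (auto simp: r_distr)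
      show ?thesis
      proof (rule disjE[OF *(3)])
        assume "g \<oplus> (a \<oplus> s \<otimes> a) \<in> A"
        then have "v \<otimes> g \<oplus> s \<otimes> a = \<zero>" using v(2) U c by auto
        then have "v \<otimes> g = \<zero>" "s \<otimes> a = \<zero>"
          using indepD[OF piso_PR(2)[OF isoB] B2(1,3) pieces(2)[OF *(1)] form(3)[OF *(2)]] by auto
        then show ?thesis using inj s(3) * by blast
      next
        assume "g \<oplus> (a \<oplus> s \<otimes> a) \<in> B"
        then have "u \<otimes> g \<oplus> a = \<zero>" using u(3) U c by auto
        then have "u \<otimes> g = \<zero>" "a = \<zero>"
          using indepD[OF piso_PR(2)[OF isoA] A2(1,3) pieces(1)[OF *(1)]] *(2) 1(2) by auto
        then show ?thesis using inj * by blast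
      qed
    qed
    have mem2: "\<exists>g\<in>G. \<exists>a\<in>A1. x = g \<oplus> (a \<oplus> s \<otimes> a)" if x: "x \<in> G <+> ?G1" for x
    proof -
      obtain g y where gy: "g \<in> G" "y \<in> ?G1" "x = g \<oplus> y" using x unfolding mem_set_add by blast
      then obtain a where "a \<in> A1" "y = (\<one> \<oplus> s) \<otimes> a" unfolding mem_lcos by blast
      then show ?thesis using gy form(4) by auto
    qed
    have "x = \<zero>" if x: "x \<in> G <+> ?G1" "x \<in> A \<or> x \<in> B" for x
    proof -
      obtain g a where ga: "g \<in> G" "a \<in> A1" "x = g \<oplus> (a \<oplus> s \<otimes> a)" using mem2 x(1) by blast
      then have "g = \<zero> \<and> a = \<zero>" using dis x(2) by blast
      then show ?thesis using ga s by simp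
    qed
    moreover have "G <+> ?G1 \<subseteq> ?S"
    proof (rule set_add_least[OF GP(2) _ S])
      show "?G1 \<subseteq> ?S" using form by (auto simp: mem_lcos intro!: set_addI)
    qed
    ultimately have "G <+> ?G1 \<in> \<G>"
      using G2 indepI[OF A G2] indepI[OF B G2] by (simp add: \<G>_def)
    then have "G <+> ?G1 = G" using G(2) subset_set_add1[OF GP(1) G1] by blast
    then have "?G1 \<subseteq> G" using subset_set_add2[OF GP(1) G1] by auto
    have "a = \<zero>" if a: "a \<in> A1" for a
    proof -
      have "a \<oplus> s \<otimes> a \<in> G" using subsetD[OF \<open>?G1 \<subseteq> G\<close> lcosI[OF a]] form(4)[OF a] by simp
      then have "a \<in> u <# G" using uv(1)[OF form(1,2)[OF a]] pieces(1) by metis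
      then show ?thesis using A2(3) a 1(2) by blast
    qed
    then show False using 1(4) PR_zero[OF A1] by blast
  qed
  then show ?thesis
  proof
    assume "A2 = {\<zero>}"
    then have "u <# G = A" using A2(4) set_add_zero piso_PR(2)[OF isoA] by auto
    then show ?thesis using piso_trans[OF piso_sym[OF isoA] isoB] subB emb_def by auto
  next
    assume "B2 = {\<zero>}"
    then have "v <# G = B" using B2(4) set_add_zero piso_PR(2)[OF isoB] by auto
    then show ?thesis using piso_trans[OF piso_sym[OF isoB] isoA] subA emb_def by auto
  qed
qed

text \<open>Relative complements of \<open>A \<inter> B\<close> in \<open>A\<close> and in
  \<open>B\<close> are independent; an embedding between them is extended by the identity on the
  intersection.\<close>

lemma comparable:
  assumes A: "A \<in> PR" and B: "B \<in> PR" shows "emb A B \<or> emb B A"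
proof -
  let ?K = "A \<inter> B"
  have K: "?K \<in> PR" using inter_PR A B by auto
  obtain A1 where A1: "A1 \<in> PR" "A1 \<subseteq> A" "?K \<inter> A1 = {\<zero>}" "?K <+> A1 = A"
    using complement[OF K A] by auto
  obtain B1 where B1: "B1 \<in> PR" "B1 \<subseteq> B" "?K \<inter> B1 = {\<zero>}" "?K <+> B1 = B"
    using complement[OF K B] by auto
  have "A1 \<inter> B1 = {\<zero>}"
    by (rule indepI) (use A1 B1 in auto)
  then have "emb A1 B1 \<or> emb B1 A1" using comparable_indep A1 B1 by auto
  then show ?thesis
    using emb_set_add[OF emb_refl[OF K] _ A1(3) B1(3)] emb_set_add[OF emb_refl[OF K] _ B1(3) A1(3)]
    by (auto simp: A1(4) B1(4))
qed

section \<open>Direct finiteness\<close>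

lemma chain_range:
  fixes f :: "nat \<Rightarrow> 'a set"
  assumes "\<And>n. f n \<in> \<A>" "\<And>m n. m \<le> n \<Longrightarrow> f m \<subseteq> f n \<or> f n \<subseteq> f m"
  shows "subset.chain \<A> (range f)"
proof -
  have "f m \<subseteq> f n \<or> f n \<subseteq> f m" for m n
    using assms(2)[of m n] assms(2)[of n m] by (cases "m \<le> n") auto
  then show ?thesis using assms(1) by (auto simp: subset_chain_def)
qed

text \<open>Von Neumann's argument: the ideals \<open>H n\<close> spanned by the differences
  \<open>t\<^sub>i z - t\<^sub>i\<^sub>+\<^sub>1 z\<close> increase to an ideal which lower continuity forces to contain \<open>Z\<close>
  modulo the intersection of the \<open>C n\<close>, while upper continuity forces it to meet \<open>Z\<close> trivially.\<close>

lemma no_shift: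
  assumes Z: "Z \<in> PR" and C: "\<And>n. C n \<in> PR" and t: "\<And>n. t n \<in> carrier R"
    and inj: "\<And>n z. z \<in> Z \<Longrightarrow> t n \<otimes> z = \<zero> \<Longrightarrow> z = \<zero>"
    and t0: "\<And>z. z \<in> Z \<Longrightarrow> t 0 \<otimes> z = z"
    and sum: "\<And>n. (t n <# Z) <+> C (Suc n) = C n"
    and ind: "\<And>n. (t n <# Z) \<inter> C (Suc n) = {\<zero>}"
  shows "Z = {\<zero>}"
proof -
  define G where "G n = (t n \<ominus> t (Suc n)) <# Z" for n
  define H where "H = rec_nat {\<zero>} (\<lambda>n h. h <+> G n)"
  have H0: "H 0 = {\<zero>}" and HS: "H (Suc n) = H n <+> G n" for n by (auto simp: H_def)
  have tZ: "t n <# Z \<in> PR" for n using lcos_PR t Z by auto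
  have G: "G n \<in> PR" for n using lcos_PR t Z by (auto simp: G_def)
  have H: "H n \<in> PR" for n
    by (induction n) (auto simp: H0 HS zero_PR set_add_PR G)
  have Csub: "t n <# Z \<subseteq> C n" "C (Suc n) \<subseteq> C n" for n
    using subset_set_add1[OF tZ C] subset_set_add2[OF tZ C] sum by metis+
  have Zc: "z \<in> carrier R" if "z \<in> Z" for z using that PR_closed[OF Z] by auto
  have Gel: "(t n \<ominus> t (Suc n)) \<otimes> z = t n \<otimes> z \<ominus> t (Suc n) \<otimes> z" if "z \<in> Z" for n z
    using t[of n] t[of "Suc n"] Zc[OF that] by algebra
  \<comment> \<open>Modulo \<open>H n\<close>, \<open>z\<close> is congruent to \<open>t n z\<close>
    by telescoping. The claim is that no other element of \<open>C n\<close> is; independence of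
    \<open>t n <# Z\<close> and \<open>C (Suc n)\<close> carries it from one index to the
    next.\<close>
  have HC: "c = \<ominus> (t n \<otimes> z)" if "z \<in> Z" "c \<in> C n" "z \<oplus> c \<in> H n" for n z c
    using that
  proof (induction n arbitrary: c)
    case 0
    have cc: "z \<in> carrier R" "c \<in> carrier R" using 0 Zc PR_closed[OF C] by auto
    have "c \<oplus> z = \<zero>" using 0 cc by (simp add: H0 a_comm)
    then show ?case using t0 0 cc minus_equality[of c z] by auto
  next
    case (Suc n)
    obtain h g where hg: "h \<in> H n" "g \<in> G n" "z \<oplus> c = h \<oplus> g" using Suc.prems(3) by (auto simp: HS mem_set_add)
    then obtain y where y: "y \<in> Z" "g = t n \<otimes> y \<ominus> t (Suc n) \<otimes> y" using Gel by (auto simp: G_def mem_lcos)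
    have cc: "z \<in> carrier R" "c \<in> carrier R" "h \<in> carrier R" "y \<in> carrier R" "g \<in> carrier R"
      "t n \<in> carrier R" "t (Suc n) \<in> carrier R"
      using Suc.prems hg y Zc PR_closed[OF C] PR_closed[OF H] PR_closed[OF G] t by auto
    have "h = (z \<oplus> c) \<ominus> g" unfolding hg(3) using cc by algebra
    then have h: "h = z \<oplus> (c \<ominus> t n \<otimes> y \<oplus> t (Suc n) \<otimes> y)" unfolding y(2) using cc by algebra
    have m: "t n \<otimes> x \<in> C n" "t n \<otimes> x \<in> t n <# Z" "t (Suc n) \<otimes> x \<in> C (Suc n)" if "x \<in> Z" for x
      using lcosI[OF that] Csub by blast+
    have "c \<ominus> t n \<otimes> y \<oplus> t (Suc n) \<otimes> y \<in> C n"
      using PR_add[OF C PR_minus[OF C]] Csub(2) m y(1) Suc.prems(2) by blast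
    then have "c \<ominus> t n \<otimes> y \<oplus> t (Suc n) \<otimes> y = \<ominus> (t n \<otimes> z)"
      using Suc.IH Suc.prems(1) hg(1) h by auto
    moreover have "t n \<otimes> z \<ominus> t n \<otimes> y \<oplus> (c \<oplus> t (Suc n) \<otimes> y) = t n \<otimes> z \<oplus> (c \<ominus> t n \<otimes> y \<oplus> t (Suc n) \<otimes> y)"
      using cc by algebra
    ultimately have "t n \<otimes> z \<ominus> t n \<otimes> y \<oplus> (c \<oplus> t (Suc n) \<otimes> y) = \<zero>" using cc by (simp add: r_neg)
    moreover have "t n \<otimes> z \<ominus> t n \<otimes> y \<in> t n <# Z" using m Suc.prems(1) y(1) PR_minus[OF tZ] by auto
    moreover have "c \<oplus> t (Suc n) \<otimes> y \<in> C (Suc n)" using m y(1) Suc.prems(2) PR_add[OF C] by auto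
    ultimately have e: "t n \<otimes> z \<ominus> t n \<otimes> y = \<zero>" "c \<oplus> t (Suc n) \<otimes> y = \<zero>"
      using indepD[OF tZ C ind] by auto
    have "z = y"
      using lcos_inj[OF Z t inj Suc.prems(1) y(1)] e(1) cc minus_zero_iff by auto
    then show ?case using e(2) cc minus_equality[of c] by auto
  qed
  have cover: "C 0 \<subseteq> H n <+> C n" for n
  proof (induction n)
    case 0
    show ?case using set_add_zero C by (simp add: H0)
  next
    case (Suc n)
    have "t n <# Z \<subseteq> G n <+> C (Suc n)"
    proof
      fix x assume "x \<in> t n <# Z"
      then obtain z where z: "z \<in> Z" "x = t n \<otimes> z" by (auto simp: mem_lcos)
      have cc: "z \<in> carrier R" "t n \<in> carrier R" "t (Suc n) \<in> carrier R" using z Zc t by auto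
      have "x = (t n \<ominus> t (Suc n)) \<otimes> z \<oplus> t (Suc n) \<otimes> z" unfolding z(2) using cc by algebra
      then show "x \<in> G n <+> C (Suc n)"
        using lcosI[OF z(1)] Csub(1)[of "Suc n"] unfolding G_def by (auto intro!: set_addI)
    qed
    then have "C n \<subseteq> G n <+> C (Suc n)"
      using set_add_least[OF _ subset_set_add2[OF G C] set_add_PR[OF G C]] sum by metis
    then have "H n <+> C n \<subseteq> H n <+> (G n <+> C (Suc n))" using set_add_mono by blast
    then show ?case using Suc set_add_assoc[OF H G C] by (auto simp: HS)
  qed
  define W where "W = \<Inter>(range C)"
  have W: "W \<in> PR" unfolding W_def by (rule Inter_PR) (use C in auto)
  have Cdec: "C n \<subseteq> C m" if "m \<le> n" for m n
    using that by (rule lift_Suc_antimono_le[rotated]) (rule Csub(2))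
  have Hinc: "H m \<subseteq> H n" if "m \<le> n" for m n
    using that by (rule lift_Suc_mono_le[rotated]) (simp add: HS subset_set_add1[OF H G])
  have HWinc: "H m <+> W \<subseteq> H n <+> W" if "m \<le> n" for m n
    using set_add_mono[OF Hinc[OF that]] by blast
  have HW: "H n <+> W \<in> PR" for n using set_add_PR H W by auto
  define L where "L = cl (\<Union>(range H))"
  have L: "L \<in> PR" unfolding L_def by (rule cl_PR) (use PR_subset[OF H] in blast)
  have HL: "H n \<subseteq> L" for n unfolding L_def using cl_upper[of "\<Union>(range H)"] by blast
  \<comment> \<open>Every \<open>H n\<close> lies in \<open>L\<close>, so \<open>L\<close> together
    with any \<open>C n\<close> covers \<open>C 0\<close>; lower continuity passes to the
    intersection \<open>W\<close>.\<close>
  have "C 0 \<subseteq> L <+> W"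
    unfolding W_def
  proof (rule lower_continuous)
    show "subset.chain PR (range C)"
      using C Cdec by (intro chain_range) auto
    fix J assume "J \<in> range C"
    then obtain n where n: "J = C n" by auto
    show "C 0 \<subseteq> L <+> J" using cover[of n] set_add_mono[OF HL[of n] order_refl] unfolding n by blast
  qed (use L C in auto)
  moreover have "L <+> W \<subseteq> cl (\<Union>(range (\<lambda>n. H n <+> W)))"
  proof (rule set_add_least)
    show K: "cl (\<Union>(range (\<lambda>n. H n <+> W))) \<in> PR" by (rule cl_PR) (use PR_subset[OF HW] in blast)
    have *: "H n <+> W \<subseteq> cl (\<Union>(range (\<lambda>n. H n <+> W)))" for n
      using cl_upper[of "\<Union>(range (\<lambda>n. H n <+> W))"] by blast
    show "L \<subseteq> cl (\<Union>(range (\<lambda>n. H n <+> W)))"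
      unfolding L_def by (rule cl_least[OF K]) (use * subset_set_add1[OF H W] in blast)
    show "W \<subseteq> cl (\<Union>(range (\<lambda>n. H n <+> W)))"
      using * subset_set_add2[OF H W] by blast
  qed
  moreover have "Z \<inter> cl (\<Union>(range (\<lambda>n. H n <+> W))) = {\<zero>}"
  proof (rule upper_continuous[OF _ _ Z])
    show "subset.chain PR (range (\<lambda>n. H n <+> W))"
      using HW HWinc by (intro chain_range) auto
    fix J assume "J \<in> range (\<lambda>n. H n <+> W)"
    then obtain n where n: "J = H n <+> W" by auto
    show "Z \<inter> J = {\<zero>}" unfolding n
    proof (rule indepI[OF Z HW])
      fix z assume z: "z \<in> Z" "z \<in> H n <+> W"
      then obtain h w where hw: "h \<in> H n" "w \<in> W" "z = h \<oplus> w" by (auto simp: mem_set_add)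
      have cc: "z \<in> carrier R" "h \<in> carrier R" "w \<in> carrier R"
        using z hw PR_closed[OF Z] PR_closed[OF H] PR_closed[OF W] by auto
      have "z \<oplus> (\<ominus> w) = h" unfolding hw(3) using cc by algebra
      \<comment> \<open>Membership in \<open>C n\<close> identifies \<open>- w\<close> with
        \<open>- t n z\<close>; membership in \<open>C (Suc n)\<close> then makes it zero, since
        that ideal is independent of \<open>t n <# Z\<close>.\<close>
      moreover have w: "\<ominus> w \<in> C m" for m using PR_neg[OF W hw(2)] by (auto simp: W_def)
      ultimately have e: "\<ominus> w = \<ominus> (t n \<otimes> z)" using HC[OF z(1)] hw(1) by auto
      have "\<ominus> w \<in> t n <# Z" unfolding e using PR_neg[OF tZ] lcosI[OF z(1)] by auto
      then have "\<ominus> w = \<zero>" using ind[of n] w by blast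
      then have "t n \<otimes> z = \<zero>" using e t cc by (metis add.inv_eq_1_iff m_closed)
      then show "z = \<zero>" using inj z(1) by blast
    qed
  qed auto
  moreover have "Z \<subseteq> C 0"
  proof
    fix z assume z: "z \<in> Z"
    then have "t 0 \<otimes> z \<in> C 0" using lcosI[OF z] Csub(1) by blast
    then show "z \<in> C 0" using t0 z by auto
  qed
  ultimately show ?thesis using PR_zero[OF Z] by blast
qed

text \<open>Dependent choice: if a copy of \<open>A\<close> can always be split off without losing
  the property \<open>P\<close>, the resulting sequence of copies and remainders is the situation of
  \<open>no_shift\<close>.\<close>

lemma no_infinite_splitting:
  assumes "P C"
    and step: "\<And>C. P C \<Longrightarrow> C \<in> PR \<and> (\<exists>A' C'. piso A A' \<and> A' \<inter> C' = {\<zero>} \<and> A' <+> C' = C \<and> P C')"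
  shows "A = {\<zero>}"
proof -
  have "\<exists>f. \<forall>n. P (f n) \<and> (\<exists>A'. piso A A' \<and> A' \<inter> f (Suc n) = {\<zero>} \<and> A' <+> f (Suc n) = f n)"
    using dependent_nat_choice[of "\<lambda>_ C. P C" "\<lambda>_ C C'. \<exists>A'. piso A A' \<and> A' \<inter> C' = {\<zero>} \<and> A' <+> C' = C"]
      assms by blast
  then obtain f where f: "\<And>n. P (f n)" "\<And>n. \<exists>A'. piso A A' \<and> A' \<inter> f (Suc n) = {\<zero>} \<and> A' <+> f (Suc n) = f n"
    by blast
  then obtain B where B: "\<And>n. piso A (B n)" "\<And>n. B n \<inter> f (Suc n) = {\<zero>}" "\<And>n. B n <+> f (Suc n) = f n"
    by metis
  have "piso (B 0) (B n)" for n using piso_trans[OF piso_sym[OF B(1)] B(1)] .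
  then have "\<exists>s\<in>carrier R. s <# B 0 = B n \<and> (\<forall>x\<in>B 0. s \<otimes> x = \<zero> \<longrightarrow> x = \<zero>)" for n unfolding piso_def by blast
  then obtain s where s: "\<And>n. s n \<in> carrier R" "\<And>n. s n <# B 0 = B n" "\<And>n x. x \<in> B 0 \<Longrightarrow> s n \<otimes> x = \<zero> \<Longrightarrow> x = \<zero>"
    by metis
  have B0: "B 0 \<in> PR" using piso_PR[OF B(1)] by auto
  \<comment> \<open>The multiplier \<open>s 0\<close> is some automorphism of \<open>B 0\<close>;
    \<open>no_shift\<close> wants the identity at index 0.\<close>
  define t where "t n = (if n = 0 then \<one> else s n)" for n
  have tB: "t n <# B 0 = B n" for n using s(2) lcos_one[OF PR_subset[OF B0]] by (auto simp: t_def)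
  have "B 0 = {\<zero>}"
  proof (rule no_shift[OF B0, of f t])
    show "f n \<in> PR" for n using step f(1) by auto
  qed (use s B B0 PR_closed[OF B0] tB in \<open>auto simp: t_def split: if_splits\<close>)
  then show ?thesis using piso_zero[OF B(1)] by auto
qed

text \<open>Otherwise the embedding can be iterated: each \<open>C\<close> isomorphic to
  \<open>X = Y + Z\<close> splits into a copy of \<open>Z\<close> and a copy of \<open>Y\<close>,
  and the latter is again isomorphic to \<open>X\<close>.\<close>

lemma directly_finite:
  assumes "piso X Y" "Y \<subseteq> X" shows "Y = X"
proof -
  have P: "X \<in> PR" "Y \<in> PR" using assms piso_PR by auto
  obtain Z where Z: "Z \<in> PR" "Z \<subseteq> X" "Y \<inter> Z = {\<zero>}" "Y <+> Z = X" using complement[OF P(2,1) assms(2)] .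
  have "Z = {\<zero>}"
  proof (rule no_infinite_splitting[of "\<lambda>C. piso X C" X])
    show "piso X X" using piso_refl P by auto
    fix C assume C: "piso X C"
    obtain s where s: "s \<in> carrier R" "s <# X = C" "\<And>x. x \<in> X \<Longrightarrow> s \<otimes> x = \<zero> \<Longrightarrow> x = \<zero>"
      using C unfolding piso_def by blast
    have "piso Y (s <# Y)" "piso Z (s <# Z)" using s assms(2) Z P by (auto intro!: pisoI)
    moreover have "(s <# Z) \<inter> (s <# Y) = {\<zero>}" "(s <# Z) <+> (s <# Y) = C"
      using lcos_indep[OF Z(1) P(2) P(1) Z(2) assms(2) _ s(1,3)] Z(3,4) s(2)
        lcos_set_add[OF Z(1) P(2) s(1)] set_add_comm[OF Z(1) P(2)] by auto
    ultimately show "C \<in> PR \<and> (\<exists>A' C'. piso Z A' \<and> A' \<inter> C' = {\<zero>} \<and> A' <+> C' = C \<and> piso X C')"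
      using piso_trans[OF assms(1)] piso_PR(2)[OF C] by blast
  qed
  then show ?thesis using Z(4) set_add_zero P by auto
qed

text \<open>If \<open>D\<close> does not embed into \<open>C'\<close>, comparability puts a copy
  \<open>C2\<close> of \<open>C'\<close> inside \<open>D\<close>. Then \<open>A <+> D\<close> embeds
  into its own subideal \<open>A <+> C2\<close>, and direct finiteness forces
  \<open>C2 = D\<close>.\<close>

lemma emb_cancel:
  assumes "piso A A'" "D \<in> PR" "C' \<in> PR" "A \<inter> D = {\<zero>}" "A' \<inter> C' = {\<zero>}" "emb (A <+> D) (A' <+> C')"
  shows "emb D C'"
proof (rule ccontr)
  assume n: "\<not> emb D C'"
  then have "emb C' D" using comparable assms(2,3) by blast
  then obtain C2 where C2: "piso C' C2" "C2 \<subseteq> D" unfolding emb_def by blast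
  have P: "A \<in> PR" "A' \<in> PR" "C2 \<in> PR" using assms C2 piso_PR by auto
  have i: "A \<inter> C2 = {\<zero>}" using indep_mono[OF assms(4) order_refl C2(2) P(1,3)] .
  have "piso (A' <+> C') (A <+> C2)" using piso_set_add[OF piso_sym[OF assms(1)] C2(1) assms(5) i] .
  then have "emb (A <+> D) (A <+> C2)" by (rule emb_trans[OF assms(6) piso_emb])
  then obtain X where X: "piso (A <+> D) X" "X \<subseteq> A <+> C2" unfolding emb_def by blast
  have sub: "A <+> C2 \<subseteq> A <+> D" using set_add_mono[OF order_refl C2(2)] .
  have "X = A <+> D" using directly_finite[OF X(1)] X(2) sub by auto
  then have eq: "A <+> C2 = A <+> D" using X(2) sub by auto
  have "D \<subseteq> C2"
  proof
    fix d assume d: "d \<in> D"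
    then have "d \<in> A <+> C2" using eq subset_set_add2[OF P(1) assms(2)] by auto
    then obtain a c where ac: "a \<in> A" "c \<in> C2" "d = a \<oplus> c" by (auto simp: mem_set_add)
    have cc: "a \<in> carrier R" "c \<in> carrier R" "d \<in> carrier R"
      using ac d P assms(2) PR_closed by auto
    have "c \<in> D" using ac(2) C2(2) by auto
    moreover have "a \<oplus> c = \<zero> \<oplus> d" using cc ac(3) by simp
    ultimately have "c = d" using indep_unique(2)[OF P(1) assms(2,4) ac(1) _ PR_zero[OF P(1)] d] by blast
    then show "d \<in> C2" using ac(2) by simp
  qed
  then have "D = C2" using C2 by auto
  then have "emb D C'" using piso_emb[OF piso_sym[OF C2(1)]] by simp
  then show False using n by simp
qed

section \<open>Counting copies\<close>

text \<open>Independence of \<open>n\<close> copies is recorded by peeling: one copy, and a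
  principal remainder holding the others. This avoids families of ideals and suits
  induction.\<close>

primrec copies :: "nat \<Rightarrow> 'a set \<Rightarrow> 'a set \<Rightarrow> bool" where
  "copies 0 A B \<longleftrightarrow> True"
| "copies (Suc n) A B \<longleftrightarrow>
     (\<exists>A' C. piso A A' \<and> C \<in> PR \<and> A' \<inter> C = {\<zero>} \<and> A' <+> C \<subseteq> B \<and> copies n A C)"

lemma copies_SucI:
  "piso A A' \<Longrightarrow> C \<in> PR \<Longrightarrow> A' \<inter> C = {\<zero>} \<Longrightarrow> A' <+> C \<subseteq> B \<Longrightarrow> copies n A C \<Longrightarrow> copies (Suc n) A B"
  by auto

lemma copies_mono: "copies n A B \<Longrightarrow> B \<subseteq> B' \<Longrightarrow> copies n A B'"
  by (cases n) (simp, simp only: copies.simps, blast intro: order_trans)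

lemma copies_emb:
  assumes "copies n A B" "emb B B'" shows "copies n A B'"
  using assms
proof (induction n arbitrary: B B')
  case (Suc n)
  obtain A' C where C: "piso A A'" "C \<in> PR" "A' \<inter> C = {\<zero>}" "A' <+> C \<subseteq> B" "copies n A C"
    using Suc.prems by auto
  obtain B2 where B2: "piso B B2" "B2 \<subseteq> B'" using Suc.prems(2) unfolding emb_def by blast
  obtain s where s: "s \<in> carrier R" "s <# B = B2" "\<And>x. x \<in> B \<Longrightarrow> s \<otimes> x = \<zero> \<Longrightarrow> x = \<zero>"
    using B2(1) unfolding piso_def by blast
  have P: "A' \<in> PR" "B \<in> PR" using C B2 piso_PR by auto
  have sub: "A' \<subseteq> B" "C \<subseteq> B" using C(4) subset_set_add1[OF P(1) C(2)] subset_set_add2[OF P(1) C(2)] by auto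
  have i: "piso A' (s <# A')" "piso C (s <# C)" using s sub P C by (auto intro!: pisoI)
  have d: "(s <# A') \<inter> (s <# C) = {\<zero>}" using lcos_indep[OF P(1) C(2) P(2) sub C(3) s(1,3)] by auto
  have e: "(s <# A') <+> (s <# C) \<subseteq> B'"
    using lcos_mono[OF C(4), of s] lcos_set_add[OF P(1) C(2) s(1)] s(2) B2(2) by auto
  show ?case
    by (rule copies_SucI[OF piso_trans[OF C(1) i(1)] piso_PR(2)[OF i(2)] d e Suc.IH[OF C(5) piso_emb[OF i(2)]]])
qed simp

lemma copies_one:
  assumes "B \<in> PR" shows "copies (Suc 0) A B \<longleftrightarrow> emb A B"
proof
  assume "copies (Suc 0) A B"
  then obtain A' C where A': "piso A A'" "C \<in> PR" "A' <+> C \<subseteq> B" by auto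
  then have "A' \<subseteq> B" using subset_set_add1[OF piso_PR(2)[OF A'(1)] A'(2)] by blast
  then show "emb A B" using A'(1) unfolding emb_def by blast
next
  assume "emb A B"
  then obtain A' where A': "piso A A'" "A' \<subseteq> B" unfolding emb_def by blast
  then have "A' \<inter> {\<zero>} = {\<zero>}" "A' <+> {\<zero>} \<subseteq> B" using PR_zero set_add_zero piso_PR by auto
  then show "copies (Suc 0) A B" by (intro copies_SucI[OF A'(1) zero_PR]) simp_all
qed

lemma copies_Suc_D: "copies (Suc n) A B \<Longrightarrow> copies n A B"
proof -
  assume "copies (Suc n) A B"
  then obtain A' C where C: "piso A A'" "C \<in> PR" "A' <+> C \<subseteq> B" "copies n A C" by auto
  then have "C \<subseteq> B" using subset_set_add2[OF piso_PR(2)[OF C(1)] C(2)] by blast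
  then show "copies n A B" using copies_mono[OF C(4)] by simp
qed

lemma copies_le: "copies n A B \<Longrightarrow> m \<le> n \<Longrightarrow> copies m A B"
  by (induction n) (auto simp del: copies.simps(2) simp: le_Suc_eq dest: copies_Suc_D)

lemma copies_add:
  assumes "copies m A X" "copies n A Y" "X \<in> PR" "Y \<in> PR" "X \<inter> Y = {\<zero>}"
  shows "copies (m + n) A (X <+> Y)"
  using assms(1,3,5)
proof (induction m arbitrary: X)
  case 0
  then show ?case using copies_mono[OF assms(2)] subset_set_add2 assms(4) by auto
next
  case (Suc m)
  obtain A' C where C: "piso A A'" "C \<in> PR" "A' \<inter> C = {\<zero>}" "A' <+> C \<subseteq> X" "copies m A C"
    using Suc.prems by auto
  have P: "A' \<in> PR" "A' <+> C \<in> PR" "C <+> Y \<in> PR" using C piso_PR assms(4) set_add_PR by auto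
  have i: "(A' <+> C) \<inter> Y = {\<zero>}" using indep_mono[OF Suc.prems(3) C(4) order_refl P(2) assms(4)] .
  note j = indep_assoc[OF P(1) C(2) assms(4) P(2,3) C(3) i]
  have "copies (m + n) A (C <+> Y)" using Suc.IH[OF C(5,2) j(2)] .
  moreover have "A' <+> (C <+> Y) \<subseteq> X <+> Y"
    using set_add_mono[OF C(4) order_refl] set_add_assoc[OF P(1) C(2) assms(4)] by metis
  ultimately have "copies (Suc (m + n)) A (X <+> Y)" by (intro copies_SucI[OF C(1) P(3) j(1)])
  then show ?case by (simp only: add_Suc)
qed

lemma copies_mult:
  assumes "copies n A B" "copies m Z A" shows "copies (n * m) Z B"
  using assms(1)
proof (induction n arbitrary: B)
  case (Suc n)
  obtain A' C where C: "piso A A'" "C \<in> PR" "A' \<inter> C = {\<zero>}" "A' <+> C \<subseteq> B" "copies n A C"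
    using Suc.prems by auto
  have "copies m Z A'" using copies_emb[OF assms(2) piso_emb[OF C(1)]] .
  then have "copies (m + n * m) Z (A' <+> C)"
    using copies_add[OF _ Suc.IH[OF C(5)] piso_PR(2)[OF C(1)] C(2,3)] by simp
  then show ?case using copies_mono[OF _ C(4)] by simp
qed simp

lemma copies_split:
  assumes "copies (m + n) A X" "X \<in> PR"
  obtains X1 X2 where "X1 \<in> PR" "X2 \<in> PR" "X1 \<inter> X2 = {\<zero>}" "X1 <+> X2 \<subseteq> X" "copies m A X1" "copies n A X2"
  using assms
proof (induction m arbitrary: X thesis)
  case 0
  show ?case
    by (rule 0(1)[of "{\<zero>}" X]) (use 0(2,3) set_add_zero PR_zero zero_PR in auto)
next
  case (Suc m)
  obtain A' C where C: "piso A A'" "C \<in> PR" "A' \<inter> C = {\<zero>}" "A' <+> C \<subseteq> X" "copies (m + n) A C"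
    using Suc.prems(2) by auto
  obtain X1 X2 where X: "X1 \<in> PR" "X2 \<in> PR" "X1 \<inter> X2 = {\<zero>}" "X1 <+> X2 \<subseteq> C" "copies m A X1" "copies n A X2"
    using Suc.IH[OF _ C(5,2)] by metis
  have P: "A' \<in> PR" "A' <+> X1 \<in> PR" "X1 <+> X2 \<in> PR" using C X piso_PR set_add_PR by auto
  have i1: "A' \<inter> (X1 <+> X2) = {\<zero>}" using indep_mono[OF C(3) order_refl X(4) P(1,3)] .
  have i2: "A' \<inter> X1 = {\<zero>}" using indep_mono[OF i1 order_refl subset_set_add1[OF X(1,2)] P(1) X(1)] .
  have i3: "(A' <+> X1) \<inter> X2 = {\<zero>}"
  proof -
    have "X2 <+> X1 = X1 <+> X2" using set_add_comm X by auto
    then have "(X2 <+> X1) \<inter> A' = {\<zero>}" "X2 \<inter> X1 = {\<zero>}" using i1 X(3) by auto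
    then have "X2 \<inter> (X1 <+> A') = {\<zero>}"
      using indep_assoc(1)[OF X(2,1) P(1)] set_add_PR X P(1) by auto
    then show ?thesis using set_add_comm[OF P(1) X(1)] by auto
  qed
  have "(A' <+> X1) <+> X2 \<subseteq> X"
    using set_add_assoc[OF P(1) X(1,2)] set_add_mono[OF order_refl X(4), of A'] C(4) by auto
  moreover have "copies (Suc m) A (A' <+> X1)" using copies_SucI[OF C(1) X(1) i2 order_refl X(5)] .
  ultimately show ?case using Suc.prems(1)[OF P(2) X(2) i3 _ _ X(6)] by blast
qed

lemma copies_cancel:
  assumes "piso A A'" "C' \<in> PR" "A' \<inter> C' = {\<zero>}" "copies (Suc n) A (A' <+> C')"
  shows "copies n A C'"
proof -
  obtain A2 D where D: "piso A A2" "D \<in> PR" "A2 \<inter> D = {\<zero>}" "A2 <+> D \<subseteq> A' <+> C'" "copies n A D"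
    using assms(4) by auto
  have P: "A2 \<in> PR" using D piso_PR by auto
  have "emb D C'"
    by (rule emb_cancel[OF piso_trans[OF piso_sym[OF D(1)] assms(1)] D(2) assms(2) D(3) assms(3)])
      (rule subset_emb[OF set_add_PR[OF P D(2)] D(4)])
  then show ?thesis using copies_emb D(5) by blast
qed

text \<open>An Archimedean property: if arbitrarily many copies fit, cancellation shows that this
  survives the removal of one copy, so the splitting would never end.\<close>

lemma copies_bounded:
  assumes "A \<noteq> {\<zero>}" "B \<in> PR" shows "\<exists>n. \<not> copies n A B"
proof (rule ccontr)
  assume "\<not> ?thesis"
  then have B: "B \<in> PR \<and> (\<forall>n. copies n A B)" using assms by auto
  have "A = {\<zero>}"
  proof (rule no_infinite_splitting[of "\<lambda>C. C \<in> PR \<and> (\<forall>n. copies n A C)", OF B])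
    fix C assume C: "C \<in> PR \<and> (\<forall>n. copies n A C)"
    then have "emb A C" using copies_one by blast
    then obtain A' where A': "piso A A'" "A' \<subseteq> C" unfolding emb_def by blast
    obtain C' where C': "C' \<in> PR" "A' \<inter> C' = {\<zero>}" "A' <+> C' = C"
      using complement[OF piso_PR(2)[OF A'(1)] _ A'(2)] C by metis
    have "copies n A C'" for n using copies_cancel[OF A'(1) C'(1,2)] C'(3) C by blast
    then show "C \<in> PR \<and> (\<exists>A' C'. piso A A' \<and> A' \<inter> C' = {\<zero>} \<and> A' <+> C' = C \<and> C' \<in> PR \<and> (\<forall>n. copies n A C'))"
      using A' C C' by blast
  qed
  then show False using assms by simp
qed

text \<open>Shrinking \<open>X1\<close> to a copy of \<open>B\<close> leaves the same summand on
  both sides, and \<open>emb_cancel\<close> removes it.\<close>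

lemma copies_subadditive_aux:
  assumes "emb B X1" "B \<in> PR" "B' \<in> PR" "X1 \<in> PR" "X2 \<in> PR"
    and "X1 \<inter> X2 = {\<zero>}" "B \<inter> B' = {\<zero>}" "X1 <+> X2 \<subseteq> B <+> B'"
  shows "emb X2 B'"
proof -
  obtain B1 where B1: "piso B B1" "B1 \<subseteq> X1" using assms(1) unfolding emb_def by blast
  have P: "B1 \<in> PR" using B1 piso_PR by auto
  have "B1 \<inter> X2 = {\<zero>}" using indep_mono[OF assms(6) B1(2) order_refl P assms(5)] .
  moreover have "B1 <+> X2 \<subseteq> B <+> B'" using set_add_mono[OF B1(2) order_refl] assms(8) by blast
  ultimately show ?thesis
    using emb_cancel[OF piso_sym[OF B1(1)] assms(5,3) _ assms(7)] subset_emb[OF set_add_PR[OF P assms(5)]] by blast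
qed

text \<open>Split the copies into \<open>X1\<close> with \<open>p\<close> and \<open>X2\<close> with
  \<open>q\<close> of them. Either \<open>X1\<close> fits into \<open>B\<close>, or \<open>B\<close>
  fits into \<open>X1\<close> and then \<open>X2\<close> is forced into \<open>B'\<close>.\<close>

lemma copies_subadditive:
  assumes "copies (p + q) A (B <+> B')" "B \<in> PR" "B' \<in> PR" "B \<inter> B' = {\<zero>}"
  shows "copies p A B \<or> copies q A B'"
proof -
  obtain X1 X2 where X: "X1 \<in> PR" "X2 \<in> PR" "X1 \<inter> X2 = {\<zero>}" "X1 <+> X2 \<subseteq> B <+> B'"
    "copies p A X1" "copies q A X2"
    using copies_split[OF assms(1)] set_add_PR assms by metis
  show ?thesis
  proof (cases "emb X1 B")
    case True
    then show ?thesis using copies_emb X by blast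
  next
    case False
    then have "emb B X1" using comparable X assms by blast
    then have "emb X2 B'" using copies_subadditive_aux assms X by blast
    then show ?thesis using copies_emb X by blast
  qed
qed

text \<open>The maximal number of copies; \<open>copies_bounded\<close> makes the minimum exist for
  non-zero \<open>A\<close> and principal \<open>B\<close>.\<close>

definition count :: "'a set \<Rightarrow> 'a set \<Rightarrow> nat" where
  "count A B = (LEAST n. \<not> copies (Suc n) A B)"

lemma copies_iff_count:
  assumes "A \<noteq> {\<zero>}" "B \<in> PR" shows "copies n A B \<longleftrightarrow> n \<le> count A B"
proof -
  obtain m where m: "\<not> copies m A B" using copies_bounded assms by blast
  then have "\<not> copies (Suc m) A B" using copies_Suc_D by blast
  then have 1: "\<not> copies (Suc (count A B)) A B" unfolding count_def by (rule LeastI)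
  have 2: "copies (count A B) A B"
  proof (cases "count A B")
    case (Suc k)
    then show ?thesis using not_less_Least[of k "\<lambda>n. \<not> copies (Suc n) A B"] unfolding count_def
      by (simp del: copies.simps)
  qed simp
  show ?thesis using copies_le[OF 2] copies_le[of n A B "Suc (count A B)"] 1 by (meson not_less_eq_eq)
qed

lemma count_superadditive:
  assumes "A \<noteq> {\<zero>}" "B \<in> PR" "B' \<in> PR" "B \<inter> B' = {\<zero>}"
  shows "count A B + count A B' \<le> count A (B <+> B')"
  using copies_add[of "count A B" A B "count A B'" B'] assms copies_iff_count set_add_PR by auto

text \<open>The parts of \<open>B\<close> and \<open>B'\<close> left after all copies are removed
  can together hold one further copy of \<open>A\<close>, but not two.\<close>

lemma count_subadditive:
  assumes "A \<noteq> {\<zero>}" "B \<in> PR" "B' \<in> PR" "B \<inter> B' = {\<zero>}"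
  shows "count A (B <+> B') \<le> Suc (count A B + count A B')"
proof (rule ccontr)
  assume "\<not> ?thesis"
  then have "copies (Suc (count A B) + Suc (count A B')) A (B <+> B')"
    using copies_iff_count[OF assms(1) set_add_PR[OF assms(2,3)]] by (auto simp del: copies.simps)
  then show False
    using copies_subadditive[OF _ assms(2-4)] copies_iff_count[OF assms(1)] assms(2,3) by (meson not_less_eq_eq order_refl)
qed

lemma count_emb: "A \<noteq> {\<zero>} \<Longrightarrow> emb B B' \<Longrightarrow> B' \<in> PR \<Longrightarrow> count A B \<le> count A B'"
  using copies_emb copies_iff_count emb_PR by (metis order_refl)

lemma count_piso: "A \<noteq> {\<zero>} \<Longrightarrow> piso B B' \<Longrightarrow> count A B = count A B'"
  by (intro antisym count_emb piso_emb) (auto intro: piso_PR piso_sym)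

lemma count_pos: "A \<noteq> {\<zero>} \<Longrightarrow> A \<in> PR \<Longrightarrow> 1 \<le> count A (carrier R)"
  using copies_one[OF carrier_PR] subset_emb[OF _ PR_subset] copies_iff_count[OF _ carrier_PR, of A 1] by auto

text \<open>If the numbers of copies are bounded, no limit is available to make them additive; an ideal
  fitting into the ring a maximal number of times is then an atom, and the numbers are additive as they stand.\<close>

definition max_count :: "'a set \<Rightarrow> bool" where
  "max_count A \<longleftrightarrow> A \<in> PR \<and> A \<noteq> {\<zero>} \<and>
     (\<forall>Z\<in>PR. Z \<noteq> {\<zero>} \<longrightarrow> count Z (carrier R) \<le> count A (carrier R))"

text \<open>If \<open>A\<close> splits properly into \<open>X\<close> and \<open>Y\<close>, the
  smaller of the two fits twice into \<open>A\<close>, hence at least twice as often as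
  \<open>A\<close> into the whole ring.\<close>

lemma max_count_atom:
  assumes "max_count A" "X \<in> PR" "X \<subseteq> A" shows "X = {\<zero>} \<or> X = A"
proof (rule ccontr)
  assume n: "\<not> ?thesis"
  have A: "A \<in> PR" "A \<noteq> {\<zero>}" using assms by (auto simp: max_count_def)
  obtain Y where Y: "Y \<in> PR" "X \<inter> Y = {\<zero>}" "X <+> Y = A" using complement[OF assms(2) A(1) assms(3)] .
  then have Yn: "Y \<noteq> {\<zero>}" using set_add_zero assms(2) n by auto
  obtain Z where Z: "Z \<in> PR" "Z \<noteq> {\<zero>}" "emb Z X" "emb Z Y"
    using comparable[OF assms(2) Y(1)] emb_refl Y(1) Yn n assms(2) by blast
  have "copies (Suc 0 + Suc 0) Z (X <+> Y)"
    using copies_add copies_one Z assms(2) Y by blast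
  then have "copies (count A (carrier R) * (Suc 0 + Suc 0)) Z (carrier R)"
    using copies_mult[of "count A (carrier R)" A] Y(3) copies_iff_count[OF A(2) carrier_PR] by blast
  then have "count A (carrier R) * 2 \<le> count Z (carrier R)"
    using copies_iff_count[OF Z(2) carrier_PR] by simp
  moreover have "count Z (carrier R) \<le> count A (carrier R)" using assms(1) Z by (auto simp: max_count_def)
  ultimately show False using count_pos[OF A(2,1)] by simp
qed

text \<open>Otherwise \<open>X\<close> embeds into the atom \<open>A\<close>, and its image can only
  be all of \<open>A\<close>.\<close>

lemma max_count_emb:
  assumes "max_count A" "X \<in> PR" "X \<noteq> {\<zero>}" shows "emb A X"
proof (rule ccontr)
  assume n: "\<not> ?thesis"
  have A: "A \<in> PR" using assms by (auto simp: max_count_def)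
  then have "emb X A" using comparable assms(2) n by blast
  then obtain X' where X': "piso X X'" "X' \<subseteq> A" unfolding emb_def by blast
  then have "X' = A" using max_count_atom[OF assms(1) piso_PR(2)[OF X'(1)]] piso_zero assms(3) by auto
  then show False using n piso_emb[OF piso_sym] X' by blast
qed

text \<open>Copies of \<open>A\<close> are peeled off \<open>B\<close> and \<open>X\<close> in
  parallel. A remainder of \<open>B\<close> without a copy of \<open>A\<close> is zero, not merely
  smaller than \<open>A\<close>, so nothing is left to place at the end.\<close>

lemma max_count_exact:
  assumes "max_count A" "\<not> copies (Suc k) A B" "copies k A X" "B \<in> PR" "X \<in> PR"
  shows "emb B X"
  using assms(2-)
proof (induction k arbitrary: B X)
  case 0
  then have "B = {\<zero>}" using max_count_emb[OF assms(1)] copies_one by blast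
  then show ?case using subset_emb zero_PR PR_zero 0 by auto
next
  case (Suc k)
  obtain A2 D where D: "piso A A2" "D \<in> PR" "A2 \<inter> D = {\<zero>}" "A2 <+> D \<subseteq> X" "copies k A D"
    using Suc.prems(2) by auto
  show ?case
  proof (cases "B = {\<zero>}")
    case True
    then show ?thesis using subset_emb zero_PR PR_zero Suc.prems by auto
  next
    case False
    then obtain A' where A': "piso A A'" "A' \<subseteq> B" using max_count_emb[OF assms(1)] Suc.prems unfolding emb_def by blast
    obtain C' where C': "C' \<in> PR" "A' \<inter> C' = {\<zero>}" "A' <+> C' = B"
      using complement[OF piso_PR(2)[OF A'(1)] _ A'(2)] Suc.prems by metis
    have "\<not> copies (Suc k) A C'" using Suc.prems(1) copies_SucI[OF A'(1) C'(1,2), of B] C'(3) by blast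
    then have "emb C' D" using Suc.IH D C' by blast
    then have "emb (A' <+> C') (A2 <+> D)"
      using emb_set_add[OF piso_emb[OF piso_trans[OF piso_sym[OF A'(1)] D(1)]]] C'(2) D(3) by blast
    then show ?thesis using emb_mono D(4) C'(3) by auto
  qed
qed

text \<open>Given one copy too many, \<open>B\<close> fits into a part \<open>X1\<close> holding
  \<open>count A B\<close> copies, so the other part, with more than \<open>count A B'\<close>
  copies, is forced into \<open>B'\<close>.\<close>

lemma max_count_additive:
  assumes "max_count A" "B \<in> PR" "B' \<in> PR" "B \<inter> B' = {\<zero>}"
  shows "count A (B <+> B') = count A B + count A B'"
proof -
  have A: "A \<noteq> {\<zero>}" using assms by (auto simp: max_count_def)
  have "count A (B <+> B') \<le> count A B + count A B'"
  proof (rule ccontr)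
    assume "\<not> ?thesis"
    then have c: "copies (count A B + Suc (count A B')) A (B <+> B')"
      using copies_iff_count[OF A set_add_PR[OF assms(2,3)]] by (auto simp del: copies.simps)
    obtain X1 X2 where X: "X1 \<in> PR" "X2 \<in> PR" "X1 \<inter> X2 = {\<zero>}" "X1 <+> X2 \<subseteq> B <+> B'"
      "copies (count A B) A X1" "copies (Suc (count A B')) A X2"
      using copies_split[OF c set_add_PR[OF assms(2,3)]] by metis
    have "\<not> copies (Suc (count A B)) A B" using copies_iff_count[OF A assms(2)] by (meson not_less_eq_eq order_refl)
    then have "emb B X1" using max_count_exact[OF assms(1)] X assms by blast
    then have "emb X2 B'" using copies_subadditive_aux assms X by blast
    then have "copies (Suc (count A B')) A B'" using copies_emb X by blast
    then show False using copies_iff_count[OF A assms(3)] by (meson not_less_eq_eq order_refl)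
  qed
  then show ?thesis using count_superadditive[OF A assms(2-4)] by simp
qed

section \<open>Dimension and rank\<close>

text \<open>Values outside \<open>PR\<close> are left open. Strict positivity on non-zero ideals is
  a consequence, see \<open>dim_pos\<close>.\<close>

definition dimension_function :: "('a set \<Rightarrow> real) \<Rightarrow> bool" where
  "dimension_function D \<longleftrightarrow> D (carrier R) = 1 \<and> (\<forall>A\<in>PR. 0 \<le> D A) \<and> (\<forall>A B. piso A B \<longrightarrow> D A = D B) \<and>
     (\<forall>A\<in>PR. \<forall>B\<in>PR. A \<inter> B = {\<zero>} \<longrightarrow> D (A <+> B) = D A + D B)"

context
  fixes D assumes D: "dimension_function D"
begin

lemma dim_carrier: "D (carrier R) = 1" and dim_nonneg: "A \<in> PR \<Longrightarrow> 0 \<le> D A"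
  and dim_piso: "piso A B \<Longrightarrow> D A = D B"
  and dim_add: "A \<in> PR \<Longrightarrow> B \<in> PR \<Longrightarrow> A \<inter> B = {\<zero>} \<Longrightarrow> D (A <+> B) = D A + D B"
  using D unfolding dimension_function_def by blast+

lemma dim_zero: "D {\<zero>} = 0"
  using dim_add[OF zero_PR zero_PR] set_add_zero[OF zero_PR] by simp

lemma dim_mono:
  assumes "A \<in> PR" "B \<in> PR" "A \<subseteq> B" shows "D A \<le> D B"
proof -
  obtain C where "C \<in> PR" "A \<inter> C = {\<zero>}" "A <+> C = B" using complement[OF assms] .
  then show ?thesis using dim_add[OF assms(1)] dim_nonneg by force
qed

lemma dim_le_one: "A \<in> PR \<Longrightarrow> D A \<le> 1"
  using dim_mono[OF _ carrier_PR PR_subset] dim_carrier by auto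

lemma dim_emb: "emb A B \<Longrightarrow> B \<in> PR \<Longrightarrow> D A \<le> D B"
  unfolding emb_def using dim_piso dim_mono piso_PR(2) by metis

lemma dim_copies:
  assumes "copies n A B" "B \<in> PR" shows "n * D A \<le> D B"
  using assms
proof (induction n arbitrary: B)
  case 0
  then show ?case using dim_nonneg by simp
next
  case (Suc n)
  obtain A' C where C: "piso A A'" "C \<in> PR" "A' \<inter> C = {\<zero>}" "A' <+> C \<subseteq> B" "copies n A C"
    using Suc.prems by auto
  have A': "A' \<in> PR" using C piso_PR by auto
  have "D A' + D C \<le> D B" using dim_add[OF A' C(2,3)] dim_mono[OF set_add_PR[OF A' C(2)] Suc.prems(2) C(4)] by simp
  moreover have "n * D A \<le> D C" using Suc.IH C by blast
  ultimately show ?case using dim_piso[OF C(1)] by (simp add: algebra_simps)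
qed

text \<open>Greedy covering: by comparability either \<open>B\<close> already embeds into
  \<open>A\<close>, or a copy of \<open>A\<close> can be split off and one copy fewer is available
  in the rest.\<close>

lemma dim_not_copies:
  assumes "\<not> copies n A B" "A \<in> PR" "B \<in> PR" shows "D B \<le> n * D A"
  using assms(1,3)
proof (induction n arbitrary: B)
  case (Suc n)
  show ?case
  proof (cases "emb B A")
    case True
    then show ?thesis using dim_emb[OF True assms(2)] dim_nonneg[OF assms(2)] by (simp add: algebra_simps add_increasing2)
  next
    case False
    then have "emb A B" using comparable assms(2) Suc.prems by blast
    then obtain A' where A': "piso A A'" "A' \<subseteq> B" unfolding emb_def by blast
    obtain C where C: "C \<in> PR" "A' \<inter> C = {\<zero>}" "A' <+> C = B"
      using complement[OF piso_PR(2)[OF A'(1)] Suc.prems(2) A'(2)] by metis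
    have "\<not> copies n A C" using Suc.prems(1) copies_SucI[OF A'(1) C(1,2), of B] C(3) by blast
    then have "D C \<le> n * D A" using Suc.IH C by blast
    then show ?thesis using dim_add[OF piso_PR(2)[OF A'(1)] C(1,2)] C(3) dim_piso[OF A'(1)] by (simp add: algebra_simps)
  qed
qed simp

lemma dim_pos:
  assumes "A \<in> PR" "A \<noteq> {\<zero>}" shows "0 < D A"
proof -
  obtain n where n: "\<not> copies n A (carrier R)" using copies_bounded[OF assms(2) carrier_PR] by blast
  have "1 \<le> n * D A" using dim_not_copies[OF n assms(1) carrier_PR] dim_carrier by simp
  then show ?thesis using dim_nonneg[OF assms(1)] by (cases "D A = 0") auto
qed

lemma dim_count:
  assumes "A \<in> PR" "A \<noteq> {\<zero>}" "B \<in> PR"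
  shows "count A B * D A \<le> D B" "D B \<le> (count A B + 1) * D A"
  using dim_copies[of "count A B" A B] dim_not_copies[of "Suc (count A B)" A B] assms
    copies_iff_count[OF assms(2,3), of "count A B"] copies_iff_count[OF assms(2,3), of "Suc (count A B)"]
  by (simp_all del: copies.simps add: algebra_simps)

text \<open>Better by one than \<open>dim_not_copies\<close>, because a remainder without a copy of
  \<open>A\<close> is zero. With the lower bound this makes \<open>D B\<close> an exact multiple of
  \<open>D A\<close>.\<close>

lemma dim_max_count:
  assumes "max_count A" "\<not> copies (Suc n) A B" "B \<in> PR" shows "D B \<le> n * D A"
  using assms(2,3)
proof (induction n arbitrary: B)
  case 0
  then have "B = {\<zero>}" using max_count_emb[OF assms(1)] copies_one by blast
  then show ?case using dim_zero by simp
next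
  case (Suc n)
  have A: "A \<in> PR" using assms by (auto simp: max_count_def)
  show ?case
  proof (cases "B = {\<zero>}")
    case True
    then show ?thesis using dim_zero dim_nonneg[OF A] by simp
  next
    case False
    then obtain A' where A': "piso A A'" "A' \<subseteq> B" using max_count_emb[OF assms(1)] Suc.prems unfolding emb_def by blast
    obtain C where C: "C \<in> PR" "A' \<inter> C = {\<zero>}" "A' <+> C = B"
      using complement[OF piso_PR(2)[OF A'(1)] Suc.prems(2) A'(2)] by metis
    have "\<not> copies (Suc n) A C" using Suc.prems(1) copies_SucI[OF A'(1) C(1,2), of B] C(3) by blast
    then have "D C \<le> n * D A" using Suc.IH C by blast
    then show ?thesis using dim_add[OF piso_PR(2)[OF A'(1)] C(1,2)] C(3) dim_piso[OF A'(1)] by (simp add: algebra_simps)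
  qed
qed

text \<open>Both bounds are independent of \<open>D\<close>, which is what uniqueness needs;
  \<open>D A\<close> is eliminated by applying \<open>dim_count\<close> to the whole ring, so that
  \<open>N * D A \<le> 1 \<le> (N + 1) * D A\<close>.\<close>

lemma dim_count_bounds:
  assumes "A \<in> PR" "A \<noteq> {\<zero>}" "B \<in> PR"
  shows "D B \<le> (count A B + 1) / count A (carrier R)" "count A B / (count A (carrier R) + 1) \<le> D B"
proof -
  let ?N = "count A (carrier R)"
  have N: "?N * D A \<le> 1" "1 \<le> (?N + 1) * D A"
    using dim_count[OF assms(1,2) carrier_PR] dim_carrier by simp_all
  have N1: "1 \<le> ?N" using count_pos assms by auto
  have "D A \<le> 1 / ?N" using N(1) N1 by (simp add: field_simps)
  then have "(count A B + 1) * D A \<le> (count A B + 1) * (1 / ?N)" by (intro mult_left_mono) auto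
  then show "D B \<le> (count A B + 1) / ?N" using dim_count(2)[OF assms] by simp
  have "1 / (?N + 1) \<le> D A" using N(2) by (simp add: field_simps)
  then have "count A B * (1 / (?N + 1)) \<le> count A B * D A" by (intro mult_left_mono) auto
  then show "count A B / (?N + 1) \<le> D B" using dim_count(1)[OF assms] by simp
qed

end

section \<open>Uniqueness and existence of the dimension\<close>

lemma max_count_or_unbounded:
  assumes "carrier R \<noteq> {\<zero>}"
  shows "(\<exists>A. max_count A) \<or> (\<forall>n. \<exists>A\<in>PR. A \<noteq> {\<zero>} \<and> n \<le> count A (carrier R))"
proof (rule disjCI)
  let ?S = "{count A (carrier R) |A. A \<in> PR \<and> A \<noteq> {\<zero>}}"
  assume "\<not> (\<forall>n. \<exists>A\<in>PR. A \<noteq> {\<zero>} \<and> n \<le> count A (carrier R))"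
  then obtain n where "\<forall>A\<in>PR. A \<noteq> {\<zero>} \<longrightarrow> count A (carrier R) < n" by (auto simp: not_le)
  then have fin: "finite ?S" by (auto intro!: finite_subset[of ?S "{..<n}"])
  have "?S \<noteq> {}" using assms carrier_PR by blast
  then have "Max ?S \<in> ?S" using Max_in fin by blast
  then obtain A where A: "A \<in> PR" "A \<noteq> {\<zero>}" "Max ?S = count A (carrier R)" by blast
  have "count Z (carrier R) \<le> count A (carrier R)" if "Z \<in> PR" "Z \<noteq> {\<zero>}" for Z
    using Max_ge[OF fin, of "count Z (carrier R)"] that A(3) by auto
  then show "\<exists>A. max_count A" using A unfolding max_count_def by blast
qed

lemma dimension_unique:
  assumes D: "dimension_function D" and E: "dimension_function E" and B: "B \<in> PR"
  shows "D B = E B"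
proof -
  have nz: "carrier R \<noteq> {\<zero>}" using dim_zero[OF D] dim_carrier[OF D] by auto
  from max_count_or_unbounded[OF nz] show ?thesis
  proof
    assume "\<exists>A. max_count A"
    then obtain A where A: "max_count A" by blast
    then have A': "A \<in> PR" "A \<noteq> {\<zero>}" by (auto simp: max_count_def)
    have eq: "F C = count A C * F A" if F: "dimension_function F" and C: "C \<in> PR" for F :: "'a set \<Rightarrow> real" and C
    proof (rule antisym)
      show "F C \<le> count A C * F A"
        using dim_max_count[OF F A _ C, of "count A C"] copies_iff_count[OF A'(2) C, of "Suc (count A C)"]
        by (simp del: copies.simps)
      show "count A C * F A \<le> F C" using dim_count(1)[OF F A' C] .
    qed
    have FA: "F A = 1 / count A (carrier R)" if F: "dimension_function F" for F :: "'a set \<Rightarrow> real"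
      using eq[OF F carrier_PR] dim_carrier[OF F] count_pos[OF A'(2,1)] by (simp add: field_simps)
    show ?thesis using eq[OF D B] eq[OF E B] FA[OF D] FA[OF E] by simp
  next
    assume unb: "\<forall>n. \<exists>A\<in>PR. A \<noteq> {\<zero>} \<and> n \<le> count A (carrier R)"
    have le: "F B \<le> G B" if F: "dimension_function F" and G: "dimension_function G" for F G
    proof (rule field_le_epsilon)
      fix e :: real assume e: "0 < e"
      \<comment> \<open>Since \<open>k \<le> N\<close>, the two bounds \<open>(k + 1) / N\<close>
        and \<open>k / (N + 1)\<close> differ by at most \<open>2 / N\<close>.\<close>
      obtain n :: nat where n: "2 / e < n" using reals_Archimedean2 by blast
      obtain A where A: "A \<in> PR" "A \<noteq> {\<zero>}" "n \<le> count A (carrier R)" using unb by blast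
      define N k where "N = real (count A (carrier R))" and "k = real (count A B)"
      have N: "N \<ge> 1" using count_pos[OF A(2,1)] by (simp add: N_def)
      have k: "k \<le> N" "k \<ge> 0" using count_emb[OF A(2) subset_emb[OF B PR_subset[OF B]] carrier_PR] by (auto simp: N_def k_def)
      have "2 / e < N" using n A(3) by (simp add: N_def)
      then have e2: "2 / N < e" using e N by (simp add: field_simps)
      define x where "x = k / (N + 1)"
      have "x * (N + 1) = k" using N by (simp add: x_def)
      then have x: "x \<le> 1" "k = x * N + x" using k N by (auto simp: x_def divide_le_eq distrib_left)
      have "(k + 1) / N = x + (x + 1) / N" unfolding x(2) using N by (simp add: add_divide_distrib)
      also have "\<dots> \<le> x + 2 / N" using x(1) N by (intro add_left_mono divide_right_mono) auto
      finally have "(k + 1) / N - k / (N + 1) < e" using e2 by (simp add: x_def)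
      moreover have "F B \<le> (k + 1) / N" "k / (N + 1) \<le> G B"
        using dim_count_bounds(1)[OF F A(1,2) B] dim_count_bounds(2)[OF G A(1,2) B]
        by (simp_all add: N_def k_def add.commute)
      ultimately show "F B \<le> G B + e" by linarith
    qed
    show ?thesis using le[OF D E] le[OF E D] by simp
  qed
qed

text \<open>Counting copies of one \<open>A\<close> and dividing by \<open>N\<close>, the count of
  the whole ring, has additivity defect at most \<open>1 / N\<close>, so any \<open>A\<close> with
  \<open>N \<ge> Suc n\<close> serves. With a maximal count the defect is zero.\<close>

lemma approximate_dimension:
  assumes "carrier R \<noteq> {\<zero>}"
  shows "\<exists>g::'a set \<Rightarrow> real. (\<forall>A. 0 \<le> g A \<and> g A \<le> 1) \<and> g (carrier R) = 1 \<and>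
    (\<forall>A B. piso A B \<longrightarrow> g A = g B) \<and>
    (\<forall>A\<in>PR. \<forall>B\<in>PR. A \<inter> B = {\<zero>} \<longrightarrow> \<bar>g (A <+> B) - g A - g B\<bar> \<le> 1 / real (Suc n))"
proof -
  have ex: "\<exists>A\<in>PR. A \<noteq> {\<zero>} \<and>
     (\<forall>B\<in>PR. \<forall>C\<in>PR. B \<inter> C = {\<zero>} \<longrightarrow>
       \<bar>real (count A (B <+> C)) - count A B - count A C\<bar> \<le> count A (carrier R) / real (Suc n))"
    using max_count_or_unbounded[OF assms]
  proof
    assume "\<exists>A. max_count A"
    then obtain A where A: "max_count A" by blast
    then have A': "A \<in> PR" "A \<noteq> {\<zero>}" by (auto simp: max_count_def)
    then show ?thesis using max_count_additive[OF A] by (intro bexI[of _ A]) auto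
  next
    assume "\<forall>n. \<exists>A\<in>PR. A \<noteq> {\<zero>} \<and> n \<le> count A (carrier R)"
    then obtain A where A: "A \<in> PR" "A \<noteq> {\<zero>}" "Suc n \<le> count A (carrier R)" by blast
    have "real (Suc n) \<le> real (count A (carrier R))" using A(3) by (rule of_nat_mono)
    then have "1 \<le> count A (carrier R) / real (Suc n)" by (subst le_divide_eq) simp
    moreover have "\<bar>real (count A (B <+> C)) - count A B - count A C\<bar> \<le> 1"
      if "B \<in> PR" "C \<in> PR" "B \<inter> C = {\<zero>}" for B C
      using count_superadditive[OF A(2) that] count_subadditive[OF A(2) that] by linarith
    ultimately have "\<bar>real (count A (B <+> C)) - count A B - count A C\<bar> \<le> count A (carrier R) / real (Suc n)"
      if "B \<in> PR" "C \<in> PR" "B \<inter> C = {\<zero>}" for B C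
      using that order_trans by blast
    then show ?thesis using A(1,2) by blast
  qed
  from ex obtain A where A: "A \<in> PR" "A \<noteq> {\<zero>}" and "\<forall>B\<in>PR. \<forall>C\<in>PR. B \<inter> C = {\<zero>} \<longrightarrow>
       \<bar>real (count A (B <+> C)) - count A B - count A C\<bar> \<le> count A (carrier R) / real (Suc n)"
    by (elim bexE conjE)
  then have err: "\<bar>real (count A (B <+> C)) - count A B - count A C\<bar> \<le> count A (carrier R) / real (Suc n)"
    if "B \<in> PR" "C \<in> PR" "B \<inter> C = {\<zero>}" for B C
    using that by simp
  define N where "N = real (count A (carrier R))"
  have N: "1 \<le> N" using count_pos[OF A(2,1)] by (simp add: N_def)
  \<comment> \<open>The value 0 off \<open>PR\<close> keeps \<open>g\<close> in the unit interval on
    every set, as the product over all sets requires.\<close>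
  define g where "g B = (if B \<in> PR then count A B / N else 0)" for B
  show ?thesis
  proof (intro exI[of _ g] conjI allI impI ballI)
    show "0 \<le> g B" for B using N by (simp add: g_def)
    show "g B \<le> 1" for B
      using N count_emb[OF A(2) subset_emb[OF _ PR_subset] carrier_PR, of B] by (auto simp: g_def N_def)
    show "g (carrier R) = 1" using N carrier_PR by (simp add: g_def N_def)
    show "g B = g C" if "piso B C" for B C
      using piso_PR[OF that] count_piso[OF A(2) that] by (simp add: g_def)
    fix B C assume BC: "B \<in> PR" "C \<in> PR" "B \<inter> C = {\<zero>}"
    have "g (B <+> C) - g B - g C = (real (count A (B <+> C)) - count A B - count A C) / N"
      using BC set_add_PR by (simp add: g_def diff_divide_distrib)
    then have "\<bar>g (B <+> C) - g B - g C\<bar> = \<bar>real (count A (B <+> C)) - count A B - count A C\<bar> / N"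
      using N by (simp add: abs_divide)
    also have "\<dots> \<le> (N / real (Suc n)) / N" using err[OF BC] N by (intro divide_right_mono) (auto simp: N_def)
    also have "\<dots> = 1 / real (Suc n)" using N by simp
    finally show "\<bar>g (B <+> C) - g B - g C\<bar> \<le> 1 / real (Suc n)" .
  qed
qed

text \<open>The dimension is a cluster point, in a product of unit intervals, of the normalised counting functions.\<close>

lemma dimension_exists:
  assumes "carrier R \<noteq> {\<zero>}"
  obtains D where "dimension_function D"
proof -
  define K :: "('a set \<Rightarrow> real) set" where "K = (\<Pi>\<^sub>E A\<in>UNIV. {0..1})"
  define S where "S = {(A, B). A \<in> PR \<and> B \<in> PR \<and> A \<inter> B = {\<zero>}}"
  \<comment> \<open>Each condition involves finitely many coordinates, so \<open>F n\<close> is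
    closed, and the sets decrease with \<open>n\<close>. A point common to all of them has defect
    zero.\<close>
  define F :: "nat \<Rightarrow> ('a set \<Rightarrow> real) set" where
    "F n = {g. g (carrier R) = 1} \<inter> (\<Inter>(A, B)\<in>{(A, B). piso A B}. {g. g A = g B}) \<inter>
       (\<Inter>(A, B)\<in>S. {g. \<bar>g (A <+> B) - g A - g B\<bar> \<le> 1 / real (Suc n)})" for n
  have "compactin (product_topology (\<lambda>i. euclidean) UNIV) K"
    unfolding K_def by (subst compactin_PiE) auto
  then have K: "compact K" by (simp add: euclidean_product_topology)
  have ev: "continuous_on UNIV (\<lambda>g::'a set \<Rightarrow> real. g A)" for A
    by (rule continuous_on_product_coordinates)
  have closed: "closed (F n)" for n
    unfolding F_def
    by (intro closed_Int closed_INT ballI) (auto intro!: closed_Collect_eq closed_Collect_le continuous_intros ev)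
  have dec: "F n \<subseteq> F m" if "m \<le> n" for m n
  proof -
    have "1 / real (Suc n) \<le> 1 / real (Suc m)" using that by (simp add: frac_le)
    then show ?thesis unfolding F_def by (intro Int_mono INF_mono' order_refl) (auto intro: order_trans)
  qed
  have ne: "K \<inter> F n \<noteq> {}" for n
  proof -
    obtain g :: "'a set \<Rightarrow> real" where g: "(\<forall>A. 0 \<le> g A \<and> g A \<le> 1) \<and> g (carrier R) = 1 \<and>
      (\<forall>A B. piso A B \<longrightarrow> g A = g B) \<and>
      (\<forall>A\<in>PR. \<forall>B\<in>PR. A \<inter> B = {\<zero>} \<longrightarrow> \<bar>g (A <+> B) - g A - g B\<bar> \<le> 1 / real (Suc n))"
      using approximate_dimension[OF assms] by (rule exE)
    have "g \<in> K \<inter> F n" using g by (auto simp: K_def F_def S_def)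
    then show ?thesis by blast
  qed
  have "K \<inter> \<Inter>(F ` UNIV) \<noteq> {}"
  proof (rule compact_imp_fip_image[OF K closed])
    fix I :: "nat set" assume I: "finite I"
    have "F (Max (insert 0 I)) \<subseteq> F i" if "i \<in> I" for i
      using I that by (intro dec) auto
    then show "K \<inter> \<Inter>(F ` I) \<noteq> {}" using ne[of "Max (insert 0 I)"] by blast
  qed
  then obtain D where D: "D \<in> K" "\<And>n. D \<in> F n" by blast
  have add: "D (A <+> B) = D A + D B" if "A \<in> PR" "B \<in> PR" "A \<inter> B = {\<zero>}" for A B
  proof -
    have b: "\<bar>D (A <+> B) - D A - D B\<bar> \<le> 1 / real (Suc n)" for n
      using D(2)[of n] that unfolding F_def S_def by blast
    have "\<bar>D (A <+> B) - D A - D B\<bar> \<le> 0"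
    proof (rule field_le_epsilon)
      fix e :: real assume "0 < e"
      then obtain n where "1 / real (Suc n) < e" using nat_approx_posE by blast
      then show "\<bar>D (A <+> B) - D A - D B\<bar> \<le> 0 + e" using b[of n] by simp
    qed
    then show ?thesis by simp
  qed
  have "dimension_function D"
    unfolding dimension_function_def
  proof (intro conjI ballI allI impI)
    show "D (carrier R) = 1" "\<And>A B. piso A B \<Longrightarrow> D A = D B" using D(2)[of 0] by (auto simp: F_def)
    show "0 \<le> D A" for A using D(1) by (auto simp: K_def PiE_iff)
  qed (use add in auto)
  then show thesis by (rule that)
qed

section \<open>Dimension functions and rank functions\<close>

lemma lcos_vanish:
  assumes "A \<in> PR" "B \<in> PR" "s \<in> carrier R" "\<And>x. x \<in> A \<Longrightarrow> s \<otimes> x = \<zero>"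
  shows "s <# (A <+> B) = s <# B"
proof -
  have "s <# A = {\<zero>}" using assms(4) PR_zero[OF assms(1)] by (force simp: l_coset_def)
  then show ?thesis using lcos_set_add[OF assms(1-3)] set_add_zero(2)[OF lcos_PR[OF assms(3,2)]] by simp
qed

text \<open>Isomorphism theorem: \<open>s <# A\<close> is isomorphic to a complement in
  \<open>A\<close> of the kernel of \<open>s\<close>.\<close>

lemma lcos_emb:
  assumes "s \<in> carrier R" "A \<in> PR" shows "emb (s <# A) A"
proof -
  let ?K = "A \<inter> {x \<in> carrier R. s \<otimes> x = \<zero>}"
  have K: "?K \<in> PR" using inter_PR[OF assms(2) kernel_PR[OF assms(1)]] .
  obtain B where B: "B \<in> PR" "B \<subseteq> A" "?K \<inter> B = {\<zero>}" "?K <+> B = A"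
    using complement[OF K assms(2)] by auto
  have "piso B (s <# B)"
  proof (rule pisoI[OF assms(1) B(1)])
    fix x assume "x \<in> B" "s \<otimes> x = \<zero>"
    then have "x \<in> ?K \<inter> B" using B(2) PR_closed[OF B(1)] by blast
    then show "x = \<zero>" using B(3) by blast
  qed
  moreover have "s <# A = s <# B" using lcos_vanish[OF K B(1) assms(1)] B(4) by auto
  ultimately show ?thesis using piso_sym B(2) unfolding emb_def by auto
qed

lemma one_lcos_carrier: "\<one> <# carrier R = carrier R"
  by (rule lcos_one) simp

lemma mem_principal: "a \<in> carrier R \<Longrightarrow> a \<in> a <# carrier R"
  using lcosI[of \<one> "carrier R" a] by simp

lemma principal_subset: "A \<in> PR \<Longrightarrow> a \<in> A \<Longrightarrow> a <# carrier R \<subseteq> A"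
  using PR_mult by (auto simp: mem_lcos)

context
  fixes D assumes D: "dimension_function D"
begin

lemma dim_lcos: "s \<in> carrier R \<Longrightarrow> A \<in> PR \<Longrightarrow> D (s <# A) \<le> D A"
  using dim_emb[OF D lcos_emb] by simp

lemma dim_eq:
  assumes "A \<in> PR" "B \<in> PR" "A \<subseteq> B" "D B \<le> D A" shows "A = B"
proof -
  obtain C where C: "C \<in> PR" "A \<inter> C = {\<zero>}" "A <+> C = B" using complement[OF assms(1-3)] .
  then have "D C \<le> 0" using dim_add[OF D assms(1)] assms(4) by force
  then have "C = {\<zero>}" using dim_pos[OF D C(1)] by force
  then show ?thesis using C(3) set_add_zero assms(1) by auto
qed

text \<open>Comparability gives an embedding in one direction; its image has full dimension and is
  therefore everything.\<close>

lemma dim_eq_piso: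
  assumes "A \<in> PR" "B \<in> PR" "D A = D B" shows "piso A B"
proof -
  have *: "piso X Y" if XY: "emb X Y" "Y \<in> PR" "D X = D Y" for X Y
  proof -
    obtain Y' where Y': "piso X Y'" "Y' \<subseteq> Y" using XY(1) unfolding emb_def by blast
    then have "Y' = Y" using dim_eq[OF piso_PR(2)[OF Y'(1)] XY(2)] dim_piso[OF D Y'(1)] XY(3) by simp
    then show ?thesis using Y' by simp
  qed
  show ?thesis using comparable[OF assms(1,2)] * piso_sym assms by metis
qed

lemma dim_set_add_le:
  assumes "A \<in> PR" "B \<in> PR" shows "D (A <+> B) \<le> D A + D B"
proof -
  let ?K = "A \<inter> B"
  have K: "?K \<in> PR" using inter_PR assms by auto
  obtain C where C: "C \<in> PR" "C \<subseteq> B" "?K \<inter> C = {\<zero>}" "?K <+> C = B"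
    using complement[OF K assms(2)] by auto
  have "A \<inter> C = {\<zero>}" by (rule indepI) (use assms C in auto)
  moreover have "A <+> B \<subseteq> A <+> C"
  proof (rule set_add_least[OF subset_set_add1[OF assms(1) C(1)] _ set_add_PR[OF assms(1) C(1)]])
    show "B \<subseteq> A <+> C" using set_add_mono[of ?K A C C] C(4) by auto
  qed
  ultimately have "D (A <+> B) \<le> D A + D C"
    using dim_mono[OF D set_add_PR[OF assms] set_add_PR[OF assms(1) C(1)]] dim_add[OF D assms(1) C(1)] by simp
  then show ?thesis using dim_mono[OF D C(1) assms(2) C(2)] by simp
qed

text \<open>For the product, \<open>a b R\<close> is contained in \<open>a R\<close> and is the
  image of \<open>b R\<close> under \<open>a\<close>. Orthogonal idempotents generate independent
  ideals with sum \<open>(e + f) R\<close>.\<close>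

lemma rank_function_dim: "rank_function R (\<lambda>a\<in>carrier R. D (a <# carrier R))"
  unfolding rank_function_def
proof (intro conjI ballI impI)
  show "(\<lambda>a\<in>carrier R. D (a <# carrier R)) \<in> carrier R \<rightarrow>\<^sub>E {0..1}"
    using dim_nonneg[OF D PR_principal] dim_le_one[OF D PR_principal] by auto
  show "(\<lambda>a\<in>carrier R. D (a <# carrier R)) \<one> = 1" using dim_carrier[OF D] one_lcos_carrier by simp
next
  fix a b assume ab: "a \<in> carrier R" "b \<in> carrier R"
  have "D ((a \<otimes> b) <# carrier R) \<le> D (a <# carrier R)"
    using ab by (intro dim_mono[OF D] PR_principal principal_subset lcosI) auto
  moreover have "D ((a \<otimes> b) <# carrier R) \<le> D (b <# carrier R)"
    using dim_lcos[OF ab(1) PR_principal[OF ab(2)]] lcos_lcos[OF ab order_refl] by simp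
  ultimately show "(\<lambda>a\<in>carrier R. D (a <# carrier R)) (a \<otimes> b)
      \<le> min ((\<lambda>a\<in>carrier R. D (a <# carrier R)) a) ((\<lambda>a\<in>carrier R. D (a <# carrier R)) b)"
    using ab by simp
next
  fix e f assume e: "e \<in> carrier R" and f: "f \<in> carrier R"
    and ef: "e \<otimes> e = e \<and> f \<otimes> f = f \<and> e \<otimes> f = \<zero> \<and> f \<otimes> e = \<zero>"
  let ?E = "e <# carrier R" and ?F = "f <# carrier R" and ?G = "(e \<oplus> f) <# carrier R"
  have P: "?E \<in> PR" "?F \<in> PR" "?G \<in> PR" using PR_principal e f by auto
  have "e = (e \<oplus> f) \<otimes> e" "f = (e \<oplus> f) \<otimes> f" using ef e f by (auto simp: l_distr)
  then have "e \<in> ?G" "f \<in> ?G" using lcosI[of _ "carrier R" "e \<oplus> f"] e f by metis+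
  then have "?E <+> ?F \<subseteq> ?G" 
    by (intro set_add_least[OF principal_subset[OF P(3)] principal_subset[OF P(3)] P(3)])
  moreover have "?G \<subseteq> ?E <+> ?F"
    using principal_subset[OF set_add_PR[OF P(1,2)] set_addI[OF mem_principal mem_principal]] e f by auto
  moreover have "?E \<inter> ?F = {\<zero>}"
  proof (rule indepI[OF P(1,2)])
    fix x assume "x \<in> ?E" "x \<in> ?F"
    then obtain r s where x: "r \<in> carrier R" "s \<in> carrier R" "x = e \<otimes> r" "x = f \<otimes> s" by (auto simp: mem_lcos)
    have "x = e \<otimes> e \<otimes> r" using x ef by simp
    also have "\<dots> = e \<otimes> x" using x(1,3) e by (simp add: m_assoc)
    also have "\<dots> = e \<otimes> f \<otimes> s" using x e f by (simp add: m_assoc)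
    finally show "x = \<zero>" using ef x(2) by simp
  qed
  ultimately have "D ?G = D ?E + D ?F" using dim_add[OF D P(1,2)] by auto
  then show "(\<lambda>a\<in>carrier R. D (a <# carrier R)) (e \<oplus> f)
      = (\<lambda>a\<in>carrier R. D (a <# carrier R)) e + (\<lambda>a\<in>carrier R. D (a <# carrier R)) f"
    using e f by simp
next
  fix a assume a: "a \<in> carrier R" "(\<lambda>a\<in>carrier R. D (a <# carrier R)) a = 0"
  then have "a <# carrier R = {\<zero>}"
    using dim_pos[OF D PR_principal[OF a(1)]] by (cases "a <# carrier R = {\<zero>}") simp_all
  then show "a = \<zero>" using mem_principal[OF a(1)] by simp
qed

end

text \<open>The converse passage, which carries uniqueness of the dimension over to rank functions.
  The value at \<open>a\<close> depends on \<open>a R\<close> only, since two generators of one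
  ideal are right multiples of each other.\<close>

lemma rank_function_dimension:
  assumes rho: "rank_function R \<rho>"
  obtains D where "dimension_function D" "\<And>a. a \<in> carrier R \<Longrightarrow> \<rho> a = D (a <# carrier R)"
proof -
  have range: "0 \<le> \<rho> a" if "a \<in> carrier R" for a using rho that by (auto simp: rank_function_def PiE_iff)
  have one: "\<rho> \<one> = 1" using rho by (auto simp: rank_function_def)
  have mult: "\<rho> (a \<otimes> b) \<le> \<rho> a" "\<rho> (a \<otimes> b) \<le> \<rho> b" if "a \<in> carrier R" "b \<in> carrier R" for a b
    using rho that by (auto simp: rank_function_def)
  have orth: "\<rho> (e \<oplus> f) = \<rho> e + \<rho> f"
    if "e \<in> carrier R" "f \<in> carrier R" "e \<otimes> e = e" "f \<otimes> f = f" "e \<otimes> f = \<zero>" "f \<otimes> e = \<zero>" for e f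
    using rho that by (auto simp: rank_function_def)
  have le: "\<rho> a \<le> \<rho> b" if "a \<in> carrier R" "b \<in> carrier R" "a <# carrier R \<subseteq> b <# carrier R" for a b
  proof -
    have "a \<in> b <# carrier R" using mem_principal that by blast
    then obtain r where "r \<in> carrier R" "a = b \<otimes> r" by (auto simp: mem_lcos)
    then show ?thesis using mult that by auto
  qed
  define D where "D A = \<rho> (SOME a. a \<in> carrier R \<and> A = a <# carrier R)" for A
  have D: "D (a <# carrier R) = \<rho> a" if a: "a \<in> carrier R" for a
  proof -
    let ?b = "SOME b. b \<in> carrier R \<and> a <# carrier R = b <# carrier R"
    have "?b \<in> carrier R \<and> a <# carrier R = ?b <# carrier R"
      by (rule someI[of _ a]) (use a in auto)
    then show ?thesis using le a unfolding D_def by (intro antisym) auto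
  qed
  have iso_le: "D B \<le> D A" if AB: "piso A B" for A B
  proof -
    obtain s where s: "s \<in> carrier R" "s <# A = B" using AB unfolding piso_def by blast
    obtain a where a: "a \<in> carrier R" "A = a <# carrier R" using piso_PR(1)[OF AB] by (auto simp: PR_def)
    have "B = (s \<otimes> a) <# carrier R" using s a lcos_lcos by auto
    then show ?thesis using D s a mult by auto
  qed
  have "dimension_function D"
    unfolding dimension_function_def
  proof (intro conjI ballI allI impI)
    show "D (carrier R) = 1" using D[OF one_closed] one one_lcos_carrier by simp
    show "0 \<le> D A" if "A \<in> PR" for A using that D range by (auto simp: PR_def)
    show "D A = D B" if "piso A B" for A B
      by (rule antisym[OF iso_le[OF piso_sym[OF that]] iso_le[OF that]])
    fix A B assume A: "A \<in> PR" and B: "B \<in> PR" and AB: "A \<inter> B = {\<zero>}"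
    obtain C where C: "C \<in> PR" "B \<subseteq> C" "A \<inter> C = {\<zero>}" "A <+> C = carrier R"
      using complement_carrier[OF A B AB] .
    obtain p where p: "p \<in> carrier R" "p \<in> A" "\<And>x. x \<in> A \<Longrightarrow> p \<otimes> x = x" "\<And>x. x \<in> C \<Longrightarrow> p \<otimes> x = \<zero>"
      using projection[OF A C(1,3,4)] by metis
    obtain g where g: "g \<in> carrier R" "g \<in> B" "\<And>x. x \<in> B \<Longrightarrow> g \<otimes> x = x" using PR_idem[OF B] by metis
    \<comment> \<open>An idempotent generator \<open>g\<close> of \<open>B\<close> satisfies
      \<open>p g = 0\<close>, but \<open>g p\<close> may be non-zero; the factor
      \<open>1 - p\<close> kills it while \<open>f\<close> still fixes \<open>B\<close>.\<close>
    define f where "f = g \<otimes> (\<one> \<ominus> p)"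
    have f: "f \<in> carrier R" "f \<in> B" using g p PR_mult[OF B g(2)] by (auto simp: f_def)
    have pf: "p \<otimes> f = \<zero>" using p(4) C(2) f(2) by auto
    have fx: "f \<otimes> x = x" if x: "x \<in> B" for x
    proof -
      have xc: "x \<in> carrier R" using x PR_closed[OF B] by auto
      have "f \<otimes> x = g \<otimes> x \<ominus> g \<otimes> (p \<otimes> x)" unfolding f_def using g(1) p(1) xc by algebra
      moreover have "p \<otimes> x = \<zero>" using p(4) C(2) x by auto
      ultimately show ?thesis using g(3)[OF x] g(1) xc by (simp add: a_minus_def)
    qed
    have "f \<otimes> p = g \<otimes> p \<ominus> g \<otimes> (p \<otimes> p)" unfolding f_def using g(1) p(1) by algebra
    then have fp: "f \<otimes> p = \<zero>" using p(3)[OF p(2)] g(1) p(1) by (simp add: a_minus_def r_neg)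
    have A': "A = p <# carrier R"
      using principal_subset[OF A p(2)] p(3) PR_closed[OF A] by (force simp: mem_lcos)
    have B': "B = f <# carrier R"
      using principal_subset[OF B f(2)] fx PR_closed[OF B] by (force simp: mem_lcos)
    have "A <+> B = (p \<oplus> f) <# carrier R"
    proof
      show "(p \<oplus> f) <# carrier R \<subseteq> A <+> B"
        by (rule principal_subset[OF set_add_PR[OF A B] set_addI[OF p(2) f(2)]])
      have "p = (p \<oplus> f) \<otimes> p" using p(1) f(1) fp p(3)[OF p(2)] by (simp add: l_distr)
      moreover have "f = (p \<oplus> f) \<otimes> f" using p(1) f(1) pf fx[OF f(2)] by (simp add: l_distr)
      ultimately have "p \<in> (p \<oplus> f) <# carrier R" "f \<in> (p \<oplus> f) <# carrier R"
        using lcosI[of _ "carrier R" "p \<oplus> f"] p f by metis+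
      then show "A <+> B \<subseteq> (p \<oplus> f) <# carrier R"
        unfolding A' B' using PR_principal p f by (intro set_add_least principal_subset) auto
    qed
    then show "D (A <+> B) = D A + D B"
      using D p f orth[OF p(1) f(1) p(3)[OF p(2)] fx[OF f(2)] pf fp] by (simp add: A' B')
  qed
  then show thesis using that D by metis
qed

lemma rk_dimension:
  assumes "carrier R \<noteq> {\<zero>}"
  obtains D where "dimension_function D" "\<And>a. a \<in> carrier R \<Longrightarrow> rk R a = D (a <# carrier R)"
proof -
  obtain D where D: "dimension_function D" using dimension_exists[OF assms] .
  have "rank_function R (rk R)"
    unfolding rk_def
  proof (rule theI[where P = "rank_function R" and a = "\<lambda>a\<in>carrier R. D (a <# carrier R)"])
    show "rank_function R (\<lambda>a\<in>carrier R. D (a <# carrier R))" using rank_function_dim[OF D] .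
    fix \<rho> assume rho: "rank_function R \<rho>"
    obtain E where E: "dimension_function E" "\<And>a. a \<in> carrier R \<Longrightarrow> \<rho> a = E (a <# carrier R)"
      using rank_function_dimension[OF rho] by metis
    show "\<rho> = (\<lambda>a\<in>carrier R. D (a <# carrier R))"
    proof (rule extensionalityI)
      show "\<rho> \<in> extensional (carrier R)" using rho by (auto simp: rank_function_def PiE_def)
    qed (use E dimension_unique[OF E(1) D] PR_principal in auto)
  qed
  then show thesis using rank_function_dimension that by metis
qed

text \<open>The triangle inequality is subadditivity of the dimension on
  \<open>(x - y) R + (y - z) R\<close>, an ideal that contains \<open>x - z\<close>.\<close>

lemma Metric_space_rank_dist:
  assumes D: "dimension_function D" and rk: "\<And>a. a \<in> carrier R \<Longrightarrow> rk R a = D (a <# carrier R)"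
  shows "Metric_space (carrier R) (rank_dist R)"
proof -
  have neg: "D (\<ominus> a <# carrier R) = D (a <# carrier R)" if a: "a \<in> carrier R" for a
  proof -
    have *: "\<ominus> b <# carrier R \<subseteq> b <# carrier R" if "b \<in> carrier R" for b
      using that by (intro principal_subset PR_principal PR_neg mem_principal)
    show ?thesis using *[OF a] *[of "\<ominus> a"] a by (simp add: minus_minus)
  qed
  show ?thesis
  proof
    show "0 \<le> rank_dist R x y" for x y
      using dim_nonneg[OF D PR_principal] by (auto simp: rank_dist_def rk)
    show "rank_dist R x y = rank_dist R y x" for x y
    proof (cases "x \<in> carrier R \<and> y \<in> carrier R")
      case True
      then have "y \<ominus> x = \<ominus> (x \<ominus> y)" by (metis a_minus_def a_inv_closed a_comm minus_add minus_minus)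
      then show ?thesis using True neg by (simp add: rank_dist_def rk)
    qed (auto simp: rank_dist_def)
    show "rank_dist R x y = 0 \<longleftrightarrow> x = y" if "x \<in> carrier R" "y \<in> carrier R" for x y
    proof
      assume "rank_dist R x y = 0"
      then have "D ((x \<ominus> y) <# carrier R) = 0" using that by (simp add: rank_dist_def rk)
      then have "(x \<ominus> y) <# carrier R = {\<zero>}"
        using dim_pos[OF D PR_principal, of "x \<ominus> y"] that by (cases "(x \<ominus> y) <# carrier R = {\<zero>}") simp_all
      then show "x = y" using mem_principal[of "x \<ominus> y"] minus_zero_iff that by auto
    next
      assume "x = y"
      then have "x \<ominus> y = \<zero>" using minus_zero_iff that by auto
      moreover have "\<zero> <# carrier R = {\<zero>}" by (auto simp: l_coset_def)
      ultimately show "rank_dist R x y = 0" using that dim_zero[OF D] by (simp add: rank_dist_def rk)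
    qed
    fix x y z assume c: "x \<in> carrier R" "y \<in> carrier R" "z \<in> carrier R"
    let ?X = "(x \<ominus> y) <# carrier R" and ?Y = "(y \<ominus> z) <# carrier R"
    have P: "?X \<in> PR" "?Y \<in> PR" using PR_principal c by auto
    have "x \<ominus> z = (x \<ominus> y) \<oplus> (y \<ominus> z)" using c by algebra
    then have "x \<ominus> z \<in> ?X <+> ?Y" using set_addI[OF mem_principal mem_principal] c by simp
    then have "D ((x \<ominus> z) <# carrier R) \<le> D (?X <+> ?Y)"
      using c by (intro dim_mono[OF D] PR_principal principal_subset set_add_PR P) auto
    also have "\<dots> \<le> D ?X + D ?Y" using dim_set_add_le[OF D P] .
    finally show "rank_dist R x z \<le> rank_dist R x y + rank_dist R y z" using c by (simp add: rank_dist_def rk)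
  qed
qed

section \<open>Generation of the unit group\<close>

lemma unit_iff_bijective:
  assumes h: "h \<in> carrier R" and surj: "h <# carrier R = carrier R"
    and inj: "\<And>x. x \<in> carrier R \<Longrightarrow> h \<otimes> x = \<zero> \<Longrightarrow> x = \<zero>"
  shows "h \<in> Units R"
proof -
  have "\<one> \<in> h <# carrier R" using surj by simp
  then obtain y where y: "y \<in> carrier R" "h \<otimes> y = \<one>" by (auto simp: mem_lcos)
  have "h \<otimes> (y \<otimes> h) = h \<otimes> \<one>" using h y by (simp flip: m_assoc)
  then have "y \<otimes> h = \<one>" using lcos_inj[OF carrier_PR h inj, of "y \<otimes> h" \<one>] h y by auto
  then show ?thesis using h y by (auto simp: Units_def)
qed

text \<open>The element \<open>h0\<close>, equal to \<open>u\<close> on \<open>A\<close> and to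
  \<open>1\<close> on a complement \<open>C\<close> containing \<open>P\<close>, differs from
  \<open>1\<close> only along \<open>A\<close>, but may fail to be injective. Its kernel
  \<open>K\<close> is mapped onto a complement \<open>M\<close> of its image instead. Both changes
  cost at most \<open>D A\<close>, whence the factor 2.\<close>

lemma unit_small_agreement:
  assumes D: "dimension_function D" and u: "u \<in> Units R" and P: "P \<in> PR" and A: "A \<in> PR"
    and PA: "P \<inter> A = {\<zero>}" and fixP: "\<And>x. x \<in> P \<Longrightarrow> u \<otimes> x = x"
  obtains h where "h \<in> Units R" "\<And>x. x \<in> P <+> A \<Longrightarrow> h \<otimes> x = u \<otimes> x" "D ((h \<ominus> \<one>) <# carrier R) \<le> 2 * D A"
proof -
  have uc: "u \<in> carrier R" using u by auto
  have ui: "x = \<zero>" if "x \<in> carrier R" "u \<otimes> x = \<zero>" for x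
  proof -
    have "x = inv u \<otimes> (u \<otimes> x)" using u uc that(1) by (simp flip: m_assoc)
    then show ?thesis using that u by simp
  qed
  obtain C where C: "C \<in> PR" "P \<subseteq> C" "A \<inter> C = {\<zero>}" "A <+> C = carrier R"
    using complement_carrier[OF A P] PA by (metis inf_commute)
  obtain h0 where h0: "h0 \<in> carrier R" "\<And>x. x \<in> A \<Longrightarrow> h0 \<otimes> x = u \<otimes> x" "\<And>x. x \<in> C \<Longrightarrow> h0 \<otimes> x = \<one> \<otimes> x"
    using glue[OF A C(1,3) uc one_closed] by metis
  have AP: "P <+> A \<in> PR" using set_add_PR P A by auto
  have h0PA: "h0 \<otimes> x = u \<otimes> x" if x: "x \<in> P <+> A" for x
  proof -
    obtain a b where ab: "a \<in> P" "b \<in> A" "x = a \<oplus> b" using x by (auto simp: mem_set_add)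
    have c: "a \<in> carrier R" "b \<in> carrier R" using ab P A PR_closed by auto
    have "h0 \<otimes> a = u \<otimes> a" using h0(3)[OF subsetD[OF C(2) ab(1)]] fixP[OF ab(1)] c by simp
    then show ?thesis using c h0(1) h0(2)[OF ab(2)] uc by (simp add: ab(3) r_distr)
  qed
  define K where "K = {x \<in> carrier R. h0 \<otimes> x = \<zero>}"
  have K: "K \<in> PR" unfolding K_def using kernel_PR[OF h0(1)] .
  \<comment> \<open>On \<open>P <+> A\<close> the element \<open>h0\<close> agrees with the
    injective \<open>u\<close>, so \<open>K\<close> avoids it; a complement \<open>T\<close> of
    \<open>K\<close> containing \<open>P <+> A\<close> is untouched by the repair.\<close>
  have "K \<inter> (P <+> A) = {\<zero>}"
    by (rule indepI[OF K AP]) (use h0PA ui in \<open>auto simp: K_def\<close>)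
  then obtain T where T: "T \<in> PR" "P <+> A \<subseteq> T" "K \<inter> T = {\<zero>}" "K <+> T = carrier R"
    using complement_carrier[OF K AP] by metis
  have KC: "K \<inter> C = {\<zero>}"
    by (rule indepI[OF K C(1)]) (use h0(3) in \<open>auto simp: K_def\<close>)
  \<comment> \<open>\<open>h0\<close> is the identity on \<open>C\<close>, so \<open>K\<close> meets
    \<open>C\<close> trivially, and \<open>C\<close> has codimension \<open>D A\<close>.\<close>
  have "D K + D C \<le> 1"
    using dim_le_one[OF D set_add_PR[OF K C(1)]] dim_add[OF D K C(1) KC] by simp
  moreover have "D A + D C = 1" using dim_add[OF D A C(1,3)] C(4) dim_carrier[OF D] by simp
  ultimately have DK: "D K \<le> D A" by simp
  let ?I = "h0 <# carrier R"
  have I: "?I \<in> PR" using lcos_PR h0 carrier_PR by auto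
  have IT: "?I = h0 <# T" using lcos_vanish[OF K T(1) h0(1)] T(4) by (auto simp: K_def)
  have h0T: "x = \<zero>" if "x \<in> T" "h0 \<otimes> x = \<zero>" for x
    using that T(3) PR_closed[OF T(1)] by (auto simp: K_def)
  have "piso T (h0 <# T)" using h0T by (intro pisoI[OF h0(1) T(1)]) auto
  then have DT: "D T = D ?I" using dim_piso[OF D] IT by simp
  obtain M where M: "M \<in> PR" "?I \<inter> M = {\<zero>}" "?I <+> M = carrier R"
    using complement[OF I carrier_PR PR_subset[OF I]] by metis
  \<comment> \<open>Rank and nullity: \<open>T\<close> is isomorphic to the image, so kernel and
    cokernel have the same dimension.\<close>
  have "D K = D M"
    using dim_add[OF D K T(1,3)] dim_add[OF D I M(1,2)] T(4) M(3) DT by simp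
  then have "piso K M" using dim_eq_piso[OF D K M(1)] by simp
  then obtain s where s: "s \<in> carrier R" "s <# K = M" "\<And>x. x \<in> K \<Longrightarrow> s \<otimes> x = \<zero> \<Longrightarrow> x = \<zero>"
    unfolding piso_def by blast
  obtain h where h: "h \<in> carrier R" "\<And>x. x \<in> K \<Longrightarrow> h \<otimes> x = s \<otimes> x" "\<And>x. x \<in> T \<Longrightarrow> h \<otimes> x = h0 \<otimes> x"
    using glue[OF K T(1,3) s(1) h0(1)] by metis
  have "h <# carrier R = (h <# K) <+> (h <# T)" using lcos_set_add[OF K T(1) h(1)] T(4) by simp
  also have "h <# K = M" using h(2) s(2) by (auto simp: l_coset_def)
  also have "h <# T = ?I" using h(3) unfolding IT by (auto simp: l_coset_def)
  finally have surj: "h <# carrier R = carrier R" using set_add_comm[OF M(1) I] M(3) by simp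
  have inj: "x = \<zero>" if x: "x \<in> carrier R" "h \<otimes> x = \<zero>" for x
  proof -
    have "x \<in> K <+> T" using x T(4) by simp
    then obtain k t where kt: "k \<in> K" "t \<in> T" "x = k \<oplus> t" by (auto simp: mem_set_add)
    have c: "k \<in> carrier R" "t \<in> carrier R" using kt K T PR_closed by auto
    have "h0 \<otimes> t \<oplus> s \<otimes> k = \<zero>"
      using x(2) kt c h s(1) h0(1) by (simp add: r_distr a_comm)
    moreover have "h0 \<otimes> t \<in> ?I" "s \<otimes> k \<in> M" using lcosI c s(2) kt by blast+
    ultimately have "h0 \<otimes> t = \<zero>" "s \<otimes> k = \<zero>" using indepD[OF I M(1,2)] by auto
    then have "t = \<zero>" "k = \<zero>" using kt s(3) h0T by blast+
    then show ?thesis using kt(3) by simp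
  qed
  have hu: "h \<in> Units R" using unit_iff_bijective[OF h(1) surj inj] .
  have agree: "h \<otimes> x = u \<otimes> x" if "x \<in> P <+> A" for x using h(3) h0PA T(2) that by auto
  have diff: "(a \<ominus> b) \<otimes> x = \<zero>" if "a \<in> carrier R" "b \<in> carrier R" "x \<in> carrier R" "a \<otimes> x = b \<otimes> x" for a b x
  proof -
    have "(a \<ominus> b) \<otimes> x = a \<otimes> x \<ominus> b \<otimes> x" using that(1-3) by algebra
    then show ?thesis using that by (simp add: a_minus_def r_neg)
  qed
  have "(h \<ominus> h0) <# carrier R = (h \<ominus> h0) <# K"
    using lcos_vanish[OF T(1) K, of "h \<ominus> h0"] set_add_comm[OF K T(1)] T(4) diff h h0 PR_closed[OF T(1)] by auto
  then have d1: "D ((h \<ominus> h0) <# carrier R) \<le> D K" using dim_lcos[OF D _ K] h h0 by auto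
  have "(h0 \<ominus> \<one>) <# carrier R = (h0 \<ominus> \<one>) <# A"
    using lcos_vanish[OF C(1) A, of "h0 \<ominus> \<one>"] set_add_comm[OF A C(1)] C(4) diff[OF _ _ _ h0(3)] h0(1) PR_closed[OF C(1)] by auto
  then have d2: "D ((h0 \<ominus> \<one>) <# carrier R) \<le> D A" using dim_lcos[OF D _ A] h0 by auto
  let ?X = "(h \<ominus> h0) <# carrier R" and ?Y = "(h0 \<ominus> \<one>) <# carrier R"
  have XY: "?X \<in> PR" "?Y \<in> PR" using PR_principal h h0 by auto
  have "h \<ominus> \<one> = (h \<ominus> h0) \<oplus> (h0 \<ominus> \<one>)" using h(1) h0(1) by algebra
  then have "h \<ominus> \<one> \<in> ?X <+> ?Y" using set_addI[OF mem_principal mem_principal] h h0 by simp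
  then have "D ((h \<ominus> \<one>) <# carrier R) \<le> D (?X <+> ?Y)"
    using h by (intro dim_mono[OF D] PR_principal principal_subset set_add_PR XY) auto
  also have "\<dots> \<le> D ?X + D ?Y" using dim_set_add_le[OF D XY] .
  finally have "D ((h \<ominus> \<one>) <# carrier R) \<le> 2 * D A" using d1 d2 DK by simp
  then show thesis using that hu agree by blast
qed

text \<open>Induction on a number \<open>n\<close> of copies of \<open>A\<close> whose total
  dimension bounds the codimension of a fixed ideal \<open>P\<close>. As
  \<open>u = h (inv h u)\<close> and \<open>inv h u\<close> fixes one more copy of \<open>A\<close>,
  closure of \<open>S\<close> under products is enough.\<close>

lemma units_generated:
  assumes D: "dimension_function D"
    and small: "\<And>e. 0 < e \<Longrightarrow> \<exists>A\<in>PR. A \<noteq> {\<zero>} \<and> D A < e" and d: "0 < d"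
    and S: "\<one> \<in> S" "\<And>x y. x \<in> S \<Longrightarrow> y \<in> S \<Longrightarrow> x \<otimes> y \<in> S"
      "\<And>u. u \<in> Units R \<Longrightarrow> D ((u \<ominus> \<one>) <# carrier R) < d \<Longrightarrow> u \<in> S"
  shows "Units R \<subseteq> S"
proof
  fix u assume u: "u \<in> Units R"
  \<comment> \<open>\<open>d / 2\<close> because the unit \<open>h\<close> is only within
    \<open>2 * D A\<close> of \<open>1\<close>.\<close>
  obtain A where A: "A \<in> PR" "A \<noteq> {\<zero>}" "D A < d / 2" using small[of "d / 2"] d by auto
  have DA: "0 < D A" using dim_pos[OF D A(1,2)] .
  have main: "u \<in> S"
    if "u \<in> Units R" "P \<in> PR" "\<And>x. x \<in> P \<Longrightarrow> u \<otimes> x = x" "1 - D P \<le> n * D A" for n :: nat and u P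
    using that
  proof (induction n arbitrary: u P)
    case 0
    then have "P = carrier R" using dim_eq[OF D 0(2) carrier_PR PR_subset[OF 0(2)]] dim_carrier[OF D] by simp
    then have "u = \<one>" using 0(1) 0(3)[of \<one>] by auto
    then show ?case using S by simp
  next
    case (Suc n)
    have uc: "u \<in> carrier R" using Suc.prems by auto
    obtain C where C: "C \<in> PR" "P \<inter> C = {\<zero>}" "P <+> C = carrier R"
      using complement[OF Suc.prems(2) carrier_PR PR_subset[OF Suc.prems(2)]] by metis
    show ?case
    proof (cases "emb A C")
      case True
      then obtain A' where A': "piso A A'" "A' \<subseteq> C" unfolding emb_def by blast
      have P: "A' \<in> PR" using piso_PR A' by auto
      have i: "P \<inter> A' = {\<zero>}" using indep_mono[OF C(2) order_refl A'(2) Suc.prems(2) P] .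
      obtain h where h: "h \<in> Units R" "\<And>x. x \<in> P <+> A' \<Longrightarrow> h \<otimes> x = u \<otimes> x" "D ((h \<ominus> \<one>) <# carrier R) \<le> 2 * D A'"
        using unit_small_agreement[OF D Suc.prems(1,2) P i Suc.prems(3)] by metis
      have hc: "h \<in> carrier R" "inv h \<in> carrier R" using h by auto
      have "h \<in> S" using S(3)[OF h(1)] h(3) dim_piso[OF D A'(1)] A(3) by simp
      moreover have "inv h \<otimes> u \<in> S"
      proof (rule Suc.IH)
        show "inv h \<otimes> u \<in> Units R" using h Suc.prems(1) by auto
        show "P <+> A' \<in> PR" using set_add_PR P Suc.prems by auto
        show "inv h \<otimes> u \<otimes> x = x" if x: "x \<in> P <+> A'" for x
        proof -
          have xc: "x \<in> carrier R" using x PR_closed \<open>P <+> A' \<in> PR\<close> by blast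
          have "inv h \<otimes> u \<otimes> x = inv h \<otimes> (h \<otimes> x)" using h(2)[OF x] hc uc xc by (simp add: m_assoc)
          also have "\<dots> = x" using h(1) hc xc by (simp flip: m_assoc)
          finally show ?thesis .
        qed
        show "1 - D (P <+> A') \<le> n * D A"
          using dim_add[OF D Suc.prems(2) P i] dim_piso[OF D A'(1)] Suc.prems(4) by (simp add: algebra_simps)
      qed
      moreover have "h \<otimes> (inv h \<otimes> u) = u" using h(1) hc uc by (simp flip: m_assoc)
      ultimately show ?thesis using S(2) by metis
    next
      case False
      \<comment> \<open>The whole complement of \<open>P\<close> is now no larger than
        \<open>A\<close>, so one unit agrees with \<open>u\<close> everywhere and \<open>u\<close>
        itself is close to \<open>1\<close>.\<close>
      then have "D C \<le> D A" using comparable[OF A(1) C(1)] dim_emb[OF D _ A(1)] by auto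
      obtain h where h: "h \<in> Units R" "\<And>x. x \<in> P <+> C \<Longrightarrow> h \<otimes> x = u \<otimes> x" "D ((h \<ominus> \<one>) <# carrier R) \<le> 2 * D C"
        using unit_small_agreement[OF D Suc.prems(1,2) C(1,2) Suc.prems(3)] by metis
      have "h \<otimes> \<one> = u \<otimes> \<one>" using h(2) C(3) by simp
      then have "h = u" using h(1) uc by auto
      then show ?thesis using S(3)[OF h(1)] h(3) \<open>D C \<le> D A\<close> A(3) by simp
    qed
  qed
  obtain n :: nat where "1 / D A < n" using reals_Archimedean2 by blast
  then have "1 - D {\<zero>} \<le> n * D A" using DA dim_zero[OF D] by (simp add: field_simps)
  then show "u \<in> S" using main[OF u zero_PR] u by auto
qed

end

section \<open>Irreducible rings are prime\<close>

context complete_regular_ring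
begin

text \<open>If \<open>b R a = 0\<close>, the annihilator \<open>{x. b R x = 0}\<close> is an intersection of principal right
  ideals, hence principal by completeness; being two-sided, it is generated by a central idempotent.\<close>

lemma central_idempotent_of_not_prime:
  assumes a: "a \<in> carrier R" "a \<noteq> \<zero>" and b: "b \<in> carrier R" "b \<noteq> \<zero>"
    and ann: "\<And>r. r \<in> carrier R \<Longrightarrow> b \<otimes> r \<otimes> a = \<zero>"
  obtains e where "e \<in> carrier R" "e \<otimes> e = e" "e \<noteq> \<zero>" "e \<noteq> \<one>" "\<And>r. r \<in> carrier R \<Longrightarrow> e \<otimes> r = r \<otimes> e"
proof -
  define J where "J = \<Inter>{{x \<in> carrier R. b \<otimes> r \<otimes> x = \<zero>} |r. r \<in> carrier R}"
  have J: "J \<in> PR"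
    unfolding J_def by (rule Inter_PR) (use kernel_PR b in auto)
  have mem: "x \<in> J \<longleftrightarrow> x \<in> carrier R \<and> (\<forall>r\<in>carrier R. b \<otimes> r \<otimes> x = \<zero>)" for x
    using one_closed by (auto simp: J_def)
  obtain e where e: "e \<in> carrier R" "e \<otimes> e = e" "e \<in> J" "\<And>x. x \<in> J \<Longrightarrow> e \<otimes> x = x"
    using PR_idem[OF J] by metis
  have left: "r \<otimes> e \<in> J" if r: "r \<in> carrier R" for r
  proof -
    have "b \<otimes> s \<otimes> (r \<otimes> e) = b \<otimes> (s \<otimes> r) \<otimes> e" if "s \<in> carrier R" for s
      using that r e(1) b(1) by algebra
    then show ?thesis using e(1,3) r by (auto simp: mem)
  qed
  have kill: "(\<one> \<ominus> e) \<otimes> (r \<otimes> e) = \<zero>" if r: "r \<in> carrier R" for r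
  proof -
    have "(\<one> \<ominus> e) \<otimes> (r \<otimes> e) = r \<otimes> e \<ominus> e \<otimes> (r \<otimes> e)" using r e(1) by algebra
    then show ?thesis using e(1) e(4)[OF left[OF r]] r by (simp add: a_minus_def r_neg)
  qed
  have "e \<otimes> r = r \<otimes> e" if r: "r \<in> carrier R" for r
  proof -
    \<comment> \<open>\<open>z y z\<close> contains the factor \<open>(1 - e) y e = 0\<close> for
      every \<open>y\<close>, so regularity gives \<open>z = 0\<close>, that is
      \<open>e r = e r e\<close>; this is \<open>r e\<close>, because \<open>J\<close> is a left
      ideal.\<close>
    define z where "z = e \<otimes> r \<otimes> (\<one> \<ominus> e)"
    have zc: "z \<in> carrier R" using r e by (auto simp: z_def)
    obtain y where y: "y \<in> carrier R" "z \<otimes> y \<otimes> z = z" using regular[OF zc] by blast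
    have "z \<otimes> y \<otimes> z = e \<otimes> r \<otimes> ((\<one> \<ominus> e) \<otimes> (y \<otimes> e)) \<otimes> (r \<otimes> (\<one> \<ominus> e))"
      unfolding z_def using r e(1) y(1) by algebra
    then have "z = \<zero>" using kill[OF y(1)] y(2) r e(1) by simp
    moreover have "z = e \<otimes> r \<ominus> e \<otimes> (r \<otimes> e)" 
      unfolding z_def using r e(1) by (simp add: a_minus_def r_distr r_minus m_assoc)
    ultimately show ?thesis using e(1) e(4)[OF left[OF r]] r minus_zero_iff by simp
  qed
  \<comment> \<open>\<open>a\<close> lies in \<open>J\<close>, so \<open>J\<close> is non-zero;
    \<open>1\<close> does not, since \<open>b 1 1 = b\<close> is non-zero.\<close>
  moreover have "e \<noteq> \<zero>" using e(4)[of a] a ann by (auto simp: mem)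
  moreover have "e \<noteq> \<one>" using e(3) b by (auto simp: mem)
  ultimately show thesis using that e(1,2) by blast
qed

text \<open>The direct factor \<open>e R\<close> with unit \<open>e\<close>, a ring when
  \<open>e\<close> is a central idempotent. Its elements have the type of those of \<open>R\<close>,
  as in \<open>irreducible_ring\<close>.\<close>

definition corner :: "'a \<Rightarrow> 'a ring" where
  "corner e = \<lparr>carrier = e <# carrier R, mult = mult R, one = e, zero = \<zero>, add = add R\<rparr>"

lemma corner_zero: "\<zero>\<^bsub>corner e\<^esub> = \<zero>"
  by (simp add: corner_def)

lemma corner_ring:
  assumes e: "e \<in> carrier R" "e \<otimes> e = e" "\<And>r. r \<in> carrier R \<Longrightarrow> e \<otimes> r = r \<otimes> e"
  shows "ring (corner e)"
proof -
  let ?E = "e <# carrier R"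
  have E: "?E \<in> PR" using PR_principal e(1) by auto
  have c: "x \<in> carrier R" "e \<otimes> x = x" "x \<otimes> e = x" if xE: "x \<in> ?E" for x
  proof -
    show x: "x \<in> carrier R" by (rule PR_closed[OF E xE])
    obtain r where r: "r \<in> carrier R" "x = e \<otimes> r" using xE unfolding mem_lcos by blast
    show ex: "e \<otimes> x = x" unfolding r(2) using e(1,2) r(1) by (simp flip: m_assoc)
    show "x \<otimes> e = x" using e(3)[OF x] ex by simp
  qed
  have "abelian_group (corner e)"
  proof (rule abelian_groupI)
    fix x assume "x \<in> carrier (corner e)"
    then have x: "x \<in> ?E" by (simp add: corner_def)
    then have "\<ominus> x \<in> ?E" "\<ominus> x \<oplus> x = \<zero>" using PR_neg[OF E] c by (auto simp: l_neg)
    then show "\<exists>y\<in>carrier (corner e). y \<oplus>\<^bsub>corner e\<^esub> x = \<zero>\<^bsub>corner e\<^esub>" by (auto simp: corner_def)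
  qed (use PR_add[OF E] PR_zero[OF E] c in \<open>auto simp: corner_def a_ac\<close>)
  moreover have "monoid (corner e)"
  proof (rule monoidI)
    show "\<one>\<^bsub>corner e\<^esub> \<in> carrier (corner e)"
      using lcosI[OF e(1), of e] e(2) by (simp add: corner_def)
  qed (use PR_mult[OF E] c in \<open>auto simp: corner_def m_assoc\<close>)
  ultimately show ?thesis
    by (rule ringI) (use c in \<open>auto simp: corner_def l_distr r_distr\<close>)
qed

lemma corner_decomposition:
  assumes e: "e \<in> carrier R" "e \<otimes> e = e" "\<And>r. r \<in> carrier R \<Longrightarrow> e \<otimes> r = r \<otimes> e"
  shows "R \<simeq> RDirProd (corner e) (corner (\<one> \<ominus> e))"
proof -
  let ?f = "\<one> \<ominus> e"
  have f: "?f \<in> carrier R" using e(1) by auto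
  have fr: "?f \<otimes> r = r \<ominus> e \<otimes> r" if "r \<in> carrier R" for r using that e(1) by algebra
  have ef: "e \<otimes> (?f \<otimes> r) = \<zero>" if r: "r \<in> carrier R" for r
  proof -
    have "e \<otimes> (?f \<otimes> r) = e \<otimes> r \<ominus> e \<otimes> e \<otimes> r" using r e(1) by algebra
    then show ?thesis using e(1,2) r by (simp add: a_minus_def r_neg)
  qed
  have fe: "?f \<otimes> (e \<otimes> r) = \<zero>" if r: "r \<in> carrier R" for r
  proof -
    have "?f \<otimes> (e \<otimes> r) = e \<otimes> r \<ominus> e \<otimes> e \<otimes> r" using r e(1) by algebra
    then show ?thesis using e(1,2) r by (simp add: a_minus_def r_neg)
  qed
  have ee: "e \<otimes> (e \<otimes> r) = e \<otimes> r" if "r \<in> carrier R" for r using that e(1,2) by (simp flip: m_assoc)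
  have ff: "?f \<otimes> (?f \<otimes> r) = ?f \<otimes> r" if r: "r \<in> carrier R" for r
  proof -
    have "?f \<otimes> (?f \<otimes> r) = ?f \<otimes> r \<ominus> e \<otimes> (?f \<otimes> r)" using r e(1) by algebra
    then show ?thesis using ef[OF r] r e(1) by (simp add: a_minus_def)
  qed
  have sum: "e \<otimes> r \<oplus> ?f \<otimes> r = r" if "r \<in> carrier R" for r using that e(1) by algebra
  have multe: "e \<otimes> (x \<otimes> y) = e \<otimes> x \<otimes> (e \<otimes> y)" if "x \<in> carrier R" "y \<in> carrier R" for x y
  proof -
    have "e \<otimes> x \<otimes> (e \<otimes> y) = e \<otimes> (x \<otimes> e) \<otimes> y" using that e(1) by (simp add: m_assoc)
    also have "\<dots> = e \<otimes> (e \<otimes> x) \<otimes> y" using e(3) that by simp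
    finally show ?thesis using ee that e(1) by (simp add: m_assoc)
  qed
  have multf: "?f \<otimes> (x \<otimes> y) = ?f \<otimes> x \<otimes> (?f \<otimes> y)" if "x \<in> carrier R" "y \<in> carrier R" for x y
  proof -
    have "?f \<otimes> x \<otimes> (?f \<otimes> y) = ?f \<otimes> (x \<otimes> y) \<ominus> ?f \<otimes> (x \<otimes> e) \<otimes> y" using that e(1) by algebra
    also have "x \<otimes> e = e \<otimes> x" using e(3) that by simp
    also have "?f \<otimes> (e \<otimes> x) = \<zero>" using fe that by simp
    finally show ?thesis using that f by (simp add: a_minus_def)
  qed
  define h where "h r = (e \<otimes> r, ?f \<otimes> r)" for r
  have hom: "h \<in> ring_hom R (RDirProd (corner e) (corner ?f))"
  proof (rule ring_hom_memI)
    fix x y assume xy: "x \<in> carrier R" "y \<in> carrier R"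
    show "h x \<in> carrier (RDirProd (corner e) (corner ?f))"
      using xy by (auto simp: h_def RDirProd_carrier corner_def intro: lcosI)
    show "h (x \<otimes> y) = h x \<otimes>\<^bsub>RDirProd (corner e) (corner ?f)\<^esub> h y"
      using multe[OF xy] multf[OF xy] by (simp add: h_def RDirProd_def DirProd_def monoid.defs corner_def)
    show "h (x \<oplus> y) = h x \<oplus>\<^bsub>RDirProd (corner e) (corner ?f)\<^esub> h y"
      using xy e(1) f by (simp add: h_def RDirProd_def DirProd_def monoid.defs corner_def r_distr)
  next
    show "h \<one> = \<one>\<^bsub>RDirProd (corner e) (corner ?f)\<^esub>"
      using e(1) f by (simp add: h_def RDirProd_def DirProd_def monoid.defs corner_def)
  qed
  have inj: "inj_on h (carrier R)"
  proof (rule inj_onI)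
    fix x y assume xy: "x \<in> carrier R" "y \<in> carrier R" "h x = h y"
    have "x = e \<otimes> x \<oplus> ?f \<otimes> x" using sum[OF xy(1)] by (rule sym)
    also have "\<dots> = e \<otimes> y \<oplus> ?f \<otimes> y" using xy(3) unfolding h_def prod.inject by (elim conjE) (simp only:)
    also have "\<dots> = y" using sum[OF xy(2)] .
    finally show "x = y" .
  qed
  have surj: "carrier (RDirProd (corner e) (corner ?f)) \<subseteq> h ` carrier R"
  proof
    fix z assume "z \<in> carrier (RDirProd (corner e) (corner ?f))"
    then have "fst z \<in> e <# carrier R" "snd z \<in> ?f <# carrier R"
      by (auto simp: RDirProd_carrier corner_def)
    then obtain r s where rs: "r \<in> carrier R" "s \<in> carrier R" "fst z = e \<otimes> r" "snd z = ?f \<otimes> s"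
      by (auto simp: mem_lcos)
    have "h (e \<otimes> r \<oplus> ?f \<otimes> s) = (e \<otimes> r, ?f \<otimes> s)"
      unfolding h_def using rs(1,2) e(1) f
      by (simp add: r_distr ee[OF rs(1)] ff[OF rs(2)] ef[OF rs(2)] fe[OF rs(1)])
    also have "\<dots> = z" using rs(3,4) by (simp add: prod_eq_iff)
    finally show "z \<in> h ` carrier R" using rs e(1) f by (intro image_eqI[of z h "e \<otimes> r \<oplus> ?f \<otimes> s"]) simp_all
  qed
  have "h ` carrier R \<subseteq> carrier (RDirProd (corner e) (corner ?f))"
    using ring_hom_closed[OF hom] by auto
  then have "h \<in> ring_iso R (RDirProd (corner e) (corner ?f))"
    using hom inj surj by (auto simp: ring_iso_def bij_betw_def)
  then show ?thesis by (auto simp: is_ring_iso_def)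
qed

lemma irreducible_imp_prime:
  assumes irr: "irreducible_ring R" and a: "a \<in> carrier R" "a \<noteq> \<zero>" and b: "b \<in> carrier R" "b \<noteq> \<zero>"
  shows "\<exists>r\<in>carrier R. b \<otimes> r \<otimes> a \<noteq> \<zero>"
proof (rule ccontr)
  assume "\<not> ?thesis"
  then have ann: "\<And>r. r \<in> carrier R \<Longrightarrow> b \<otimes> r \<otimes> a = \<zero>" by auto
  obtain e where e: "e \<in> carrier R" "e \<otimes> e = e" "e \<noteq> \<zero>" "e \<noteq> \<one>" "\<And>r. r \<in> carrier R \<Longrightarrow> e \<otimes> r = r \<otimes> e"
    using central_idempotent_of_not_prime[OF a b ann] by metis
  let ?f = "\<one> \<ominus> e"
  have f: "?f \<in> carrier R" using e(1) by auto
  have "?f \<otimes> x = x \<ominus> e \<otimes> x" if "x \<in> carrier R" for x using that e(1) by algebra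
  then have "?f \<otimes> ?f = ?f \<ominus> e \<otimes> ?f" using f .
  moreover have "e \<otimes> ?f = \<zero>" using e(1,2) by (simp add: a_minus_def r_distr r_minus r_neg)
  ultimately have ff: "?f \<otimes> ?f = ?f" using f by (simp add: a_minus_def)
  have fr: "?f \<otimes> r = r \<otimes> ?f" if r: "r \<in> carrier R" for r
  proof -
    have "?f \<otimes> r = r \<ominus> e \<otimes> r" using r e(1) by algebra
    moreover have "r \<otimes> ?f = r \<ominus> r \<otimes> e" using r e(1) by (simp add: a_minus_def r_distr r_minus)
    ultimately show ?thesis using e(5)[OF r] by simp
  qed
  have fn: "?f \<noteq> \<zero>" using minus_zero_iff[OF one_closed e(1)] e(4) by auto
  have mem: "x \<in> carrier (corner x)" if "x \<in> carrier R" for x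
    using lcosI[of \<one> "carrier R" x] that by (simp add: corner_def)
  have "carrier (corner e) \<noteq> {\<zero>\<^bsub>corner e\<^esub>}" "carrier (corner ?f) \<noteq> {\<zero>\<^bsub>corner ?f\<^esub>}"
    using mem[OF e(1)] mem[OF f] e(3) fn by (auto simp: corner_zero)
  then show False
    using irr corner_ring[OF e(1,2,5)] corner_ring[OF f ff fr] corner_decomposition[OF e(1,2,5)]
    unfolding irreducible_ring_def by blast
qed

end

section \<open>Translation of the lattice axioms into statements about ideals\<close>

lemma prime_continuous_ringI:
  assumes cont: "continuous_ring R" and irr: "irreducible_ring R"
  shows "prime_continuous_ring R"
proof -
  have "regular_ring R" using cont by (simp add: continuous_ring_def)
  then interpret ring R by (simp add: regular_ring_def)
  define L where "L = principal_right_ideals R"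
  have car: "carrier L = PR" and le: "le L = (\<subseteq>)"
    by (auto simp: L_def principal_right_ideals_def PR_def)
  have "complete_lattice L" using cont by (simp add: continuous_ring_def L_def Let_def)
  then interpret L: complete_lattice L .
  have inf: "\<Sqinter>\<^bsub>L\<^esub>\<A> = \<Inter>\<A>" if \<A>: "\<A> \<subseteq> PR" "\<A> \<noteq> {}" for \<A>
  proof
    show "\<Sqinter>\<^bsub>L\<^esub>\<A> \<subseteq> \<Inter>\<A>" using L.inf_lower[of \<A>] \<A> by (auto simp: car le)
    show "\<Inter>\<A> \<subseteq> \<Sqinter>\<^bsub>L\<^esub>\<A>"
    proof
      fix x assume x: "x \<in> \<Inter>\<A>"
      then have xc: "x \<in> carrier R" using \<A> PR_closed by blast
      have "x <#\<^bsub>R\<^esub> carrier R \<subseteq> A" if A: "A \<in> \<A>" for A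
      proof -
        have "x \<in> A" "A \<in> PR" using A x \<A>(1) by auto
        then show ?thesis using PR_mult by (auto simp: mem_lcos)
      qed
      \<comment> \<open>\<open>x R\<close> is a lower bound of the family, so it lies below the
        infimum; hence the infimum contains every common element.\<close>
      then have "x <#\<^bsub>R\<^esub> carrier R \<subseteq> \<Sqinter>\<^bsub>L\<^esub>\<A>"
        using L.inf_greatest[of \<A> "x <#\<^bsub>R\<^esub> carrier R"] \<A>(1) PR_principal[OF xc] by (simp add: car le)
      moreover have "x \<in> x <#\<^bsub>R\<^esub> carrier R" using lcosI[of "\<one>\<^bsub>R\<^esub>" "carrier R" x] xc by simp
      ultimately show "x \<in> \<Sqinter>\<^bsub>L\<^esub>\<A>" by blast
    qed
  qed
  interpret complete_regular_ring R
  proof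
    show "\<exists>b\<in>carrier R. a \<otimes>\<^bsub>R\<^esub> b \<otimes>\<^bsub>R\<^esub> a = a" if "a \<in> carrier R" for a
      using \<open>regular_ring R\<close> that by (simp add: regular_ring_def)
    show "\<Inter>\<A> \<in> PR" if "\<A> \<subseteq> PR" "\<A> \<noteq> {}" for \<A>
      using L.inf_closed[of \<A>] inf[OF that] that by (simp add: car)
  qed
  have sup: "\<Squnion>\<^bsub>L\<^esub>\<A> = cl (\<Union>\<A>)" if \<A>: "\<A> \<subseteq> PR" for \<A>
  proof
    have "\<Union>\<A> \<subseteq> carrier R" using \<A> PR_subset by blast
    then have "cl (\<Union>\<A>) \<in> PR" by (rule cl_PR)
    moreover have "A \<subseteq> cl (\<Union>\<A>)" if "A \<in> \<A>" for A
      using Union_upper[OF that] cl_upper by (rule subset_trans)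
    ultimately show "\<Squnion>\<^bsub>L\<^esub>\<A> \<subseteq> cl (\<Union>\<A>)" using L.sup_least[of \<A> "cl (\<Union>\<A>)"] \<A> by (simp add: car le)
    have "A \<subseteq> \<Squnion>\<^bsub>L\<^esub>\<A>" if "A \<in> \<A>" for A using L.sup_upper[of \<A> A] \<A> that by (simp add: car le)
    then show "cl (\<Union>\<A>) \<subseteq> \<Squnion>\<^bsub>L\<^esub>\<A>" using L.sup_closed[of \<A>] \<A> by (intro cl_least) (auto simp: car)
  qed
  have meet: "I \<sqinter>\<^bsub>L\<^esub> J = I \<inter> J" if "I \<in> PR" "J \<in> PR" for I J
    using inf[of "{I, J}"] that by (simp add: meet_def)
  have join: "I \<squnion>\<^bsub>L\<^esub> J = I <+>\<^bsub>R\<^esub> J" if IJ: "I \<in> PR" "J \<in> PR" for I J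
  proof -
    have "cl (I \<union> J) = I <+>\<^bsub>R\<^esub> J"
    proof
      show "cl (I \<union> J) \<subseteq> I <+>\<^bsub>R\<^esub> J"
        using subset_set_add1[OF IJ] subset_set_add2[OF IJ] by (intro cl_least set_add_PR IJ) auto
      have "cl (I \<union> J) \<in> PR" using IJ PR_subset by (intro cl_PR) auto
      then show "I <+>\<^bsub>R\<^esub> J \<subseteq> cl (I \<union> J)"
        using cl_upper[of "I \<union> J"] by (intro set_add_least) auto
    qed
    then show ?thesis using sup[of "{I, J}"] IJ by (simp add: join_def)
  qed
  have ax: "I \<sqinter>\<^bsub>L\<^esub> (\<Squnion>\<^bsub>L\<^esub>\<C>) = \<Squnion>\<^bsub>L\<^esub>{I \<sqinter>\<^bsub>L\<^esub> J |J. J \<in> \<C>}"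
      "I \<squnion>\<^bsub>L\<^esub> (\<Sqinter>\<^bsub>L\<^esub>\<C>) = \<Sqinter>\<^bsub>L\<^esub>{I \<squnion>\<^bsub>L\<^esub> J |J. J \<in> \<C>}"
    if "subset.chain PR \<C>" "I \<in> PR" for \<C> I
    using cont that unfolding continuous_ring_def Let_def L_def[symmetric] car by blast+
  show ?thesis
  proof
    show "\<exists>r\<in>carrier R. b \<otimes>\<^bsub>R\<^esub> r \<otimes>\<^bsub>R\<^esub> a \<noteq> \<zero>\<^bsub>R\<^esub>"
      if "a \<in> carrier R" "b \<in> carrier R" "a \<noteq> \<zero>\<^bsub>R\<^esub>" "b \<noteq> \<zero>\<^bsub>R\<^esub>" for a b
      using irreducible_imp_prime[OF irr] that by auto
  next
    fix \<C> I assume C: "subset.chain PR \<C>" "\<C> \<noteq> {}" and I: "I \<in> PR" and z: "\<And>J. J \<in> \<C> \<Longrightarrow> I \<inter> J = {\<zero>\<^bsub>R\<^esub>}"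
    have sub: "\<C> \<subseteq> PR" using C by (simp add: subset_chain_def)
    \<comment> \<open>All meets with members of the non-empty chain collapse to the zero ideal, so
      the supremum of the meets is zero.\<close>
    have "{I \<sqinter>\<^bsub>L\<^esub> J |J. J \<in> \<C>} = {{\<zero>\<^bsub>R\<^esub>}}"
      using meet[OF I] z sub C(2) by (auto intro!: exI)
    then have "I \<sqinter>\<^bsub>L\<^esub> (\<Squnion>\<^bsub>L\<^esub>\<C>) = cl {\<zero>\<^bsub>R\<^esub>}" using ax(1)[OF C(1) I] sup[of "{{\<zero>\<^bsub>R\<^esub>}}"] zero_PR by simp
    moreover have "cl {\<zero>\<^bsub>R\<^esub>} = {\<zero>\<^bsub>R\<^esub>}" using cl_least[OF zero_PR order_refl] cl_upper by blast
    moreover have "cl (\<Union>\<C>) \<in> PR" using sub PR_subset by (intro cl_PR) blast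
    ultimately show "I \<inter> cl (\<Union>\<C>) = {\<zero>\<^bsub>R\<^esub>}" using sup[OF sub] meet[OF I] by simp
  next
    fix \<C> I X assume C: "subset.chain PR \<C>" "\<C> \<noteq> {}" and I: "I \<in> PR" and X: "X \<in> PR"
      and z: "\<And>J. J \<in> \<C> \<Longrightarrow> X \<subseteq> I <+>\<^bsub>R\<^esub> J"
    have sub: "\<C> \<subseteq> PR" using C by (simp add: subset_chain_def)
    let ?S = "{I \<squnion>\<^bsub>L\<^esub> J |J. J \<in> \<C>}"
    have join': "I \<squnion>\<^bsub>L\<^esub> J = I <+>\<^bsub>R\<^esub> J" "I <+>\<^bsub>R\<^esub> J \<in> PR" if "J \<in> \<C>" for J
      using join[OF I] set_add_PR[OF I] that sub by auto
    have S: "?S \<subseteq> PR" "?S \<noteq> {}" using join' C(2) by auto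
    have "I <+>\<^bsub>R\<^esub> \<Inter>\<C> = \<Inter>?S"
      using ax(2)[OF C(1) I] inf[OF sub C(2)] join[OF I Inter_PR[OF sub C(2)]] inf[OF S] by simp
    moreover have "X \<subseteq> \<Inter>?S" using z join' by auto
    ultimately show "X \<subseteq> I <+>\<^bsub>R\<^esub> \<Inter>\<C>" by simp
  qed
qed

section \<open>Escape functions on the image of the unit group\<close>

context prime_continuous_ring
begin

context
  fixes D assumes D: "dimension_function D" and rk: "\<And>a. a \<in> carrier R \<Longrightarrow> rk R a = D (a <# carrier R)"
begin

text \<open>Without such an ideal, \<open>rank_dist R x y < e\<close> forces
  \<open>(x - y) R = 0\<close>, so balls of radius \<open>e\<close> have at most one point.\<close>

lemma nondiscrete_small_ideals:
  assumes nd: "nondiscrete_ring R" and e: "0 < e"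
  shows "\<exists>A\<in>PR. A \<noteq> {\<zero>} \<and> D A < e"
proof (rule ccontr)
  assume n: "\<not> ?thesis"
  interpret M: Metric_space "carrier R" "rank_dist R" using Metric_space_rank_dist[OF D rk] .
  have ball: "M.mball x e \<subseteq> {x}" for x
  proof
    fix y assume y: "y \<in> M.mball x e"
    then have c: "x \<in> carrier R" "y \<in> carrier R" "rank_dist R x y < e" by (auto simp: M.in_mball)
    let ?A = "(x \<ominus> y) <# carrier R"
    have "D ?A < e" using c by (simp add: rank_dist_def rk)
    moreover have "?A \<in> PR" using PR_principal c by auto
    ultimately have "?A = {\<zero>}" using n by blast
    then have "x \<ominus> y = \<zero>" using mem_principal[of "x \<ominus> y"] c by auto
    then show "y \<in> {x}" using minus_zero_iff c by auto
  qed
  have "rank_topology R = discrete_topology (carrier R)"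
    unfolding rank_topology_def topology_eq openin_discrete_topology M.openin_mtopology
    using ball e by blast
  then show False using nd by (simp add: nondiscrete_ring_def)
qed

text \<open>From \<open>u^(k+1) - 1 = (u^k - 1) u + (u - 1)\<close>. The rank distance of all powers
  to \<open>1\<close> is thus bounded uniformly in \<open>k\<close>.\<close>

lemma pow_minus_one_mem:
  assumes u: "u \<in> carrier R" shows "u [^] (k::nat) \<ominus> \<one> \<in> (u \<ominus> \<one>) <# carrier R"
proof (induction k)
  case 0
  show ?case using PR_zero[OF PR_principal, of "u \<ominus> \<one>"] u by (simp add: a_minus_def r_neg)
next
  case (Suc k)
  let ?I = "(u \<ominus> \<one>) <# carrier R"
  have I: "?I \<in> PR" using PR_principal u by auto
  have c: "u [^] k \<in> carrier R" using u by simp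
  have "u [^] Suc k \<ominus> \<one> = (u [^] k \<ominus> \<one>) \<otimes> u \<oplus> (u \<ominus> \<one>)"
    using u c by (simp add: a_minus_def l_distr l_minus a_assoc) (simp add: l_neg r_neg1 r_neg2)
  then show ?case using PR_add[OF I PR_mult[OF I Suc u]] mem_principal u by simp
qed

lemma length_vanishes:
  assumes H: "topological_group H T" and phi: "\<phi> \<in> hom (units_of R) H"
    and cont: "continuous_map (GL_topology R) T \<phi>" and nd: "nondiscrete_ring R"
    and f: "escape_function H T f" and x: "x \<in> Units R"
  shows "f (\<phi> x) = 0"
proof -
  interpret H: group H using H by (simp add: topological_group_def)
  interpret M: Metric_space "carrier R" "rank_dist R" using Metric_space_rank_dist[OF D rk] .
  interpret U: group "units_of R" by (rule units_group)
  have car: "\<phi> y \<in> carrier H" if "y \<in> Units R" for y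
    using phi that by (auto simp: hom_def units_of_def)
  have mult: "\<phi> (y \<otimes> z) = \<phi> y \<otimes>\<^bsub>H\<^esub> \<phi> z" if "y \<in> Units R" "z \<in> Units R" for y z
    using phi that by (auto simp: hom_def units_of_def)
  have one: "\<phi> \<one> = \<one>\<^bsub>H\<^esub>" using hom_one[OF phi units_group H.group_axioms] by (simp add: units_of_def)
  have Units_pow: "y [^] k \<in> Units R" if "y \<in> Units R" for y and k :: nat
    by (induction k) (use that in auto)
  have pow: "\<phi> (y [^] (k::nat)) = \<phi> y [^]\<^bsub>H\<^esub> k" if y: "y \<in> Units R" for y k
    by (induction k) (use y one mult Units_pow in auto)
  have len: "f \<one>\<^bsub>H\<^esub> = 0" "\<And>y. y \<in> carrier H \<Longrightarrow> 0 \<le> f y"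
    "\<And>y z. y \<in> carrier H \<Longrightarrow> z \<in> carrier H \<Longrightarrow> f (y \<otimes>\<^bsub>H\<^esub> z) \<le> f y + f z"
    using f by (auto simp: escape_function_def length_function_def)
  obtain N where N: "escape_neighborhood H T f N" using f by (auto simp: escape_function_def)
  then obtain W where W: "openin T W" "\<one>\<^bsub>H\<^esub> \<in> W" "W \<subseteq> N"
    by (auto simp: escape_neighborhood_def identity_neighborhood_def)
  have top: "topspace (GL_topology R) = Units R"
    unfolding GL_topology_def rank_topology_def topspace_subtopology M.topspace_mtopology
    using Units_closed by blast
  have "openin (GL_topology R) {y \<in> Units R. \<phi> y \<in> W}"
    using openin_continuous_map_preimage[OF cont W(1)] by (simp add: top)
  then obtain O' where O': "openin (rank_topology R) O'" "{y \<in> Units R. \<phi> y \<in> W} = O' \<inter> Units R"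
    unfolding GL_topology_def openin_subtopology by blast
  have "\<one> \<in> {y \<in> Units R. \<phi> y \<in> W}" using one W(2) by simp
  then have "\<one> \<in> O'" unfolding O'(2) by simp
  then obtain d where d: "0 < d" "M.mball \<one> d \<subseteq> O'"
    using O'(1) unfolding rank_topology_def M.openin_mtopology by blast
  have near: "f (\<phi> u) = 0" if u: "u \<in> Units R" and small: "D ((u \<ominus> \<one>) <# carrier R) < d" for u
  proof -
    have uc: "u \<in> carrier R" using u by auto
    have inN: "\<phi> u [^]\<^bsub>H\<^esub> (k::nat) \<in> N" for k
    proof -
      have c: "u [^] k \<in> carrier R" using uc by simp
      have P: "(u \<ominus> \<one>) <# carrier R \<in> PR" using PR_principal uc by auto
      have "D ((u [^] k \<ominus> \<one>) <# carrier R) \<le> D ((u \<ominus> \<one>) <# carrier R)"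
        using c by (intro dim_mono[OF D] PR_principal P principal_subset pow_minus_one_mem uc) auto
      then have "rank_dist R (u [^] k) \<one> < d" using c small by (simp add: rank_dist_def rk)
      then have "u [^] k \<in> M.mball \<one> d" using c by (simp add: M.in_mball M.commute)
      then have "u [^] k \<in> O' \<inter> Units R" using d(2) Units_pow[OF u, of k] by blast
      then have "\<phi> (u [^] k) \<in> W" unfolding O'(2)[symmetric] by simp
      then show ?thesis using W(3) pow[OF u] by auto
    qed
    \<comment> \<open>The number \<open>n\<close> of powers to be tested grows with the accuracy
      \<open>e\<close>, but all powers of \<open>\<phi> u\<close> lie in \<open>N\<close>, so every
      \<open>e\<close> is reached.\<close>
    have "f (\<phi> u) \<le> 0"
    proof (rule field_le_epsilon)
      fix e :: real assume "0 < e"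
      then obtain n :: nat where
        "{y \<in> carrier H. \<forall>k\<in>{1..n}. y [^]\<^bsub>H\<^esub> k \<in> N} \<subseteq> {y \<in> carrier H. f y \<in> {0..<e}}"
        using N unfolding escape_neighborhood_def by blast
      then have "f (\<phi> u) \<in> {0..<e}" using inN car[OF u] by blast
      then show "f (\<phi> u) \<le> 0 + e" by simp
    qed
    then show ?thesis using len(2)[OF car[OF u]] by simp
  qed
  have "Units R \<subseteq> {y \<in> Units R. f (\<phi> y) = 0}"
  proof (rule units_generated[OF D nondiscrete_small_ideals[OF nd] d(1)])
    show "\<one> \<in> {y \<in> Units R. f (\<phi> y) = 0}" using one len(1) by simp
    show "y \<otimes> z \<in> {y \<in> Units R. f (\<phi> y) = 0}"
      if "y \<in> {y \<in> Units R. f (\<phi> y) = 0}" "z \<in> {y \<in> Units R. f (\<phi> y) = 0}" for y z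
    proof -
      have yz: "y \<in> Units R" "z \<in> Units R" "f (\<phi> y) = 0" "f (\<phi> z) = 0" using that by auto
      have "f (\<phi> (y \<otimes> z)) \<le> 0" using mult[OF yz(1,2)] len(3)[OF car[OF yz(1)] car[OF yz(2)]] yz by simp
      then show ?thesis using len(2)[OF car] yz by (auto intro: antisym)
    qed
  qed (use near in auto)
  then show ?thesis using x by blast
qed

end

end

theorem corollary6p9:
  fixes R :: "('a, 'm) ring_scheme"
    and H :: "('h, 'n) monoid_scheme"
    and T :: "'h topology"
    and \<phi> :: "'a \<Rightarrow> 'h"
  assumes "continuous_ring R"
    and "irreducible_ring R"
    and "nondiscrete_ring R"
    and "topological_group H T"
    and "Hausdorff_space T"
    and "escape_property H T"
    and "\<phi> \<in> hom (units_of R) H"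
    and "continuous_map (GL_topology R) T \<phi>"
  shows "\<forall>x\<in>carrier (units_of R). \<phi> x = \<one>\<^bsub>H\<^esub>"
proof -
  interpret prime_continuous_ring R using prime_continuous_ringI[OF assms(1,2)] .
  obtain D where D: "dimension_function D" "\<And>a. a \<in> carrier R \<Longrightarrow> rk R a = D (a <#\<^bsub>R\<^esub> carrier R)"
    using rk_dimension assms(2) unfolding irreducible_ring_def by metis
  have top: "topspace T = carrier H" and grp: "group H" using assms(4) by (auto simp: topological_group_def)
  show ?thesis
  proof (rule ccontr)
    assume "\<not> ?thesis"
    then obtain x where x: "x \<in> Units R" "\<phi> x \<noteq> \<one>\<^bsub>H\<^esub>" by (auto simp: units_of_def)
    have "\<phi> x \<in> carrier H" using assms(7) x(1) by (auto simp: hom_def units_of_def)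
    moreover have "\<one>\<^bsub>H\<^esub> \<in> carrier H" using grp by (simp add: group.is_monoid)
    ultimately obtain V W where V: "openin T V" "openin T W" "\<one>\<^bsub>H\<^esub> \<in> V" "\<phi> x \<in> W" "disjnt V W"
      using assms(5) x(2) unfolding Hausdorff_space_def top by metis
    \<comment> \<open>\<open>V\<close> misses \<open>\<phi> x\<close>, whereas an escape function
      whose unit ball lies in \<open>V\<close> vanishes at \<open>\<phi> x\<close> and so puts it
      there.\<close>
    have "identity_neighborhood H T V"
      using V openin_subset[OF V(1)] unfolding identity_neighborhood_def top by blast
    then obtain f where f: "escape_function H T f" "{y \<in> carrier H. f y \<in> {0..<1}} \<subseteq> V"
      using assms(6) unfolding escape_property_def by blast
    have "f (\<phi> x) = 0" using length_vanishes[OF D assms(4,7,8,3) f(1) x(1)] .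
    then have "\<phi> x \<in> V" using f(2) \<open>\<phi> x \<in> carrier H\<close> by auto
    then show False using V by (auto simp: disjnt_iff)
  qed
qed

end
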